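(* There exists an absolute constant $c>0$ such that for all integers $g\geq 0$ and $d\geq 8$, there are infinitely many integers $n$ for which there is an $n$-vertex $(g,d)$-map graph with treewidth at least $c\sqrt{(g+1)dn}$ and layered treewidth at least $c\,(g+1)d$.
   Context: The Euler genus of the orientable surface with $h$ handles is $2h$; the Euler genus of the non-orientable surface with $c$ cross-caps is $c$. A $(g,d)$-map graph is defined as follows. Start with a graph $G_0$ embedded (without crossings) in a surface of Euler genus at most $g$, with each face labelled a "nation" or a "lake", where each vertex of $G_0$ is incident with at most $d$ nations. Let $G$ be the graph whose vertices are the nations of $G_0$, where two vertices are adjacent in $G$ if the corresponding faces of $G_0$ share a vertex. Then $G$ is called a $(g,d)$-map graph. Treewidth is the usual one: the minimum, over all tree-decompositions, of (maximum bag size) $-1$. A layering of a graph $G$ is a partition $(V_0,V_1,\dots,V_t)$ of $V(G)$ such that for every edge $vw\in E(G)$, if $v\in V_i$ and $w\in V_j$, then $|i-j|\leq 1$; each $V_i$ is called a layer. The layered width of a tree-decomposition $(B_x:x\in V(T))$ of $G$ is the minimum integer $\ell$ such that, for some layering $(V_0,V_1,\dots,V_t)$ of $G$, each bag $B_x$ contains at most $\ell$ vertices in each layer $V_i$. The layered treewidth of $G$ is the minimum layered width of a tree-decomposition of $G$. *)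

theory Defs
  imports "HOL-Analysis.Analysis"
begin

section \<open>Finite simple graphs, trees, treewidth\<close>

definition simple_graph :: "'a set \<Rightarrow> 'a set set \<Rightarrow> bool" where
  "simple_graph V E \<longleftrightarrow> finite V \<and> (\<forall>e\<in>E. e \<subseteq> V \<and> card e = 2)"

definition connected_graph :: "'a set \<Rightarrow> 'a set set \<Rightarrow> bool" where
  "connected_graph V E \<longleftrightarrow> V \<noteq> {} \<and> (\<forall>u\<in>V. \<forall>v\<in>V. (\<lambda>x y. {x, y} \<in> E)\<^sup>*\<^sup>* u v)"

text \<open>A cycle is given by the list of its vertices, without repeating the first one at the end.\<close>

definition graph_cycle :: "'a set set \<Rightarrow> 'a list \<Rightarrow> bool" where
  "graph_cycle E xs \<longleftrightarrow> length xs \<ge> 3 \<and> distinct xs \<and>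
     (\<forall>i<length xs. {xs ! i, xs ! (Suc i mod length xs)} \<in> E)"

definition tree :: "'a set \<Rightarrow> 'a set set \<Rightarrow> bool" where
  "tree V E \<longleftrightarrow> simple_graph V E \<and> connected_graph V E \<and> (\<nexists>xs. graph_cycle E xs)"

definition tree_decomposition ::
    "'a set \<Rightarrow> 'a set set \<Rightarrow> 't set \<Rightarrow> 't set set \<Rightarrow> ('t \<Rightarrow> 'a set) \<Rightarrow> bool" where
  "tree_decomposition V E T F B \<longleftrightarrow>
     tree T F \<and>
     (\<forall>x\<in>T. B x \<subseteq> V) \<and>
     (\<forall>e\<in>E. \<exists>x\<in>T. e \<subseteq> B x) \<and>
     (\<forall>v\<in>V. connected_graph {x\<in>T. v \<in> B x} {e\<in>F. e \<subseteq> {x\<in>T. v \<in> B x}})"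

text \<open>Every finite tree is isomorphic to one whose nodes are natural numbers. The value is an
  integer because the empty graph has treewidth \<open>-1\<close>.\<close>

definition treewidth :: "'a set \<Rightarrow> 'a set set \<Rightarrow> int" where
  "treewidth V E =
     int (LEAST k. \<exists>(T :: nat set) F B. tree_decomposition V E T F B \<and>
       k = Max ((\<lambda>x. card (B x)) ` T)) - 1"

definition layering :: "'a set \<Rightarrow> 'a set set \<Rightarrow> nat \<Rightarrow> (nat \<Rightarrow> 'a set) \<Rightarrow> bool" where
  "layering V E t L \<longleftrightarrow>
     (\<Union>i\<le>t. L i) = V \<and> disjoint_family_on L {..t} \<and>
     (\<forall>v w i j. {v, w} \<in> E \<and> i \<le> t \<and> j \<le> t \<and> v \<in> L i \<and> w \<in> L j \<longrightarrow> \<bar>int i - int j\<bar> \<le> 1)"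

definition layered_width ::
    "'a set \<Rightarrow> 'a set set \<Rightarrow> 't set \<Rightarrow> ('t \<Rightarrow> 'a set) \<Rightarrow> nat" where
  "layered_width V E T B =
     (LEAST l. \<exists>t L. layering V E t L \<and> (\<forall>x\<in>T. \<forall>i\<le>t. card (B x \<inter> L i) \<le> l))"

definition layered_treewidth :: "'a set \<Rightarrow> 'a set set \<Rightarrow> nat" where
  "layered_treewidth V E =
     (LEAST k. \<exists>(T :: nat set) F B. tree_decomposition V E T F B \<and> k = layered_width V E T B)"

section \<open>Closed surfaces and their Euler genus\<close>

text \<open>
  A surface is obtained from the unit sphere by removing \<open>k\<close> open spherical caps whose closures
  are pairwise disjoint and then gluing the boundary circles. Cap \<open>i\<close> has centre \<open>p i\<close> and
  consists of the points at height greater than \<open>s i\<close> in the direction \<open>p i\<close>.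
\<close>

definition cap_circle :: "real^3 \<Rightarrow> real \<Rightarrow> (real^3) set" where
  "cap_circle a t = {x \<in> sphere 0 1. x \<bullet> a = t}"

definition disjoint_caps :: "nat \<Rightarrow> (nat \<Rightarrow> real^3) \<Rightarrow> (nat \<Rightarrow> real) \<Rightarrow> bool" where
  "disjoint_caps k p s \<longleftrightarrow>
     (\<forall>i<k. norm (p i) = 1 \<and> -1 < s i \<and> s i < 1) \<and>
     (\<forall>i<k. \<forall>j<k. i \<noteq> j \<longrightarrow>
        {x \<in> sphere 0 1. x \<bullet> p i \<ge> s i} \<inter> {x \<in> sphere 0 1. x \<bullet> p j \<ge> s j} = {})"

definition holed_sphere :: "nat \<Rightarrow> (nat \<Rightarrow> real^3) \<Rightarrow> (nat \<Rightarrow> real) \<Rightarrow> (real^3) set" where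
  "holed_sphere k p s = {x \<in> sphere 0 1. \<forall>i<k. x \<bullet> p i \<le> s i}"

definition glued_space :: "(real^3) set \<Rightarrow> (real^3 \<Rightarrow> real^3 \<Rightarrow> bool) \<Rightarrow> 'a topology \<Rightarrow> bool" where
  "glued_space S R X \<longleftrightarrow>
     (\<exists>q. quotient_map (top_of_set S) X q \<and>
        (\<forall>x\<in>S. \<forall>y\<in>S. q x = q y \<longleftrightarrow> x = y \<or> R x y \<or> R y x))"

text \<open>
  A handle joins the boundary circles of two caps of equal size. The gluing map is the
  reflection of the sphere that exchanges the two centres. It preserves the sphere with the two
  caps removed, exchanges the two circles and reverses orientation, so the two circles
  are identified with opposite boundary orientations and the result is orientable.
\<close>

definition swap_reflection :: "real^3 \<Rightarrow> real^3 \<Rightarrow> real^3 \<Rightarrow> real^3" where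
  "swap_reflection a b x = x - (2 * (x \<bullet> (a - b)) / ((a - b) \<bullet> (a - b))) *\<^sub>R (a - b)"

definition sphere_with_handles :: "nat \<Rightarrow> 'a topology \<Rightarrow> bool" where
  "sphere_with_handles h X \<longleftrightarrow>
     (\<exists>p s. disjoint_caps (2 * h) p s \<and> (\<forall>i<h. s (2 * i) = s (2 * i + 1)) \<and>
        glued_space (holed_sphere (2 * h) p s)
          (\<lambda>x y. \<exists>i<h. x \<in> cap_circle (p (2 * i)) (s (2 * i)) \<and>
             y = swap_reflection (p (2 * i)) (p (2 * i + 1)) x) X)"

text \<open>A cross-cap identifies antipodal points of the boundary circle of a cap. The half turn
  about the axis through \<open>a\<close> sends \<open>x\<close> to \<open>2(x \<bullet> a)a - x\<close>.\<close>

definition sphere_with_crosscaps :: "nat \<Rightarrow> 'a topology \<Rightarrow> bool" where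
  "sphere_with_crosscaps c X \<longleftrightarrow>
     (\<exists>p s. disjoint_caps c p s \<and>
        glued_space (holed_sphere c p s)
          (\<lambda>x y. \<exists>i<c. x \<in> cap_circle (p i) (s i) \<and> y = (2 * (x \<bullet> p i)) *\<^sub>R p i - x) X)"

definition surface_of_euler_genus :: "nat \<Rightarrow> 'a topology \<Rightarrow> bool" where
  "surface_of_euler_genus k X \<longleftrightarrow>
     (\<exists>h. k = 2 * h \<and> sphere_with_handles h X) \<or>
     (k \<ge> 1 \<and> sphere_with_crosscaps k X)"

section \<open>Embedded graphs and map graphs\<close>

text \<open>The vertices of an embedded graph are points of the surface. Each edge \<open>e\<close> is drawn as the
  simple arc \<open>\<gamma> e\<close> between its two ends.\<close>

definition embedded_graph ::
    "'a topology \<Rightarrow> 'a set \<Rightarrow> 'a set set \<Rightarrow> ('a set \<Rightarrow> real \<Rightarrow> 'a) \<Rightarrow> bool" where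
  "embedded_graph X V E \<gamma> \<longleftrightarrow>
     simple_graph V E \<and> V \<subseteq> topspace X \<and>
     (\<forall>e\<in>E. embedding_map (top_of_set {0..1}) X (\<gamma> e) \<and> {\<gamma> e 0, \<gamma> e 1} = e \<and>
        \<gamma> e ` {0<..<1} \<inter> V = {}) \<and>
     (\<forall>e\<in>E. \<forall>f\<in>E. e \<noteq> f \<longrightarrow> \<gamma> e ` {0<..<1} \<inter> \<gamma> f ` {0<..<1} = {})"

definition embedding_faces ::
    "'a topology \<Rightarrow> 'a set \<Rightarrow> 'a set set \<Rightarrow> ('a set \<Rightarrow> real \<Rightarrow> 'a) \<Rightarrow> 'a set set" where
  "embedding_faces X V E \<gamma> =
     connected_components_of (subtopology X (topspace X - (V \<union> (\<Union>e\<in>E. \<gamma> e ` {0..1}))))"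

text \<open>
  \<open>(V, E)\<close> is a \<open>(g, d)\<close>-map graph if it is isomorphic, via \<open>f\<close>, to the graph on the set \<open>N\<close> of
  nations. A vertex is incident with a face if it lies in the closure of the face.
  The points of \<open>X\<close> have type \<^typ>\<open>(real^3) set\<close>, which contains the
  equivalence classes of every gluing, so every surface occurs up to homeomorphism.
\<close>

definition map_graph :: "nat \<Rightarrow> nat \<Rightarrow> 'b set \<Rightarrow> 'b set set \<Rightarrow> bool" where
  "map_graph g d V E \<longleftrightarrow>
     simple_graph V E \<and>
     (\<exists>(X :: (real^3) set topology) k V0 E0 \<gamma> N f.
        k \<le> g \<and> surface_of_euler_genus k X \<and> embedded_graph X V0 E0 \<gamma> \<and>
        N \<subseteq> embedding_faces X V0 E0 \<gamma> \<and>
        (\<forall>x\<in>V0. card {F\<in>N. x \<in> X closure_of F} \<le> d) \<and>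
        bij_betw f V N \<and>
        (\<forall>u\<in>V. \<forall>v\<in>V. {u, v} \<in> E \<longleftrightarrow>
           u \<noteq> v \<and> (\<exists>x\<in>V0. x \<in> X closure_of (f u) \<and> x \<in> X closure_of (f v))))"

end

theory Submission
  imports Defs "HOL-Library.Transitive_Closure_Table" "HOL-Combinatorics.Permutations"
begin

text \<open>
  Draw a cyclic grid with \<open>s\<close> rows around the northern half of the sphere and replace each of its
  edges by \<open>m\<close> parallel lens-shaped nations, where \<open>m\<close> is about \<open>d / 8\<close>; one further nation covers
  the north pole and touches every column. The lower ends of the columns lie on the boundary
  circles of caps centred on the equator, \<open>s\<close> on each circle. A handle glues two circles by a
  reflection and identifies these ends in mirrored order, so it acts as a bundle of \<open>s\<close> wires
  between two sectors of the grid. The sectors are grouped into \<open>k\<close> blocks, \<open>k\<close> about \<open>g / 70\<close>, and a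
  counting argument gives a wiring by handles for which the blocks form an expander.

  A set of at most \<open>k s m / 40\<close> nations spoils few blocks; the undamaged rows and columns in a
  large connected group of the other blocks form a connected set that avoids it. Any two sets
  obtained in this way intersect, so by the Helly property of subtrees every
  tree-decomposition has a bag with more than \<open>k s m / 40\<close> nations. As there are about
  \<open>140 k s\<^sup>2 m\<close> nations, this bound has the order of the square root of \<open>g d n\<close>. All nations are within distance
  \<open>s + 1\<close> of the polar one, so every layering has at most \<open>2 s + 3\<close> nonempty layers, and some layer
  meets the large bag in a number of nations of order \<open>k m\<close>.
\<close>

section \<open>Treewidth and brambles\<close>

text \<open>A grid with 70 k s columns but only s rows has treewidth of order s. The expander raises
  this to order k s, since a separator must now damage a constant fraction of the blocks, and the m
  lenses per edge multiply it by m. Keeping the depth at s lets the same graph serve the layered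
  bound: dividing k s m by the depth leaves k m. Each constant has one source. At most 4 grid edges
  meet in a point, so a vertex sees at most 4 m lenses and the polar nation, and 4 m + 1 \<le> d for
  m = d div 8. A block has 70 sectors, 35 for first and 35 for second ends of handles; 35 is what
  the union bound over pairs of sets of blocks needs. Spoiling a block takes s / 2 dead edges, each
  costing m / 2 nations, so k s m / 40 nations spoil at most k / 10 blocks; the connected group that
  remains exceeds 7 k / 10, hence more than half. The topological burden is to show that each lens
  is exactly one face. It is carried by a chart that is injective above height 0 except at the pole
  and along one seam; handles show only in the identifications at height 0.\<close>

definition joined_in :: "'a set set \<Rightarrow> 'a set \<Rightarrow> 'a \<Rightarrow> 'a \<Rightarrow> bool" where
  "joined_in E A = (\<lambda>u v. {u, v} \<in> E \<and> u \<in> A \<and> v \<in> A)\<^sup>*\<^sup>*"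

definition connected_within :: "'a set set \<Rightarrow> 'a set \<Rightarrow> bool" where
  "connected_within E A \<longleftrightarrow> A \<noteq> {} \<and> (\<forall>u\<in>A. \<forall>v\<in>A. joined_in E A u v)"

lemma joined_in_refl [simp]: "joined_in E A u u"
  by (simp add: joined_in_def)

lemma joined_in_edge: "{u, v} \<in> E \<Longrightarrow> u \<in> A \<Longrightarrow> v \<in> A \<Longrightarrow> joined_in E A u v"
  by (auto simp: joined_in_def)

lemma joined_in_trans: "joined_in E A u v \<Longrightarrow> joined_in E A v w \<Longrightarrow> joined_in E A u w"
  by (auto simp: joined_in_def)

lemma joined_in_sym: "joined_in E A u v \<Longrightarrow> joined_in E A v u"
  unfolding joined_in_def
proof (induction rule: rtranclp_induct)
  case (step y z)
  then have "{z, y} \<in> E \<and> z \<in> A \<and> y \<in> A"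
    by (simp add: insert_commute)
  then show ?case
    by (rule converse_rtranclp_into_rtranclp) (fact step.IH)
qed simp

lemma joined_in_mono: "joined_in E A u v \<Longrightarrow> E \<subseteq> E' \<Longrightarrow> A \<subseteq> A' \<Longrightarrow> joined_in E' A' u v"
  unfolding joined_in_def by (erule rtranclp_mono[THEN predicate2D, rotated]) auto

lemma joined_in_avoiding: "joined_in E (A - {x}) u v \<Longrightarrow> x \<in> e \<Longrightarrow> joined_in (E - {e}) A u v"
  unfolding joined_in_def by (erule rtranclp_mono[THEN predicate2D, rotated]) auto

lemma joined_in_mem: "joined_in E A u v \<Longrightarrow> u \<in> A \<Longrightarrow> v \<in> A"
  unfolding joined_in_def by (induction rule: rtranclp_induct) auto

text \<open>A walk in \<open>A\<close> that starts in \<open>D\<close> cannot leave \<open>D\<close>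
  when steps inside \<open>A\<close> do not. It turns connection inside a large set into connection
  inside a component.\<close>

lemma joined_in_closed:
  assumes "joined_in E A u v" "u \<in> D"
    and closed: "\<And>a b. a \<in> D \<Longrightarrow> {a, b} \<in> E \<Longrightarrow> a \<in> A \<Longrightarrow> b \<in> A \<Longrightarrow> b \<in> D"
  shows "joined_in E D u v"
proof -
  have "joined_in E D u v \<and> v \<in> D"
    using assms(1) unfolding joined_in_def[of E A]
  proof (induction rule: rtranclp_induct)
    case (step a b)
    then show ?case using closed[of a b] by (auto intro: joined_in_trans joined_in_edge)
  qed (use assms(2) in auto)
  then show ?thesis by simp
qed

lemma connected_graph_iff_within:
  "connected_graph A {e \<in> E. e \<subseteq> A} \<longleftrightarrow> connected_within E A"
proof -
  have "(\<lambda>x y. {x, y} \<in> {e \<in> E. e \<subseteq> A}) = (\<lambda>u v. {u, v} \<in> E \<and> u \<in> A \<and> v \<in> A)"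
    by auto
  then show ?thesis
    by (simp add: connected_graph_def connected_within_def joined_in_def)
qed

text \<open>A walk between the ends that avoids the edge shortens to a path, and the edge closes
  this path to a cycle.\<close>

lemma tree_edge_bridge:
  assumes tree: "tree T F" and e: "{x, y} \<in> F"
  shows "\<not> joined_in (F - {{x, y}}) T x y"
proof
  assume j: "joined_in (F - {{x, y}}) T x y"
  let ?r = "\<lambda>u v. {u, v} \<in> F - {{x, y}} \<and> u \<in> T \<and> v \<in> T"
  have sg: "\<And>e. e \<in> F \<Longrightarrow> card e = 2"
    using tree by (auto simp: tree_def simple_graph_def)
  have xy: "x \<noteq> y"
    using sg[OF e] by auto
  from j obtain xs where p: "rtrancl_path ?r x xs y"
    unfolding joined_in_def by (auto simp: rtranclp_eq_rtrancl_path)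
  then obtain ys where ys: "rtrancl_path ?r x ys y" and d: "distinct (x # ys)"
    by (rule rtrancl_path_distinct)
  have last: "ys \<noteq> []" "last ys = y"
    using ys xy by (auto elim: rtrancl_path.cases intro: rtrancl_path_last)
  have nth: "?r ((x # ys) ! i) (ys ! i)" if "i < length ys" for i
    using rtrancl_path_nth[OF ys] that by simp
  \<comment> \<open>A path of one step would be the removed edge itself. With two steps the closed
    path has the three vertices that \<open>graph_cycle\<close> demands.\<close>
  have len: "length ys \<ge> 2"
  proof (rule ccontr)
    assume "\<not> ?thesis"
    with last have "ys = [y]"
      by (cases ys) (auto simp: Suc_le_eq)
    with nth[of 0] show False
      by simp
  qed
  have "graph_cycle F (x # ys)"
    unfolding graph_cycle_def
  proof (intro conjI allI impI)
    show "3 \<le> length (x # ys)" using len by simp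
    show "distinct (x # ys)" by (fact d)
    fix i assume i: "i < length (x # ys)"
    show "{(x # ys) ! i, (x # ys) ! (Suc i mod length (x # ys))} \<in> F"
    proof (cases "i = length ys")
      case True
      then have "(x # ys) ! i = y"
        using last by (simp add: last_conv_nth nth_Cons')
      then show ?thesis using e True by (simp add: insert_commute)
    next
      case False
      then show ?thesis using nth[of i] i by simp
    qed
  qed
  with tree show False
    by (auto simp: tree_def)
qed

text \<open>Stop the walk just before it first reaches \<open>x\<close>.\<close>

lemma last_step_avoiding:
  assumes "joined_in F T u x" "u \<noteq> x" "u \<in> T"
  obtains y where "{y, x} \<in> F" "joined_in F (T - {x}) u y" "y \<in> T"
proof -
  have "joined_in F (T - {x}) u w \<or> (\<exists>y. {y, x} \<in> F \<and> joined_in F (T - {x}) u y \<and> y \<in> T)"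
    if "joined_in F T u w" for w
    using that[unfolded joined_in_def]
  proof (induction rule: rtranclp_induct)
    case (step y z)
    show ?case
    proof (cases "joined_in F (T - {x}) u y")
      case True
      then have "y \<in> T - {x}"
        using assms by (auto dest: joined_in_mem)
      with True step.hyps show ?thesis
        by (cases "z = x") (auto intro: joined_in_trans joined_in_edge)
    qed (use step.IH in auto)
  qed simp
  from this[OF assms(1)] show ?thesis
    using that assms(2,3) by (metis DiffD2 DiffI insertI1 joined_in_mem singletonD)
qed

text \<open>If no node is common, every node \<open>x\<close> misses some member \<open>f x\<close>,
  which lies in a single component \<open>D x\<close> of the tree without \<open>x\<close>. Choose
  \<open>x\<close> with \<open>D x\<close> smallest and step to the neighbour \<open>y\<close> of
  \<open>x\<close> in \<open>D x\<close>: then \<open>D y\<close> is a proper subset of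
  \<open>D x\<close>.\<close>

lemma subtrees_Helly:
  assumes tree: "tree T F"
    and sub: "\<And>S. S \<in> \<S> \<Longrightarrow> S \<subseteq> T \<and> connected_within F S"
    and meet: "\<And>S S'. S \<in> \<S> \<Longrightarrow> S' \<in> \<S> \<Longrightarrow> S \<inter> S' \<noteq> {}"
  shows "\<exists>x\<in>T. \<forall>S\<in>\<S>. x \<in> S"
proof (rule ccontr)
  assume "\<not> ?thesis"
  then have "\<forall>x\<in>T. \<exists>S\<in>\<S>. x \<notin> S" by blast
  then obtain f where f: "\<And>x. x \<in> T \<Longrightarrow> f x \<in> \<S> \<and> x \<notin> f x" by metis
  define D where "D x = {z \<in> T - {x}. \<exists>u\<in>f x. joined_in F (T - {x}) u z}" for x
  have finT: "finite T" and neT: "T \<noteq> {}" and conT: "\<And>u v. u \<in> T \<Longrightarrow> v \<in> T \<Longrightarrow> joined_in F T u v"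
  proof -
    show "finite T" "T \<noteq> {}"
      using tree by (auto simp: tree_def simple_graph_def connected_graph_def)
    have "{e \<in> F. e \<subseteq> T} = F"
      using tree by (auto simp: tree_def simple_graph_def)
    then have "connected_within F T"
      using tree connected_graph_iff_within[of T F] by (simp add: tree_def)
    then show "\<And>u v. u \<in> T \<Longrightarrow> v \<in> T \<Longrightarrow> joined_in F T u v"
      by (auto simp: connected_within_def)
  qed
  have inD: "joined_in F (T - {x}) u v \<and> v \<in> D x" if "x \<in> T" "u \<in> f x" "v \<in> f x" for x u v
  proof -
    have s: "f x \<subseteq> T - {x}" and c: "joined_in F (f x) u v"
      using sub f that by (fastforce simp: connected_within_def)+
    from joined_in_mono[OF c order_refl s] show ?thesis
      using that s by (auto simp: D_def)
  qed
  have D_conn: "joined_in F (T - {x}) z w" if x: "x \<in> T" and z: "z \<in> D x" and w: "w \<in> D x" for x z w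
  proof -
    obtain u v where "u \<in> f x" "joined_in F (T - {x}) u z" "v \<in> f x" "joined_in F (T - {x}) v w"
      using z w by (auto simp: D_def)
    then show ?thesis
      using inD[OF x] by (meson joined_in_sym joined_in_trans)
  qed
  obtain x where x: "x \<in> T" and xmin: "\<And>y. y \<in> T \<Longrightarrow> card (D x) \<le> card (D y)"
    using neT ex_has_least_nat[of "\<lambda>x. x \<in> T" _ "\<lambda>x. card (D x)"] by blast
  obtain u where u: "u \<in> f x"
    using meet f[OF x] by blast
  have uT: "u \<in> T" "u \<noteq> x"
    using u f[OF x] sub by auto
  obtain y where y: "{y, x} \<in> F" "joined_in F (T - {x}) u y" "y \<in> T"
    using last_step_avoiding[OF conT[OF uT(1) x] uT(2) uT(1)] by blast
  have yx: "y \<noteq> x"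
    using tree y(1) by (auto simp: tree_def simple_graph_def)
  have yD: "y \<in> D x"
    using u y yx by (auto simp: D_def)
  \<comment> \<open>Otherwise a node \<open>z\<close> common to \<open>f x\<close> and
    \<open>f y\<close> is joined to \<open>y\<close> without using \<open>x\<close> and to
    \<open>x\<close> without using \<open>y\<close>. Neither walk uses the edge between
    \<open>x\<close> and \<open>y\<close>, which is a bridge.\<close>
  have xD: "x \<notin> D y"
  proof
    assume xD: "x \<in> D y"
    obtain z where z: "z \<in> f x" "z \<in> f y"
      using meet f x y by (metis disjoint_iff)
    have e: "joined_in F (T - {x}) y z" "joined_in F (T - {y}) z x"
      using D_conn inD[OF x] inD[OF y(3)] x y yD xD z by blast+
    have "joined_in (F - {{x, y}}) T y z" "joined_in (F - {{x, y}}) T z x"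
      using e by (auto intro: joined_in_avoiding)
    then have "joined_in (F - {{x, y}}) T x y"
      by (meson joined_in_sym joined_in_trans)
    with tree_edge_bridge[OF tree, of x y] y(1) show False
      by (simp add: insert_commute)
  qed
  \<comment> \<open>Inside \<open>D y\<close>, which misses \<open>x\<close>, the node
    \<open>w\<close> reaches a neighbour of \<open>y\<close>. One more step reaches
    \<open>y\<close>, so \<open>w\<close> lies on the same side of \<open>x\<close> as
    \<open>y\<close>.\<close>
  have "D y \<subseteq> D x"
  proof
    fix w assume w: "w \<in> D y"
    obtain v where v: "v \<in> f y" using meet f[OF y(3)] by blast
    have vT: "v \<in> T" "v \<noteq> y"
      using v f[OF y(3)] sub by auto
    obtain y' where y': "{y', y} \<in> F" "joined_in F (T - {y}) v y'" "y' \<in> T"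
      using last_step_avoiding[OF conT[OF vT(1) y(3)] vT(2) vT(1)] by blast
    have "y' \<noteq> y"
      using tree y'(1) by (auto simp: tree_def simple_graph_def)
    then have y'D: "y' \<in> D y"
      using v y' by (auto simp: D_def)
    have "joined_in F (D y) w y'"
    proof (rule joined_in_closed)
      show "joined_in F (T - {y}) w y'"
        using D_conn y w y'D by blast
      show "w \<in> D y" by (fact w)
      fix a b assume ab: "a \<in> D y" "{a, b} \<in> F" "a \<in> T - {y}" "b \<in> T - {y}"
      then obtain u where "u \<in> f y" "joined_in F (T - {y}) u a"
        by (auto simp: D_def)
      with joined_in_trans[OF this(2) joined_in_edge[OF ab(2-4)]] show "b \<in> D y"
        using ab by (auto simp: D_def)
    qed
    then have "joined_in F (T - {x}) w y'"
      by (rule joined_in_mono) (use xD in \<open>auto simp: D_def\<close>)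
    moreover have "y' \<in> T - {x}"
      using y'D xD by (auto simp: D_def)
    ultimately have "joined_in F (T - {x}) w y"
      using y' y yx by (meson DiffI joined_in_edge joined_in_trans singletonD)
    then show "w \<in> D x"
      using joined_in_trans[OF y(2) joined_in_sym] u w xD by (auto simp: D_def)
  qed
  moreover have "y \<notin> D y" by (simp add: D_def)
  ultimately have "D y \<subset> D x" using yD by blast
  then have "card (D y) < card (D x)"
    by (intro psubset_card_mono) (use finT in \<open>auto simp: D_def\<close>)
  with xmin[OF y(3)] show False by simp
qed

text \<open>The nodes whose bags meet a connected set form a subtree: the nodes of one vertex are
  connected, and the ends of an edge share a bag. A vertex common to two sets gives the two subtrees
  a common node, so the Helly property applies.\<close>

lemma tree_decomposition_bag_meets:
  assumes td: "tree_decomposition V E T F B"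
    and con: "\<And>U. U \<in> \<U> \<Longrightarrow> U \<subseteq> V \<and> connected_within E U"
    and meet: "\<And>U U'. U \<in> \<U> \<Longrightarrow> U' \<in> \<U> \<Longrightarrow> U \<inter> U' \<noteq> {}"
  shows "\<exists>x\<in>T. \<forall>U\<in>\<U>. B x \<inter> U \<noteq> {}"
proof -
  define S where "S U = {x \<in> T. B x \<inter> U \<noteq> {}}" for U
  have node: "connected_within F {x \<in> T. v \<in> B x}" if "v \<in> V" for v
    using td that unfolding tree_decomposition_def connected_graph_iff_within by blast
  have S_conn: "connected_within F (S U)" if U: "U \<in> \<U>" for U
    unfolding connected_within_def
  proof (intro conjI ballI)
    have UV: "U \<subseteq> V" "U \<noteq> {}" using con[OF U] by (auto simp: connected_within_def)
    then show "S U \<noteq> {}"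
      using node unfolding connected_within_def S_def by blast
    have same: "joined_in F (S U) x y" if "v \<in> U" "x \<in> T" "y \<in> T" "v \<in> B x" "v \<in> B y" for v x y
      using node[of v] that UV unfolding connected_within_def
      by (intro joined_in_mono[of F "{x \<in> T. v \<in> B x}" x y F "S U"]) (auto simp: S_def)
    fix x y assume x: "x \<in> S U" and y: "y \<in> S U"
    obtain u v where uv: "u \<in> B x" "u \<in> U" "v \<in> B y" "v \<in> U" and xy: "x \<in> T" "y \<in> T"
      using x y by (auto simp: S_def)
    have "joined_in E U u v"
      using con[OF U] uv by (auto simp: connected_within_def)
    then have "\<forall>y\<in>T. v \<in> B y \<longrightarrow> joined_in F (S U) x y"
      unfolding joined_in_def[of E]
    proof (induction rule: rtranclp_induct)
      case base
      then show ?case using same uv xy by auto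
    next
      case (step a b)
      then have "{a, b} \<in> E" by simp
      then obtain z where "z \<in> T" "{a, b} \<subseteq> B z"
        using td unfolding tree_decomposition_def by meson
      then have z: "z \<in> T" "a \<in> B z" "b \<in> B z" by auto
      show ?case
      proof (intro ballI impI)
        fix y assume "y \<in> T" "b \<in> B y"
        moreover have "joined_in F (S U) x z" using step.IH z by auto
        ultimately show "joined_in F (S U) x y"
          using same[of b z y] step.hyps z by (auto intro: joined_in_trans)
      qed
    qed
    then show "joined_in F (S U) x y" using uv xy by auto
  qed
  have "\<exists>x\<in>T. \<forall>A\<in>S ` \<U>. x \<in> A"
  proof (rule subtrees_Helly)
    show "tree T F" using td by (simp add: tree_decomposition_def)
    fix A assume "A \<in> S ` \<U>"
    then show "A \<subseteq> T \<and> connected_within F A" using S_conn by (auto simp: S_def)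
  next
    fix A A' assume "A \<in> S ` \<U>" "A' \<in> S ` \<U>"
    then obtain U U' where U: "U \<in> \<U>" "U' \<in> \<U>" "A = S U" "A' = S U'" by auto
    then obtain v where "v \<in> U" "v \<in> U'" using meet by blast
    moreover from this have "connected_within F {x \<in> T. v \<in> B x}" using node con U by blast
    ultimately show "A \<inter> A' \<noteq> {}"
      using U unfolding connected_within_def S_def by blast
  qed
  then show ?thesis by (auto simp: S_def)
qed

text \<open>Some bag meets every \<open>U S\<close>. It cannot be small, since with \<open>S\<close>
  taken to be this bag itself, \<open>U S\<close> avoids it.\<close>

lemma large_bag:
  fixes w :: nat
  assumes td: "tree_decomposition V E T F B"
    and U: "\<And>S. S \<subseteq> V \<Longrightarrow> card S \<le> w \<Longrightarrow> U S \<subseteq> V - S \<and> connected_within E (U S)"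
    and meet: "\<And>S S'. S \<subseteq> V \<Longrightarrow> card S \<le> w \<Longrightarrow> S' \<subseteq> V \<Longrightarrow> card S' \<le> w \<Longrightarrow> U S \<inter> U S' \<noteq> {}"
  shows "\<exists>x\<in>T. w < card (B x)"
proof -
  have "\<exists>x\<in>T. \<forall>A\<in>U ` {S. S \<subseteq> V \<and> card S \<le> w}. B x \<inter> A \<noteq> {}"
    by (rule tree_decomposition_bag_meets[OF td]) (use U meet in blast)+
  then obtain x where x: "x \<in> T" "\<And>S. S \<subseteq> V \<Longrightarrow> card S \<le> w \<Longrightarrow> B x \<inter> U S \<noteq> {}"
    by auto
  have "B x \<subseteq> V" using td x by (auto simp: tree_decomposition_def)
  with U[of "B x"] x(2)[of "B x"] have "\<not> card (B x) \<le> w" by blast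
  then show ?thesis using x(1) not_le by blast
qed

text \<open>Makes the \<open>LEAST\<close> in the definitions of both widths range over a nonempty
  set.\<close>

lemma trivial_tree_decomposition:
  assumes "simple_graph V E"
  shows "tree_decomposition V E {0::nat} {} (\<lambda>_. V)"
proof -
  have "tree {0::nat} {}"
    by (auto simp: tree_def simple_graph_def connected_graph_def graph_cycle_def intro!: exI[of _ "0::nat"])
  then show ?thesis
    using assms by (auto simp: tree_decomposition_def simple_graph_def connected_graph_def)
qed

section \<open>From large bags to treewidth and layered treewidth\<close>

lemma treewidth_ge:
  fixes w :: nat
  assumes "simple_graph V E"
    and big: "\<And>(T :: nat set) F B. tree_decomposition V E T F B \<Longrightarrow> \<exists>x\<in>T. w < card (B x)"
  shows "int w \<le> treewidth V E"
proof -
  let ?P = "\<lambda>k. \<exists>(T :: nat set) F B. tree_decomposition V E T F B \<and> k = Max ((\<lambda>x. card (B x)) ` T)"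
  have "?P (LEAST k. ?P k)"
    by (rule LeastI_ex) (use trivial_tree_decomposition[OF assms(1)] in blast)
  then obtain T :: "nat set" and F B where td: "tree_decomposition V E T F B"
    and l: "(LEAST k. ?P k) = Max ((\<lambda>x. card (B x)) ` T)" by blast
  obtain x where x: "x \<in> T" "w < card (B x)" using big[OF td] by auto
  have "finite T" using td by (auto simp: tree_decomposition_def tree_def simple_graph_def)
  then have "card (B x) \<le> (LEAST k. ?P k)" unfolding l using x by (intro Max_ge) auto
  with x show ?thesis unfolding treewidth_def by linarith
qed

text \<open>Adjacent vertices lie in the same or in consecutive layers, so everything within
  distance \<open>D\<close> of \<open>a\<close> lies in the at most 2 D + 1 layers around that of
  \<open>a\<close>. The large bag is spread over these.\<close>

lemma layered_treewidth_ge: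
  fixes w D :: nat
  assumes G: "simple_graph V E"
    and big: "\<And>(T :: nat set) F B. tree_decomposition V E T F B \<Longrightarrow> \<exists>x\<in>T. w < card (B x)"
    and a: "a \<in> V" and dist: "\<And>v. v \<in> V \<Longrightarrow> \<exists>i\<le>D. ((\<lambda>x y. {x, y} \<in> E) ^^ i) a v"
  shows "w < (2 * D + 1) * layered_treewidth V E"
proof -
  let ?P = "\<lambda>k. \<exists>(T :: nat set) F B. tree_decomposition V E T F B \<and> k = layered_width V E T B"
  have "?P (layered_treewidth V E)"
    unfolding layered_treewidth_def
    by (rule LeastI_ex) (use trivial_tree_decomposition[OF G] in blast)
  then obtain T :: "nat set" and F B where td: "tree_decomposition V E T F B"
    and l: "layered_treewidth V E = layered_width V E T B" by blast
  have finV: "finite V" using G by (simp add: simple_graph_def)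
  have BV: "B x \<subseteq> V" if "x \<in> T" for x
    using td that by (auto simp: tree_decomposition_def)
  let ?Q = "\<lambda>l. \<exists>t L. layering V E t L \<and> (\<forall>x\<in>T. \<forall>i\<le>t. card (B x \<inter> L i) \<le> l)"
  have "?Q (layered_width V E T B)"
    unfolding layered_width_def
  proof (rule LeastI_ex, intro exI conjI ballI allI impI)
    show "layering V E 0 (\<lambda>_. V)" by (auto simp: layering_def disjoint_family_on_def)
    fix x i assume "x \<in> T" "i \<le> (0 :: nat)"
    then show "card (B x \<inter> V) \<le> card V" using finV by (intro card_mono) auto
  qed
  then obtain t L where L: "layering V E t L"
    and bd: "\<And>x i. x \<in> T \<Longrightarrow> i \<le> t \<Longrightarrow> card (B x \<inter> L i) \<le> layered_treewidth V E"
    unfolding l by blast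
  obtain x where x: "x \<in> T" "w < card (B x)" using big[OF td] by auto
  have cover: "\<exists>i\<le>t. v \<in> L i" if "v \<in> V" for v
    using L that by (auto simp: layering_def)
  obtain ia where ia: "ia \<le> t" "a \<in> L ia" using cover[OF a] by auto
  have sgE: "\<And>u v. {u, v} \<in> E \<Longrightarrow> u \<in> V \<and> v \<in> V"
    using G by (auto simp: simple_graph_def)
  have near: "\<exists>i\<le>t. v \<in> L i \<and> \<bar>int i - int ia\<bar> \<le> int n"
    if "((\<lambda>x y. {x, y} \<in> E) ^^ n) a v" for n v
    using that
  proof (induction n arbitrary: v)
    case 0
    then show ?case using ia by auto
  next
    case (Suc n)
    then obtain u where u: "((\<lambda>x y. {x, y} \<in> E) ^^ n) a u" "{u, v} \<in> E" by auto
    obtain i where i: "i \<le> t" "u \<in> L i" "\<bar>int i - int ia\<bar> \<le> int n" using Suc.IH[OF u(1)] by auto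
    obtain j where j: "j \<le> t" "v \<in> L j" using cover sgE[OF u(2)] by blast
    have "\<bar>int i - int j\<bar> \<le> 1"
      using L u(2) i j unfolding layering_def by blast
    with i(3) j show ?case by (intro exI[of _ j]) auto
  qed
  define I where "I = {i. i \<le> t \<and> \<bar>int i - int ia\<bar> \<le> int D}"
  have IJ: "int ` I \<subseteq> {int ia - int D .. int ia + int D}" by (auto simp: I_def)
  have finI: "finite I" by (simp add: I_def)
  have "card I = card (int ` I)" by (simp add: card_image)
  also have "\<dots> \<le> 2 * D + 1" using card_mono[OF _ IJ] by simp
  finally have cI: "card I \<le> 2 * D + 1" .
  have "B x \<subseteq> (\<Union>i\<in>I. B x \<inter> L i)"
  proof
    fix v assume v: "v \<in> B x"
    with BV x have "v \<in> V" by auto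
    then obtain n where n: "n \<le> D" "((\<lambda>x y. {x, y} \<in> E) ^^ n) a v" using dist by blast
    obtain i where "i \<le> t" "v \<in> L i" "\<bar>int i - int ia\<bar> \<le> int n" using near[OF n(2)] by blast
    with n v show "v \<in> (\<Union>i\<in>I. B x \<inter> L i)" by (auto simp: I_def)
  qed
  then have "card (B x) \<le> card (\<Union>i\<in>I. B x \<inter> L i)"
    by (intro card_mono) (use finI BV[OF x(1)] finV in \<open>auto intro: finite_subset\<close>)
  also have "\<dots> \<le> (\<Sum>i\<in>I. card (B x \<inter> L i))" by (rule card_UN_le[OF finI])
  also have "\<dots> \<le> (\<Sum>i\<in>I. layered_treewidth V E)"
    by (rule sum_mono) (use bd x in \<open>auto simp: I_def\<close>)
  also have "\<dots> \<le> (2 * D + 1) * layered_treewidth V E" using mult_right_mono[OF cI, of "layered_treewidth V E"] by simp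
  finally show ?thesis using x by simp
qed

section \<open>Expanding permutations\<close>

text \<open>Among permutations that keep \<open>A\<close> out of \<open>B\<close>, all positions
  outside \<open>A\<close> are hit by \<open>B\<close> equally often, by symmetry under
  transpositions. As each such permutation hits \<open>B\<close> from card B of these positions,
  \<open>a\<close> is sent into \<open>B\<close> in at least a fifth of the cases.\<close>

lemma card_permutations_avoiding_insert:
  fixes X :: "'a set"
  assumes X: "finite X" and A: "A \<subseteq> X" "a \<in> X - A" and B: "B \<subseteq> X" "card X \<le> 5 * card B"
  shows "5 * card {\<pi>. \<pi> permutes X \<and> \<pi> ` insert a A \<inter> B = {}} \<le> 4 * card {\<pi>. \<pi> permutes X \<and> \<pi> ` A \<inter> B = {}}"
proof -
  define P where "P = {\<pi>. \<pi> permutes X \<and> \<pi> ` A \<inter> B = {}}"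
  have finP: "finite P"
    unfolding P_def using finite_permutations[OF X] by (rule finite_subset[rotated]) auto
  define Q where "Q c = {\<pi> \<in> P. \<pi> c \<in> B}" for c
  have finX: "finite (X - A)" "finite A" "finite B" using X A B finite_subset by auto
  have eq: "card (Q c) = card (Q a)" if c: "c \<in> X - A" for c
  proof (rule bij_betw_same_card[of "\<lambda>\<pi>. \<pi> \<circ> Transposition.transpose a c"])
    have tp: "Transposition.transpose a c permutes X"
      using A c by (intro permutes_swap_id) auto
    have tz: "Transposition.transpose a c z = z" if "z \<in> A" for z
      using A c that by (auto simp: Transposition.transpose_def)
    have imp: "(\<lambda>\<pi>. \<pi> \<circ> Transposition.transpose a c) ` Q u \<subseteq> Q v" if "{u, v} = {a, c}" for u v
    proof
      fix \<rho> assume "\<rho> \<in> (\<lambda>\<pi>. \<pi> \<circ> Transposition.transpose a c) ` Q u"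
      then obtain \<pi> where \<pi>: "\<rho> = \<pi> \<circ> Transposition.transpose a c" "\<pi> permutes X" "\<pi> ` A \<inter> B = {}" "\<pi> u \<in> B"
        by (auto simp: Q_def P_def)
      have "\<rho> ` A = \<pi> ` A"
        unfolding \<pi>(1) by (rule image_cong) (simp_all add: tz)
      moreover have "\<rho> v = \<pi> u"
        using that unfolding \<pi>(1) by (auto simp: doubleton_eq_iff)
      ultimately show "\<rho> \<in> Q v"
        using \<pi> permutes_compose[OF tp \<pi>(2)] by (simp add: Q_def P_def)
    qed
    show "bij_betw (\<lambda>\<pi>. \<pi> \<circ> Transposition.transpose a c) (Q c) (Q a)"
      by (rule bij_betw_byWitness[where f' = "\<lambda>\<pi>. \<pi> \<circ> Transposition.transpose a c"])
        (use imp[of a c] imp[of c a] in \<open>auto simp: comp_assoc\<close>)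
  qed
  \<comment> \<open>Count the pairs of a position \<open>c\<close> outside \<open>A\<close> and a
    permutation in \<open>P\<close> that sends \<open>c\<close> into \<open>B\<close>. No element of
    \<open>B\<close> is the image of an element of \<open>A\<close>, so every permutation
    contributes exactly card B.\<close>
  have "(\<Sum>c\<in>X - A. card (Q c)) = (\<Sum>c\<in>X - A. \<Sum>\<pi>\<in>P. if \<pi> c \<in> B then 1 else 0)"
    unfolding Q_def using finP by (intro sum.cong refl) (simp add: sum.If_cases Int_def)
  also have "\<dots> = (\<Sum>\<pi>\<in>P. \<Sum>c\<in>X - A. if \<pi> c \<in> B then 1 else 0)" by (rule sum.swap)
  also have "\<dots> = (\<Sum>\<pi>\<in>P. card B)"
  proof (rule sum.cong[OF refl])
    fix \<pi> assume p: "\<pi> \<in> P"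
    then have perm: "\<pi> permutes X" and av: "\<pi> ` A \<inter> B = {}" by (auto simp: P_def)
    have "\<pi> ` {c \<in> X - A. \<pi> c \<in> B} = B"
    proof (intro equalityI subsetI)
      fix b assume b: "b \<in> B"
      then have "b \<in> \<pi> ` X" using B permutes_image[OF perm] by auto
      with b av show "b \<in> \<pi> ` {c \<in> X - A. \<pi> c \<in> B}" by auto
    qed auto
    moreover have "inj_on \<pi> {c \<in> X - A. \<pi> c \<in> B}" using permutes_inj[OF perm] inj_on_subset by blast
    ultimately have "card {c \<in> X - A. \<pi> c \<in> B} = card B" using card_image by metis
    then show "(\<Sum>c\<in>X - A. if \<pi> c \<in> B then 1 else 0) = card B"
      using finX by (simp add: sum.If_cases Int_def)
  qed
  finally have dc: "card (X - A) * card (Q a) = card P * card B" using eq by simp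
  have "card X * card P \<le> 5 * card B * card P" using B(2) by (rule mult_right_mono) simp
  also have "\<dots> = 5 * (card (X - A) * card (Q a))" using dc by (simp add: mult_ac)
  also have "\<dots> \<le> 5 * (card X * card (Q a))" using X by (intro mult_left_mono mult_right_mono card_mono) auto
  finally have "card X * card P \<le> card X * (5 * card (Q a))" by (simp add: mult_ac)
  moreover have "card X > 0" using X A by (auto simp: card_gt_0_iff)
  ultimately have "card P \<le> 5 * card (Q a)" by simp
  moreover have "card {\<pi>. \<pi> permutes X \<and> \<pi> ` insert a A \<inter> B = {}} + card (Q a) = card P"
  proof -
    have "P = {\<pi>. \<pi> permutes X \<and> \<pi> ` insert a A \<inter> B = {}} \<union> Q a"
      by (auto simp: P_def Q_def)
    moreover have "{\<pi>. \<pi> permutes X \<and> \<pi> ` insert a A \<inter> B = {}} \<inter> Q a = {}" by (auto simp: Q_def)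
    ultimately show ?thesis using finP by (metis card_Un_disjoint finite_Un)
  qed
  ultimately show ?thesis unfolding P_def by linarith
qed

text \<open>Adding the elements of \<open>A\<close> one at a time, each costs a factor 4/5.\<close>

lemma card_permutations_avoiding:
  fixes X :: "'a set"
  assumes X: "finite X" and A: "A \<subseteq> X" and B: "B \<subseteq> X" "card X \<le> 5 * card B"
  shows "5 ^ card A * card {\<pi>. \<pi> permutes X \<and> \<pi> ` A \<inter> B = {}} \<le> 4 ^ card A * fact (card X)"
  using finite_subset[OF A X] A
proof (induction A rule: finite_induct)
  case empty
  then show ?case using card_permutations[OF refl X] by simp
next
  case (insert a A)
  have "5 ^ card (insert a A) * card {\<pi>. \<pi> permutes X \<and> \<pi> ` insert a A \<inter> B = {}}
      = 5 ^ card A * (5 * card {\<pi>. \<pi> permutes X \<and> \<pi> ` insert a A \<inter> B = {}})"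
    using insert by simp
  also have "\<dots> \<le> 5 ^ card A * (4 * card {\<pi>. \<pi> permutes X \<and> \<pi> ` A \<inter> B = {}})"
    by (intro mult_left_mono card_permutations_avoiding_insert) (use X B insert in auto)
  also have "\<dots> \<le> 4 * (4 ^ card A * fact (card X))" using insert by simp
  finally show ?case using insert by simp
qed

text \<open>Each of \<open>k\<close> blocks consists of 35 consecutive numbers.\<close>

definition expanding :: "nat \<Rightarrow> (nat \<Rightarrow> nat) \<Rightarrow> bool" where
  "expanding k \<sigma> \<longleftrightarrow>
    (\<forall>A B. A \<subseteq> {..<k} \<longrightarrow> B \<subseteq> {..<k} \<longrightarrow> k \<le> 5 * card A \<longrightarrow> k \<le> 5 * card B \<longrightarrow>
      (\<exists>i<35 * k. i div 35 \<in> A \<and> \<sigma> i div 35 \<in> B))"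

text \<open>Union bound. There are at most 4^k pairs (A, B); the 35 numbers per block make
  \<open>up A\<close> have at least 35 k / 5 = 7 k elements, so a pair fails for at most a fraction
  (4/5)^(7 k) of the permutations. The sum is below 1 because 4^8 = 65536 < 78125 = 5^7.\<close>

lemma exists_expanding_permutation:
  fixes k :: nat
  assumes k: "k \<ge> 1"
  shows "\<exists>\<sigma>. \<sigma> permutes {..<35 * k} \<and> expanding k \<sigma>"
proof (rule ccontr)
  assume neg: "\<not> ?thesis"
  define X where "X = {..<35 * k}"
  define up where "up A = {i \<in> X. i div 35 \<in> A}" for A
  have card_up: "card (up A) = 35 * card A" if A: "A \<subseteq> {..<k}" for A
  proof -
    have "up A = (\<lambda>(a, b). 35 * a + b) ` (A \<times> {..<35})"
    proof (intro equalityI subsetI)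
      fix i assume "i \<in> up A"
      then show "i \<in> (\<lambda>(a, b). 35 * a + b) ` (A \<times> {..<35})"
        by (intro image_eqI[of _ _ "(i div 35, i mod 35)"]) (auto simp: up_def)
    qed (use A in \<open>force simp: up_def X_def\<close>)
    moreover have "inj_on (\<lambda>(a, b). 35 * a + b :: nat) (A \<times> {..<35})"
      by (rule inj_on_inverseI[where g = "\<lambda>i. (i div 35, i mod 35)"]) auto
    ultimately show ?thesis by (simp add: card_image card_cartesian_product)
  qed
  have finX: "finite X" "card X = 35 * k" by (auto simp: X_def)
  define Bad where "Bad A B = {\<pi>. \<pi> permutes X \<and> \<pi> ` up A \<inter> up B = {}}" for A B
  have finBad: "finite (Bad A B)" for A B
    unfolding Bad_def using finite_permutations[OF finX(1)] by (rule finite_subset[rotated]) auto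
  define Pr where "Pr = {(A, B). A \<subseteq> {..<k} \<and> B \<subseteq> {..<k} \<and> k \<le> 5 * card A \<and> k \<le> 5 * card B}"
  have Prsub: "Pr \<subseteq> Pow {..<k} \<times> Pow {..<k}" by (auto simp: Pr_def)
  then have finPr: "finite Pr" by (rule finite_subset) auto
  have "card Pr \<le> card (Pow {..<k} \<times> Pow {..<k})" by (rule card_mono[OF _ Prsub]) simp
  then have cPr: "card Pr \<le> 4 ^ k" by (simp add: card_Pow card_cartesian_product power_mult_distrib[symmetric])
  have bad: "5 ^ (7 * k) * card (Bad A B) \<le> 4 ^ (7 * k) * fact (card X)" if AB: "(A, B) \<in> Pr" for A B
  proof -
    have "7 * k \<le> card (up A)" "card X \<le> 5 * card (up B)"
      using AB card_up finX by (auto simp: Pr_def)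
    \<comment> \<open>Exactly 7 k elements are kept, so that the bound has the same exponent for all
      pairs.\<close>
    then obtain A' where A': "A' \<subseteq> up A" "card A' = 7 * k" by (meson obtain_subset_with_card_n)
    have "A' \<subseteq> X" "up B \<subseteq> X" using A' by (auto simp: up_def)
    then have "5 ^ (7 * k) * card {\<pi>. \<pi> permutes X \<and> \<pi> ` A' \<inter> up B = {}} \<le> 4 ^ (7 * k) * fact (card X)"
      using card_permutations_avoiding[of X A' "up B"] finX A' \<open>card X \<le> 5 * card (up B)\<close> by simp
    moreover have "card (Bad A B) \<le> card {\<pi>. \<pi> permutes X \<and> \<pi> ` A' \<inter> up B = {}}"
      unfolding Bad_def
      by (rule card_mono) (use A' finite_permutations[OF finX(1)] in \<open>auto intro: finite_subset[rotated]\<close>)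
    ultimately show ?thesis by (meson mult_le_mono2 order_trans)
  qed
  have "{\<pi>. \<pi> permutes X} \<subseteq> (\<Union>(A, B)\<in>Pr. Bad A B)"
  proof
    fix \<pi> assume "\<pi> \<in> {\<pi>. \<pi> permutes X}"
    then have p: "\<pi> permutes X" by simp
    with neg have "\<not> expanding k \<pi>" unfolding X_def by blast
    then obtain A B where AB: "A \<subseteq> {..<k}" "B \<subseteq> {..<k}" "k \<le> 5 * card A" "k \<le> 5 * card B"
      and no: "\<And>i. i < 35 * k \<Longrightarrow> i div 35 \<in> A \<Longrightarrow> \<pi> i div 35 \<notin> B"
      unfolding expanding_def by auto
    have "\<pi> \<in> Bad A B" using p no by (auto simp: Bad_def up_def X_def)
    then show "\<pi> \<in> (\<Union>(A, B)\<in>Pr. Bad A B)" using AB by (auto simp: Pr_def)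
  qed
  then have "card {\<pi>. \<pi> permutes X} \<le> card (\<Union>(A, B)\<in>Pr. Bad A B)"
    by (intro card_mono) (use finPr finBad in auto)
  also have "\<dots> \<le> (\<Sum>p\<in>Pr. card (case p of (A, B) \<Rightarrow> Bad A B))" by (rule card_UN_le[OF finPr])
  finally have "fact (card X) \<le> (\<Sum>p\<in>Pr. card (case p of (A, B) \<Rightarrow> Bad A B))"
    using card_permutations[OF refl finX(1)] by simp
  then have "5 ^ (7 * k) * fact (card X) \<le> (\<Sum>p\<in>Pr. 5 ^ (7 * k) * card (case p of (A, B) \<Rightarrow> Bad A B))"
    by (simp add: sum_distrib_left[symmetric])
  also have "\<dots> \<le> (\<Sum>p\<in>Pr. 4 ^ (7 * k) * fact (card X))"
    by (rule sum_mono) (use bad in auto)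
  also have "\<dots> \<le> 4 ^ k * (4 ^ (7 * k) * fact (card X))" using cPr by simp
  finally have "(5::nat) ^ (7 * k) \<le> 4 ^ k * 4 ^ (7 * k)" by simp
  also have "\<dots> = 4 ^ (8 * k)" by (simp flip: power_add)
  finally have "(5 ^ 7) ^ k \<le> (4 ^ 8 :: nat) ^ k" by (simp only: power_mult)
  moreover have "(4 ^ 8 :: nat) ^ k < (5 ^ 7) ^ k" using k by (intro power_strict_mono) auto
  ultimately show False by simp
qed

section \<open>Grids wired by an expander\<close>

text \<open>Two sets of at least k / 5 vertices cannot be separated. So if a component reaches k /
  5, less than k / 5 lies outside it, and more than 9/10 - 1/5 = 7/10 of k lies inside. If none
  does, a minimal union of components reaching k / 5 has size below 2 k / 5, and it is separated
  from a remainder that is still large.\<close>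

lemma large_component:
  fixes k :: nat
  assumes k: "k \<ge> 1" and G: "finite G" "9 * k \<le> 10 * card G"
    and exp: "\<And>A B. A \<subseteq> G \<Longrightarrow> B \<subseteq> G \<Longrightarrow> A \<inter> B = {} \<Longrightarrow> k \<le> 5 * card A \<Longrightarrow> k \<le> 5 * card B \<Longrightarrow>
      \<exists>a\<in>A. \<exists>b\<in>B. {a, b} \<in> E"
  shows "\<exists>C\<subseteq>G. connected_within E C \<and> 7 * k < 10 * card C"
proof -
  define comp where "comp v = {w \<in> G. joined_in E G v w}" for v
  have comp_sub: "comp v \<subseteq> G" for v by (auto simp: comp_def)
  have comp_closed: "b \<in> comp v" if "a \<in> comp v" "{a, b} \<in> E" "b \<in> G" for a b v
    using that unfolding comp_def by (auto intro: joined_in_trans joined_in_edge)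
  have comp_conn: "connected_within E (comp v)" if v: "v \<in> G" for v
  proof -
    have "joined_in E (comp v) v w" if "w \<in> comp v" for w
      by (rule joined_in_closed[of E G]) (use that v comp_closed in \<open>auto simp: comp_def\<close>)
    moreover have "v \<in> comp v" using v by (simp add: comp_def)
    ultimately show ?thesis unfolding connected_within_def
      by (metis empty_iff joined_in_sym joined_in_trans)
  qed
  show ?thesis
  proof (cases "\<exists>v\<in>G. k \<le> 5 * card (comp v)")
    case True
    then obtain v where v: "v \<in> G" "k \<le> 5 * card (comp v)" by auto
    have "\<not> k \<le> 5 * card (G - comp v)"
    proof
      assume "k \<le> 5 * card (G - comp v)"
      from exp[OF comp_sub _ _ v(2) this] show False using comp_closed by blast
    qed
    moreover have "card (G - comp v) = card G - card (comp v)"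
      using comp_sub G by (intro card_Diff_subset) (auto intro: finite_subset)
    ultimately have "7 * k < 10 * card (comp v)" using G by linarith
    then show ?thesis using comp_conn v comp_sub by blast
  next
    case False
    \<comment> \<open>Unions of components that reach the threshold k / 5. Removing one component
      from a minimal one drops below the threshold.\<close>
    define Cl where "Cl A \<longleftrightarrow> A \<subseteq> G \<and> (\<forall>a\<in>A. \<forall>b\<in>G. {a, b} \<in> E \<longrightarrow> b \<in> A) \<and> k \<le> 5 * card A" for A
    have "Cl G" using G by (auto simp: Cl_def)
    then obtain A where A: "Cl A" and min: "\<And>A'. Cl A' \<Longrightarrow> card A \<le> card A'"
      using ex_has_least_nat[of Cl G card] by blast
    have finA: "finite A" using A G by (auto simp: Cl_def intro: finite_subset)
    have "A \<noteq> {}" using A k by (auto simp: Cl_def)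
    then obtain v where v: "v \<in> A" by auto
    then have vG: "v \<in> G" using A by (auto simp: Cl_def)
    have comp_A: "comp v \<subseteq> A"
    proof
      fix w assume "w \<in> comp v"
      then have "joined_in E G v w" by (simp add: comp_def)
      then have "joined_in E A v w"
        by (rule joined_in_closed[OF _ v]) (use A in \<open>auto simp: Cl_def\<close>)
      then show "w \<in> A" using v by (rule joined_in_mem)
    qed
    have vc: "v \<in> comp v" using vG by (simp add: comp_def)
    have "\<not> Cl (A - comp v)"
    proof
      assume "Cl (A - comp v)"
      then have "card A \<le> card (A - comp v)" by (rule min)
      moreover have "card (A - comp v) < card A"
        using vc v finA by (intro psubset_card_mono) auto
      ultimately show False by simp
    qed
    moreover have "\<forall>a\<in>A - comp v. \<forall>b\<in>G. {a, b} \<in> E \<longrightarrow> b \<in> A - comp v"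
    proof (intro ballI impI)
      fix a b assume a: "a \<in> A - comp v" and b: "b \<in> G" "{a, b} \<in> E"
      have "a \<in> G" using a A by (auto simp: Cl_def)
      then have "b \<notin> comp v" using comp_closed[of b v a] a b by (auto simp: insert_commute)
      then show "b \<in> A - comp v" using A a b by (auto simp: Cl_def)
    qed
    ultimately have "5 * card (A - comp v) < k"
      using A unfolding Cl_def by (meson Diff_subset not_le order_trans)
    moreover have "card (A - comp v) = card A - card (comp v)"
      using comp_A finA by (intro card_Diff_subset) (auto intro: finite_subset)
    moreover have "5 * card (comp v) < k" using False vG by auto
    moreover have "card (G - A) = card G - card A"
      using A finA by (intro card_Diff_subset) (auto simp: Cl_def)
    ultimately have "k \<le> 5 * card (G - A)" using G k by linarith
    with exp[of A "G - A"] A show ?thesis by (auto simp: Cl_def)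
  qed
qed

text \<open>Row edges start at height 1, see \<open>meets\<close> below, so nothing but lower ends
  of columns lies at height 0. A point where a handle glues two columns therefore lies on only two
  grid edges.\<close>

definition grid_edges :: "nat \<Rightarrow> nat \<Rightarrow> (bool \<times> nat \<times> nat) set" where
  "grid_edges W s = UNIV \<times> {..<W} \<times> {..<s}"

text \<open>The edge \<open>(True, x, r)\<close> of the grid joins \<open>(x, r)\<close> to \<open>(x, r + 1)\<close> and the edge
  \<open>(False, x, r)\<close> joins \<open>(x, r + 1)\<close> to \<open>(x + 1, r + 1)\<close>.\<close>

inductive meets :: "(nat \<Rightarrow> nat \<Rightarrow> bool) \<Rightarrow> bool \<times> nat \<times> nat \<Rightarrow> bool \<times> nat \<times> nat \<Rightarrow> bool"
  for glued where
  same: "meets glued e e"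
| row: "meets glued (False, x, r) (False, Suc x, r)"
| column: "meets glued (True, x, r) (True, x, Suc r)"
| corner: "meets glued (True, x, r) (False, x, r)"
| handle: "glued x x' \<Longrightarrow> meets glued (True, x, 0) (True, x', 0)"

text \<open>Here \<open>q\<close> and \<open>q'\<close> number sectors of \<open>s\<close>
  consecutive columns, 70 sectors to a block. One handle supplies the whole bundle, and the index s
  - 1 - c is what the gluing reflection imposes.\<close>

definition linked :: "nat \<Rightarrow> (nat \<Rightarrow> nat \<Rightarrow> bool) \<Rightarrow> nat \<Rightarrow> nat \<Rightarrow> bool" where
  "linked s glued b b' \<longleftrightarrow> (\<exists>q q'. q div 70 = b \<and> q' div 70 = b' \<and>
     (\<forall>c<s. glued (q * s + c) (q' * s + (s - 1 - c))))"

locale wired_grid =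
  fixes k s m :: nat and glued :: "nat \<Rightarrow> nat \<Rightarrow> bool" and V :: "'a set" and E :: "'a set set"
    and \<nu> :: "bool \<times> nat \<times> nat \<Rightarrow> nat \<Rightarrow> 'a" and apex :: 'a
  assumes pos: "k \<ge> 1" "s \<ge> 1" "m \<ge> 1"
    and simple: "simple_graph V E"
    and V_eq: "V = insert apex (case_prod \<nu> ` (grid_edges (70 * k * s) s \<times> {..<m}))"
    and inj: "inj_on (case_prod \<nu>) (grid_edges (70 * k * s) s \<times> {..<m})"
    and adjacent: "\<And>e e' j j'. e \<in> grid_edges (70 * k * s) s \<Longrightarrow> e' \<in> grid_edges (70 * k * s) s \<Longrightarrow>
      meets glued e e' \<Longrightarrow> j < m \<Longrightarrow> j' < m \<Longrightarrow> (e, j) \<noteq> (e', j') \<Longrightarrow> {\<nu> e j, \<nu> e' j'} \<in> E"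
    and apex: "\<And>x j. x < 70 * k * s \<Longrightarrow> j < m \<Longrightarrow> {apex, \<nu> (True, x, s - 1) j} \<in> E"
    and expansion: "\<And>A B. A \<subseteq> {..<k} \<Longrightarrow> B \<subseteq> {..<k} \<Longrightarrow> A \<inter> B = {} \<Longrightarrow> k \<le> 5 * card A \<Longrightarrow> k \<le> 5 * card B \<Longrightarrow>
      \<exists>b\<in>A. \<exists>b'\<in>B. linked s glued b b'"
begin

abbreviation "H \<equiv> grid_edges (70 * k * s) s"

text \<open>Majorities make survivors meet: if an edge is alive for two deleted sets, some copy of it avoids
  both, and two good sets of rows or columns in a block have a member in common.\<close>

definition "alive S e \<longleftrightarrow> 2 * card {j \<in> {..<m}. \<nu> e j \<in> S} < m"
definition "dead S = {e \<in> H. \<not> alive S e}"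
definition "block b = {e \<in> H. fst (snd e) div (70 * s) = b}"
definition "good S b \<longleftrightarrow> b < k \<and> 2 * card (dead S \<inter> block b) < s"
definition "row_alive S b r \<longleftrightarrow> (\<forall>x. x div (70 * s) = b \<longrightarrow> alive S (False, x, r))"
definition "column_alive S x \<longleftrightarrow> (\<forall>r<s. alive S (True, x, r))"
definition "links = {{b, b'} | b b'. linked s glued b b'}"
text \<open>Meaningful only for sets \<open>S\<close> that are small enough for such a
  \<open>C\<close> to exist. The bound 7/10 makes any two cores overlap.\<close>

definition "core S = (SOME C. C \<subseteq> {b. good S b} \<and> connected_within links C \<and> 7 * k < 10 * card C)"
definition "lines S = {(v, x, r). (v, x, r) \<in> H \<and> x div (70 * s) \<in> core S \<and>
  (if v then column_alive S x else row_alive S (x div (70 * s)) r)}"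
definition "survivors S = {\<nu> e j | e j. e \<in> lines S \<and> j < m \<and> \<nu> e j \<notin> S}"

section \<open>Counting the damage done by a small set of nations\<close>

lemma in_H: "(v, x, r) \<in> H \<longleftrightarrow> x < 70 * k * s \<and> r < s"
  by (simp add: grid_edges_def)

lemma finite_H: "finite H"
  by (simp add: grid_edges_def)

lemma finite_V: "finite V"
  using simple by (simp add: simple_graph_def)

lemma column_lt: "x div (70 * s) < k \<Longrightarrow> x < 70 * k * s"
  using pos by (simp add: div_less_iff_less_mult mult_ac)

lemma sector_block: "c < s \<Longrightarrow> (q * s + c) div (70 * s) = q div 70"
  using div_mult2_eq[of "q * s + c" s 70] by (simp add: mult.commute)

lemma block_index: "i < 70 * s \<Longrightarrow> (b * (70 * s) + i) div (70 * s) = b"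
  using div_mult_self3[of "70 * s" b i] by simp

text \<open>A dead edge has at least half of its \<open>m\<close> copies in \<open>S\<close>, and
  copies of different edges are different nations.\<close>

lemma card_dead:
  assumes S: "S \<subseteq> V"
  shows "card (dead S) * m \<le> 2 * card S"
proof -
  have fin: "finite (dead S)" "finite S"
    using finite_H finite_V S by (auto simp: dead_def intro: finite_subset)
  have "card (dead S) * m = (\<Sum>e\<in>dead S. m)" by simp
  also have "\<dots> \<le> (\<Sum>e\<in>dead S. 2 * card {j \<in> {..<m}. \<nu> e j \<in> S})"
    by (rule sum_mono) (auto simp: dead_def alive_def)
  also have "\<dots> = 2 * card (SIGMA e:dead S. {j \<in> {..<m}. \<nu> e j \<in> S})"
    using fin by (simp add: sum_distrib_left)
  also have "card (SIGMA e:dead S. {j \<in> {..<m}. \<nu> e j \<in> S}) \<le> card S"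
  proof (rule card_inj_on_le)
    show "inj_on (case_prod \<nu>) (SIGMA e:dead S. {j \<in> {..<m}. \<nu> e j \<in> S})"
      by (rule inj_on_subset[OF inj]) (auto simp: dead_def)
  qed (use fin in auto)
  finally show ?thesis by simp
qed

text \<open>A block that is not good contains at least s / 2 dead edges and so accounts for at least
  s m / 4 elements of \<open>S\<close>. With at most k s m / 40 elements there are at most k / 10
  such blocks.\<close>

lemma card_not_good:
  assumes S: "S \<subseteq> V" "40 * card S \<le> k * s * m"
  shows "9 * k \<le> 10 * card {b. good S b}"
proof -
  let ?B = "{b. b < k \<and> \<not> good S b}"
  have "card ?B * s = (\<Sum>b\<in>?B. s)" by simp
  also have "\<dots> \<le> (\<Sum>b\<in>?B. 2 * card (dead S \<inter> block b))"
    by (rule sum_mono) (auto simp: good_def)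
  also have "\<dots> = 2 * card (\<Union>b\<in>?B. dead S \<inter> block b)"
    unfolding sum_distrib_left[symmetric]
    by (subst card_UN_disjoint) (use finite_H in \<open>auto simp: block_def dead_def\<close>)
  also have "\<dots> \<le> 2 * card (dead S)"
    using finite_H by (intro mult_left_mono card_mono) (auto simp: dead_def)
  finally have "card ?B * s * m \<le> 2 * (card (dead S) * m)"
    using mult_right_mono[of "card ?B * s" "2 * card (dead S)" m] by simp
  also have "\<dots> \<le> 4 * card S" using card_dead[OF S(1)] by (simp add: mult.commute)
  finally have "10 * (card ?B * s * m) \<le> k * s * m" using S(2) by linarith
  then have "10 * card ?B * (s * m) \<le> k * (s * m)" by (simp only: mult.assoc)
  then have 1: "10 * card ?B \<le> k" using pos by simp
  have k: "{..<k} = {b. good S b} \<union> ?B" by (auto simp: good_def)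
  moreover have "finite {b. good S b}" by (rule finite_subset[of _ "{..<k}"]) (auto simp: good_def)
  ultimately have "card {..<k} = card {b. good S b} + card ?B"
    by (subst card_Un_disjoint[symmetric]) auto
  with 1 show ?thesis by simp
qed

text \<open>Each damaged row contains a dead edge of the block, and different rows contain different
  edges.\<close>

lemma card_dead_rows:
  assumes "good S b"
  shows "2 * card {r \<in> {..<s}. \<not> row_alive S b r} < s"
proof -
  have "{r \<in> {..<s}. \<not> row_alive S b r} \<subseteq> (snd \<circ> snd) ` (dead S \<inter> block b)"
  proof
    fix r assume "r \<in> {r \<in> {..<s}. \<not> row_alive S b r}"
    then obtain x where "r < s" "x div (70 * s) = b" "\<not> alive S (False, x, r)"
      by (auto simp: row_alive_def)
    then have "(False, x, r) \<in> dead S \<inter> block b"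
      using assms column_lt[of x] by (auto simp: dead_def block_def in_H good_def)
    then show "r \<in> (snd \<circ> snd) ` (dead S \<inter> block b)" by force
  qed
  then have "card {r \<in> {..<s}. \<not> row_alive S b r} \<le> card (dead S \<inter> block b)"
    using finite_H by (intro surj_card_le) (auto simp: dead_def)
  with assms show ?thesis by (simp add: good_def)
qed

text \<open>The count is within one sector, not the whole block: a handle meets only the
  \<open>s\<close> columns of a sector, and most of these have to survive.\<close>

lemma card_dead_columns:
  assumes "good S b" "q div 70 = b"
  shows "2 * card {c \<in> {..<s}. \<not> column_alive S (q * s + c)} < s"
proof -
  have "{c \<in> {..<s}. \<not> column_alive S (q * s + c)} \<subseteq> (\<lambda>e. fst (snd e) - q * s) ` (dead S \<inter> block b)"
  proof
    fix c assume "c \<in> {c \<in> {..<s}. \<not> column_alive S (q * s + c)}"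
    then obtain r where "c < s" "r < s" "\<not> alive S (True, q * s + c, r)"
      by (auto simp: column_alive_def)
    then have "(True, q * s + c, r) \<in> dead S \<inter> block b"
      using assms column_lt[of "q * s + c"] sector_block[of c q]
      by (auto simp: dead_def block_def in_H good_def)
    then show "c \<in> (\<lambda>e. fst (snd e) - q * s) ` (dead S \<inter> block b)" by force
  qed
  then have "card {c \<in> {..<s}. \<not> column_alive S (q * s + c)} \<le> card (dead S \<inter> block b)"
    using finite_H by (intro surj_card_le) (auto simp: dead_def)
  with assms show ?thesis by (simp add: good_def)
qed

lemma common_element:
  fixes n :: nat
  assumes "2 * card {i \<in> {..<n}. \<not> P i} < n" "2 * card {i \<in> {..<n}. \<not> Q i} < n"
  obtains i where "i < n" "P i" "Q i"
proof -
  have "card ({i \<in> {..<n}. \<not> P i} \<union> {i \<in> {..<n}. \<not> Q i}) < card {..<n}"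
    using assms card_Un_le[of "{i \<in> {..<n}. \<not> P i}" "{i \<in> {..<n}. \<not> Q i}"] by simp
  then have "{i \<in> {..<n}. \<not> P i} \<union> {i \<in> {..<n}. \<not> Q i} \<noteq> {..<n}" by (metis less_irrefl)
  then have "\<exists>i<n. P i \<and> Q i" by blast
  then show ?thesis using that by blast
qed

section \<open>Connectedness of the survivors of a small set\<close>

context
  fixes S assumes S: "S \<subseteq> V" "40 * card S \<le> k * s * m"
begin

lemma core: "core S \<subseteq> {b. good S b}" "connected_within links (core S)" "7 * k < 10 * card (core S)"
proof -
  have "\<exists>C\<subseteq>{b. good S b}. connected_within links C \<and> 7 * k < 10 * card C"
  proof (rule large_component[OF pos(1)])
    show "finite {b. good S b}" by (rule finite_subset[of _ "{..<k}"]) (auto simp: good_def)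
    show "9 * k \<le> 10 * card {b. good S b}" using card_not_good S by simp
    fix A B assume AB: "A \<subseteq> {b. good S b}" "B \<subseteq> {b. good S b}" "A \<inter> B = {}"
      "k \<le> 5 * card A" "k \<le> 5 * card B"
    then have "A \<subseteq> {..<k}" "B \<subseteq> {..<k}" by (auto simp: good_def)
    from expansion[OF this AB(3-5)] show "\<exists>a\<in>A. \<exists>b\<in>B. {a, b} \<in> links"
      by (auto simp: links_def)
  qed
  then have "\<exists>C. C \<subseteq> {b. good S b} \<and> connected_within links C \<and> 7 * k < 10 * card C" by blast
  from someI_ex[OF this] show "core S \<subseteq> {b. good S b}" "connected_within links (core S)" "7 * k < 10 * card (core S)"
    by (auto simp: core_def)
qed

lemma copy_outside: "alive S e \<Longrightarrow> \<exists>j<m. \<nu> e j \<notin> S"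
proof (rule ccontr)
  assume "alive S e" "\<not> (\<exists>j<m. \<nu> e j \<notin> S)"
  then have "{j \<in> {..<m}. \<nu> e j \<in> S} = {..<m}" by auto
  with \<open>alive S e\<close> show False by (simp add: alive_def)
qed

lemma line_alive: "e \<in> lines S \<Longrightarrow> alive S e"
  by (cases e) (auto simp: lines_def row_alive_def column_alive_def in_H split: if_splits)

definition "contacts = {{e, e'} | e e'. meets glued e e'}"

lemma contact: "meets glued e e' \<Longrightarrow> e \<in> lines S \<Longrightarrow> e' \<in> lines S \<Longrightarrow> joined_in contacts (lines S) e e'"
  unfolding contacts_def by (rule joined_in_edge) blast+

lemma survivorsI: "e \<in> lines S \<Longrightarrow> j < m \<Longrightarrow> \<nu> e j \<notin> S \<Longrightarrow> \<nu> e j \<in> survivors S"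
  unfolding survivors_def by blast

lemma column_joined:
  assumes "x div (70 * s) \<in> core S" "column_alive S x" "r < s" "r' < s"
  shows "joined_in contacts (lines S) (True, x, r) (True, x, r')"
proof -
  have x: "x < 70 * k * s" using assms core column_lt by (auto simp: good_def)
  have "r < s \<Longrightarrow> joined_in contacts (lines S) (True, x, 0) (True, x, r)" for r
  proof (induction r)
    case (Suc r)
    have "joined_in contacts (lines S) (True, x, r) (True, x, Suc r)"
      using assms Suc.prems x by (intro contact meets.column) (auto simp: lines_def in_H)
    with Suc show ?case by (auto intro: joined_in_trans)
  qed simp
  from this[OF assms(3)] this[OF assms(4)] show ?thesis
    by (blast intro: joined_in_sym joined_in_trans)
qed

lemma row_joined:
  assumes "b \<in> core S" "row_alive S b r" "r < s" "x div (70 * s) = b" "x' div (70 * s) = b"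
  shows "joined_in contacts (lines S) (False, x, r) (False, x', r)"
proof -
  have lt: "x < 70 * k * s" if "x div (70 * s) = b" for x
    using that assms core column_lt by (auto simp: good_def)
  have start: "joined_in contacts (lines S) (False, b * (70 * s), r) (False, b * (70 * s) + i, r)" if "i < 70 * s" for i
    using that
  proof (induction i)
    case (Suc i)
    have "(b * (70 * s) + i) div (70 * s) = b" "Suc (b * (70 * s) + i) div (70 * s) = b"
      using block_index[of i b] block_index[of "Suc i" b] Suc.prems by auto
    then have "joined_in contacts (lines S) (False, b * (70 * s) + i, r) (False, Suc (b * (70 * s) + i), r)"
      using assms lt by (intro contact meets.row) (auto simp: lines_def in_H)
    with Suc show ?case by (auto intro: joined_in_trans)
  qed simp
  have "joined_in contacts (lines S) (False, b * (70 * s), r) (False, x, r)" if "x div (70 * s) = b" for x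
  proof -
    have "x = b * (70 * s) + x mod (70 * s)" using that by (metis div_mult_mod_eq)
    then show ?thesis using start[of "x mod (70 * s)"] pos by simp
  qed
  from this[OF assms(4)] this[OF assms(5)] show ?thesis
    by (blast intro: joined_in_sym joined_in_trans)
qed

lemma alive_row: assumes "good S b" obtains r where "r < s" "row_alive S b r"
  using common_element[OF card_dead_rows[OF assms] card_dead_rows[OF assms]] by blast

lemma alive_column: assumes "good S b" obtains x where "x div (70 * s) = b" "column_alive S x"
proof -
  \<comment> \<open>Any sector of the block would do; 70 b is its first one.\<close>
  obtain c where "c < s" "column_alive S (b * 70 * s + c)"
    using common_element[OF card_dead_columns[OF assms, of "b * 70"] card_dead_columns[OF assms, of "b * 70"]] by auto
  with that[of "b * 70 * s + c"] sector_block[of c "b * 70"] show ?thesis by simp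
qed

text \<open>One undamaged row \<open>r0\<close> and one undamaged column \<open>x0\<close> serve as
  a hub: every undamaged column crosses \<open>r0\<close> and every undamaged row crosses
  \<open>x0\<close>, so all lines of the block are joined to the row edge at (x0, r0).\<close>

lemma block_joined:
  assumes "(v, x, r) \<in> lines S" "(v', x', r') \<in> lines S" "x div (70 * s) = x' div (70 * s)"
  shows "joined_in contacts (lines S) (v, x, r) (v', x', r')"
proof -
  define b where "b = x div (70 * s)"
  have b: "b \<in> core S" using assms by (auto simp: lines_def b_def)
  then have g: "good S b" using core by auto
  obtain r0 where r0: "r0 < s" "row_alive S b r0" using alive_row[OF g] .
  obtain x0 where x0: "x0 div (70 * s) = b" "column_alive S x0" using alive_column[OF g] .
  have lt: "x < 70 * k * s" if "x div (70 * s) = b" for x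
    using that g column_lt by (auto simp: good_def)
  have col: "joined_in contacts (lines S) (True, x, r) (False, x0, r0)"
    if "(True, x, r) \<in> lines S" "x div (70 * s) = b" for x r
  proof -
    have "joined_in contacts (lines S) (True, x, r) (True, x, r0)"
      using that r0 b by (intro column_joined) (auto simp: lines_def in_H)
    moreover have "joined_in contacts (lines S) (True, x, r0) (False, x, r0)"
      using that r0 b by (intro contact meets.corner) (auto simp: lines_def in_H)
    moreover have "joined_in contacts (lines S) (False, x, r0) (False, x0, r0)"
      by (rule row_joined[OF b]) (use that r0 x0 in auto)
    ultimately show ?thesis by (blast intro: joined_in_trans)
  qed
  have "joined_in contacts (lines S) (v, x, r) (False, x0, r0)"
    if l: "(v, x, r) \<in> lines S" "x div (70 * s) = b" for v x r
  proof (cases v)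
    case False
    then have r: "row_alive S b r" "r < s" using l by (auto simp: lines_def in_H)
    have "joined_in contacts (lines S) (False, x, r) (False, x0, r)"
      by (rule row_joined[OF b]) (use l r x0 in auto)
    moreover have l0: "(False, x0, r) \<in> lines S" "(True, x0, r) \<in> lines S"
      using r x0 b lt by (auto simp: lines_def in_H)
    then have "joined_in contacts (lines S) (False, x0, r) (True, x0, r)"
      by (intro joined_in_sym[OF contact] meets.corner)
    ultimately show ?thesis using col[OF l0(2) x0(1)] False by (auto intro: joined_in_trans)
  qed (use col l in simp)
  from this[OF assms(1)] this[OF assms(2)] assms(3) show ?thesis
    unfolding b_def by (metis joined_in_sym joined_in_trans)
qed

text \<open>Within a block this is \<open>block_joined\<close>. For linked blocks, fewer than half
  of the \<open>s\<close> columns are damaged in each of the two sectors, so one of the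
  \<open>s\<close> glued pairs consists of undamaged columns. Walks in the core then chain the
  blocks together.\<close>

lemma lines_connected: "connected_within contacts (lines S)"
proof -
  have ex: "\<exists>x r. (True, x, r) \<in> lines S \<and> x div (70 * s) = b" if b: "b \<in> core S" for b
  proof -
    have g: "good S b" using b core by auto
    obtain x where x: "x div (70 * s) = b" "column_alive S x" using alive_column[OF g] .
    moreover have "x < 70 * k * s" using x g column_lt by (auto simp: good_def)
    ultimately have "(True, x, 0) \<in> lines S" using b pos by (auto simp: lines_def in_H)
    with x show ?thesis by blast
  qed
  have link: "joined_in contacts (lines S) (v, x, r) (v', x', r')"
    if b: "b \<in> core S" "b' \<in> core S" "linked s glued b b'"
      and l: "(v, x, r) \<in> lines S" "x div (70 * s) = b" "(v', x', r') \<in> lines S" "x' div (70 * s) = b'"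
    for b b' v x r v' x' r'
  proof -
    obtain q q' where q: "q div 70 = b" "q' div 70 = b'"
      "\<And>c. c < s \<Longrightarrow> glued (q * s + c) (q' * s + (s - 1 - c))"
      using b(3) by (auto simp: linked_def)
    have g: "good S b" "good S b'" using b core by auto
    \<comment> \<open>Reversing the order of the columns of a sector does not change how many are
      damaged.\<close>
    have "{c \<in> {..<s}. \<not> column_alive S (q' * s + (s - 1 - c))}
        \<subseteq> (\<lambda>c. s - 1 - c) ` {c \<in> {..<s}. \<not> column_alive S (q' * s + c)}"
    proof
      fix c assume "c \<in> {c \<in> {..<s}. \<not> column_alive S (q' * s + (s - 1 - c))}"
      then show "c \<in> (\<lambda>c. s - 1 - c) ` {c \<in> {..<s}. \<not> column_alive S (q' * s + c)}"
        by (intro image_eqI[of _ _ "s - 1 - c"]) auto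
    qed
    then have "card {c \<in> {..<s}. \<not> column_alive S (q' * s + (s - 1 - c))} \<le> card {c \<in> {..<s}. \<not> column_alive S (q' * s + c)}"
      by (rule surj_card_le[rotated]) simp
    then have "2 * card {c \<in> {..<s}. \<not> column_alive S (q' * s + (s - 1 - c))} < s"
      using card_dead_columns[OF g(2) q(2)] by linarith
    from common_element[OF card_dead_columns[OF g(1) q(1)] this]
    obtain c where c: "c < s" "column_alive S (q * s + c)" "column_alive S (q' * s + (s - 1 - c))" .
    have blk: "(q * s + c) div (70 * s) = b" "(q' * s + (s - 1 - c)) div (70 * s) = b'"
      using sector_block[of c q] sector_block[of "s - 1 - c" q'] q c by auto
    have lt: "q * s + c < 70 * k * s" "q' * s + (s - 1 - c) < 70 * k * s"
      by (rule column_lt; use blk g in \<open>simp add: good_def\<close>)+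
    have li: "(True, q * s + c, 0) \<in> lines S" "(True, q' * s + (s - 1 - c), 0) \<in> lines S"
      using blk lt b c pos by (auto simp: lines_def in_H)
    have "joined_in contacts (lines S) (True, q * s + c, 0) (True, q' * s + (s - 1 - c), 0)"
      by (intro contact meets.handle q(3) c li)
    then show ?thesis
      using block_joined[OF l(1) li(1)] block_joined[OF li(2) l(3)] blk l by (metis joined_in_trans)
  qed
  have all: "joined_in contacts (lines S) (v, x, r) (v', x', r')"
    if j: "joined_in links (core S) b b'" and b: "b \<in> core S"
      and l: "(v, x, r) \<in> lines S" "x div (70 * s) = b" "(v', x', r') \<in> lines S" "x' div (70 * s) = b'"
    for b b' v x r v' x' r'
  proof -
    have "\<forall>v' x' r'. (v', x', r') \<in> lines S \<longrightarrow> x' div (70 * s) = b' \<longrightarrow> joined_in contacts (lines S) (v, x, r) (v', x', r')"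
      using j unfolding joined_in_def[of links]
    proof (induction rule: rtranclp_induct)
      case base
      then show ?case using block_joined l by auto
    next
      case (step a b')
      then have ab: "a \<in> core S" "b' \<in> core S" "{a, b'} \<in> links" by auto
      then have "linked s glued a b' \<or> linked s glued b' a"
        by (auto simp: links_def doubleton_eq_iff)
      moreover obtain y t where y: "(True, y, t) \<in> lines S" "y div (70 * s) = a" using ex[OF ab(1)] by blast
      ultimately have "joined_in contacts (lines S) (True, y, t) (v', x', r')"
        if "(v', x', r') \<in> lines S" "x' div (70 * s) = b'" for v' x' r'
        using link ab that joined_in_sym by metis
      then show ?case using step.IH y by (blast intro: joined_in_trans)
    qed
    then show ?thesis using l by blast
  qed
  show ?thesis unfolding connected_within_def
  proof (intro conjI ballI)
    show "lines S \<noteq> {}" using ex core(2) by (auto simp: connected_within_def)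
    fix e e' assume e: "e \<in> lines S" "e' \<in> lines S"
    obtain v x r v' x' r' where eq: "e = (v, x, r)" "e' = (v', x', r')" by (cases e; cases e') auto
    have "x div (70 * s) \<in> core S" "x' div (70 * s) \<in> core S" using e eq by (auto simp: lines_def)
    then show "joined_in contacts (lines S) e e'"
      using all e core(2) unfolding eq connected_within_def by metis
  qed
qed

text \<open>All copies of two edges in contact are pairwise adjacent, so a walk along lines lifts to
  the survivors as soon as each line has one copy outside \<open>S\<close>; a line, being alive, has
  one.\<close>

lemma survivors_connected: "connected_within E (survivors S)"
proof -
  have cross: "joined_in E (survivors S) (\<nu> e j) (\<nu> e' j')"
    if "meets glued e e' \<or> meets glued e' e" "e \<in> lines S" "e' \<in> lines S" "j < m" "j' < m" "\<nu> e j \<notin> S" "\<nu> e' j' \<notin> S" for e e' j j'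
  proof (cases "(e, j) = (e', j')")
    case False
    have "e \<in> H" "e' \<in> H" using that by (auto simp: lines_def)
    then have "{\<nu> e j, \<nu> e' j'} \<in> E"
      using adjacent[of e e' j j'] adjacent[of e' e j' j] that False by (metis insert_commute)
    then show ?thesis using that survivorsI by (intro joined_in_edge) blast+
  qed simp
  have all: "joined_in E (survivors S) (\<nu> e j) (\<nu> e' j')"
    if jn: "joined_in contacts (lines S) e e'" and "e \<in> lines S" "e' \<in> lines S" "j < m" "j' < m" "\<nu> e j \<notin> S" "\<nu> e' j' \<notin> S"
    for e e' j j'
  proof -
    have "\<forall>j'<m. \<nu> e' j' \<notin> S \<longrightarrow> joined_in E (survivors S) (\<nu> e j) (\<nu> e' j')"
      using jn unfolding joined_in_def[of contacts]
    proof (induction rule: rtranclp_induct)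
      case base
      then show ?case using that cross meets.same by blast
    next
      case (step a b)
      then have ab: "a \<in> lines S" "b \<in> lines S" "meets glued a b \<or> meets glued b a"
        by (auto simp: contacts_def doubleton_eq_iff)
      obtain i where i: "i < m" "\<nu> a i \<notin> S" using copy_outside[OF line_alive[OF ab(1)]] by blast
      have "joined_in E (survivors S) (\<nu> a i) (\<nu> b j')" if "j' < m" "\<nu> b j' \<notin> S" for j'
        by (rule cross[OF ab(3,1,2) i(1) that(1) i(2) that(2)])
      then show ?case using step.IH i by (blast intro: joined_in_trans)
    qed
    then show ?thesis using that by blast
  qed
  have "survivors S \<noteq> {}"
  proof -
    obtain e where e: "e \<in> lines S" using lines_connected by (auto simp: connected_within_def)
    then show ?thesis using copy_outside[OF line_alive[OF e]] survivorsI by blast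
  qed
  moreover have "joined_in E (survivors S) u v" if uv: "u \<in> survivors S" "v \<in> survivors S" for u v
  proof -
    obtain e j where e: "u = \<nu> e j" "e \<in> lines S" "j < m" "\<nu> e j \<notin> S"
      using uv(1) unfolding survivors_def by blast
    obtain e' j' where e': "v = \<nu> e' j'" "e' \<in> lines S" "j' < m" "\<nu> e' j' \<notin> S"
      using uv(2) unfolding survivors_def by blast
    have "joined_in contacts (lines S) e e'"
      using lines_connected e e' unfolding connected_within_def by blast
    from all[OF this e(2) e'(2) e(3) e'(3) e(4) e'(4)] show ?thesis by (simp add: e e')
  qed
  ultimately show ?thesis by (simp add: connected_within_def)
qed

end

lemma survivors_sub: "survivors S \<subseteq> V - S"
proof
  fix v assume "v \<in> survivors S"
  then obtain e j where e: "v = \<nu> e j" "e \<in> lines S" "j < m" "\<nu> e j \<notin> S"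
    unfolding survivors_def by blast
  have "e \<in> H" using e(2) by (auto simp: lines_def)
  then have "case_prod \<nu> (e, j) \<in> V" unfolding V_eq using e(3) by blast
  then show "v \<in> V - S" using e by simp
qed

text \<open>Pigeonhole on three levels: two cores with more than 7/10 of the blocks each share a
  block; each set damages fewer than half of its rows; each set contains fewer than half of the
  copies of an edge in a common row.\<close>

lemma survivors_meet:
  assumes S: "S \<subseteq> V" "40 * card S \<le> k * s * m" and S': "S' \<subseteq> V" "40 * card S' \<le> k * s * m"
  shows "survivors S \<inter> survivors S' \<noteq> {}"
proof -
  have fin: "finite {b. good S b}" for S by (rule finite_subset[of _ "{..<k}"]) (auto simp: good_def)
  have "core S \<inter> core S' \<noteq> {}"
  proof
    assume "core S \<inter> core S' = {}"
    then have "card (core S \<union> core S') = card (core S) + card (core S')"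
      using core(1)[OF S] core(1)[OF S'] fin by (intro card_Un_disjoint) (auto intro: finite_subset)
    moreover have "card (core S \<union> core S') \<le> card {..<k}"
      using core(1)[OF S] core(1)[OF S'] by (intro card_mono) (auto simp: good_def)
    ultimately show False using core(3)[OF S] core(3)[OF S'] by simp
  qed
  then obtain b where b: "b \<in> core S" "b \<in> core S'" by auto
  then have g: "good S b" "good S' b" using core(1)[OF S] core(1)[OF S'] by auto
  obtain r where r: "r < s" "row_alive S b r" "row_alive S' b r"
    using common_element[OF card_dead_rows[OF g(1)] card_dead_rows[OF g(2)]] .
  define e where "e = (False, b * (70 * s), r)"
  have x: "b * (70 * s) div (70 * s) = b" using pos by simp
  have "b * (70 * s) < 70 * k * s" using column_lt[of "b * (70 * s)"] x g by (simp add: good_def)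
  then have e: "e \<in> lines S" "e \<in> lines S'" using b r x by (auto simp: e_def lines_def in_H)
  have "2 * card {j \<in> {..<m}. \<not> \<nu> e j \<notin> S} < m" "2 * card {j \<in> {..<m}. \<not> \<nu> e j \<notin> S'} < m"
    using line_alive[OF S e(1)] line_alive[OF S' e(2)] by (auto simp: alive_def)
  from common_element[OF this] obtain j where "j < m" "\<nu> e j \<notin> S" "\<nu> e j \<notin> S'" .
  then have "\<nu> e j \<in> survivors S \<inter> survivors S'"
    using e survivorsI[OF S] survivorsI[OF S'] by blast
  then show ?thesis by blast
qed

lemma every_decomposition_has_large_bag:
  assumes "tree_decomposition V E T F B"
  shows "\<exists>x\<in>T. k * s * m div 40 < card (B x)"
proof (rule large_bag[OF assms, where U = survivors])
  have *: "40 * card S \<le> k * s * m" if "card S \<le> k * s * m div 40" for S :: "'a set"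
    using order_trans[OF mult_le_mono2[OF that] times_div_less_eq_dividend] .
  fix S assume S: "S \<subseteq> V" "card S \<le> k * s * m div 40"
  show "survivors S \<subseteq> V - S \<and> connected_within E (survivors S)"
    using survivors_sub survivors_connected[OF S(1) *[OF S(2)]] by simp
  fix S' assume S': "S' \<subseteq> V" "card S' \<le> k * s * m div 40"
  show "survivors S \<inter> survivors S' \<noteq> {}"
    using survivors_meet[OF S(1) *[OF S(2)] S'(1) *[OF S'(2)]] .
qed

text \<open>The apex touches the top edge of every column, and at most s - 1 further steps go down
  to any edge of it. A row edge is one step from the column edge below its left end.\<close>

lemma distance_to_apex:
  assumes "v \<in> V"
  shows "\<exists>i\<le>s + 1. ((\<lambda>x y. {x, y} \<in> E) ^^ i) apex v"
proof -
  have col: "((\<lambda>x y. {x, y} \<in> E) ^^ Suc i) apex (\<nu> (True, x, s - 1 - i) j)" if "x < 70 * k * s" "i < s" "j < m" for x i j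
    using that
  proof (induction i)
    case 0
    then show ?case using apex by auto
  next
    case (Suc i)
    have eq: "s - 1 - i = Suc (s - 1 - Suc i)" using Suc.prems by simp
    have "meets glued (True, x, s - 1 - Suc i) (True, x, s - 1 - i)"
      unfolding eq by (rule meets.column)
    then have "{\<nu> (True, x, s - 1 - Suc i) j, \<nu> (True, x, s - 1 - i) j} \<in> E"
      using Suc.prems by (intro adjacent) (auto simp: in_H)
    then have "{\<nu> (True, x, s - 1 - i) j, \<nu> (True, x, s - 1 - Suc i) j} \<in> E"
      by (simp add: insert_commute)
    with Suc show ?case by (intro relpowp_Suc_I[of "Suc i"]) auto
  qed
  consider "v = apex" | w x r j where "v = \<nu> (w, x, r) j" "x < 70 * k * s" "r < s" "j < m"
    using assms unfolding V_eq by (auto simp: grid_edges_def)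
  then show ?thesis
  proof cases
    case 1
    then show ?thesis by (intro exI[of _ 0]) auto
  next
    case 2
    have up: "((\<lambda>x y. {x, y} \<in> E) ^^ Suc (s - 1 - r)) apex (\<nu> (True, x, r) j)"
      using col[of x "s - 1 - r" j] 2 by simp
    show ?thesis
    proof (cases w)
      case True
      then show ?thesis using up 2 by (intro exI[of _ "Suc (s - 1 - r)"]) auto
    next
      case False
      have "{\<nu> (True, x, r) j, \<nu> (False, x, r) j} \<in> E"
        using 2 by (intro adjacent meets.corner) (auto simp: in_H)
      then have "((\<lambda>x y. {x, y} \<in> E) ^^ Suc (Suc (s - 1 - r))) apex v"
        using up 2 False by (intro relpowp_Suc_I[of "Suc (s - 1 - r)"]) auto
      then show ?thesis using 2 by (intro exI[of _ "Suc (Suc (s - 1 - r))"]) auto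
    qed
  qed
qed

lemma treewidth_lower: "int (k * s * m div 40) \<le> treewidth V E"
  by (rule treewidth_ge[OF simple]) (rule every_decomposition_has_large_bag)

lemma layered_treewidth_lower: "k * s * m div 40 < (2 * s + 3) * layered_treewidth V E"
proof -
  have "k * s * m div 40 < (2 * (s + 1) + 1) * layered_treewidth V E"
  proof (rule layered_treewidth_ge[OF simple, where a = apex])
    show "apex \<in> V" using V_eq by blast
    show "\<exists>x\<in>T. k * s * m div 40 < card (B x)" if "tree_decomposition V E T F B" for T :: "nat set" and F B
      by (rule every_decomposition_has_large_bag[OF that])
    show "\<exists>i\<le>s + 1. ((\<lambda>x y. {x, y} \<in> E) ^^ i) apex v" if "v \<in> V" for v
      by (rule distance_to_apex[OF that])
  qed
  then show ?thesis by (simp add: algebra_simps)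
qed

end

section \<open>Gluing along circles\<close>

text \<open>The points of the quotient are the orbits, as sets. No continuity of \<tau> is assumed,
  because the gluing involution is the identity off the circles and jumps on them; closedness of
  saturations takes its place and makes the quotient map closed.\<close>

lemma involution_quotient:
  fixes S :: "'a::topological_space set" and \<tau> :: "'a \<Rightarrow> 'a"
  assumes \<tau>: "\<And>x. x \<in> S \<Longrightarrow> \<tau> x \<in> S" "\<And>x. x \<in> S \<Longrightarrow> \<tau> (\<tau> x) = x"
    and cl: "\<And>C. closed C \<Longrightarrow> C \<subseteq> S \<Longrightarrow> closed (C \<union> \<tau> ` C)"
  obtains X :: "'a set topology" and q where "quotient_map (top_of_set S) X q"
    "\<And>C. closed C \<Longrightarrow> C \<subseteq> S \<Longrightarrow> closedin X (q ` C)"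
    "\<And>x y. x \<in> S \<Longrightarrow> y \<in> S \<Longrightarrow> q x = q y \<longleftrightarrow> y = x \<or> y = \<tau> x"
proof -
  define q where "q x = {x, \<tau> x}" for x
  define L where "L U \<longleftrightarrow> U \<subseteq> q ` S \<and> openin (top_of_set S) {x \<in> S. q x \<in> U}" for U
  have "istopology L"
    unfolding istopology_def
  proof (intro conjI allI impI)
    fix U U' assume L: "L U" "L U'"
    have eq: "{x \<in> S. q x \<in> U \<inter> U'} = {x \<in> S. q x \<in> U} \<inter> {x \<in> S. q x \<in> U'}" by auto
    show "L (U \<inter> U')" using L unfolding L_def eq by (simp add: le_infI1 openin_Int)
  next
    fix \<U> assume L: "\<forall>U\<in>\<U>. L U"
    have eq: "{x \<in> S. q x \<in> \<Union>\<U>} = (\<Union>U\<in>\<U>. {x \<in> S. q x \<in> U})" by auto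
    show "L (\<Union>\<U>)" using L unfolding L_def eq by (intro conjI Union_least openin_Union) auto
  qed
  define X where "X = topology L"
  have op: "openin X U \<longleftrightarrow> L U" for U
    unfolding X_def using \<open>istopology L\<close> by (simp add: topology_inverse')
  have top: "topspace X = q ` S"
  proof
    show "topspace X \<subseteq> q ` S" using op openin_topspace unfolding L_def by blast
    have "{x \<in> S. q x \<in> q ` S} = S" by auto
    then have "L (q ` S)" by (simp add: L_def)
    then show "q ` S \<subseteq> topspace X" using op openin_subset by blast
  qed
  have qm: "quotient_map (top_of_set S) X q"
    unfolding quotient_map_def using top op by (auto simp: L_def)
  have eq: "q x = q y \<longleftrightarrow> y = x \<or> y = \<tau> x" if "x \<in> S" "y \<in> S" for x y
    using that \<tau>(2) unfolding q_def doubleton_eq_iff by metis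
  have "closedin X (q ` C)" if C: "closed C" "C \<subseteq> S" for C
  proof -
    have "{x \<in> S. q x \<in> q ` C} = C \<union> \<tau> ` C"
    proof (intro equalityI subsetI)
      fix x assume "x \<in> {x \<in> S. q x \<in> q ` C}"
      then obtain c where "c \<in> C" "x \<in> S" "q c = q x" by auto
      then show "x \<in> C \<union> \<tau> ` C" using eq[of c x] C by auto
    next
      fix x assume "x \<in> C \<union> \<tau> ` C"
      then obtain c where c: "c \<in> C" "x = c \<or> x = \<tau> c" by auto
      then have "c \<in> S" "x \<in> S" using C \<tau>(1) by auto
      then have "q c = q x" using eq c by blast
      then show "x \<in> {x \<in> S. q x \<in> q ` C}" using c(1) \<open>x \<in> S\<close> by (metis (mono_tags, lifting) imageI mem_Collect_eq)
    qed
    moreover have "C \<union> \<tau> ` C \<subseteq> S" using C \<tau>(1) by auto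
    ultimately have "closedin (top_of_set S) {x \<in> topspace (top_of_set S). q x \<in> q ` C}"
      using cl[OF C] by (simp add: closed_subset)
    moreover have "q ` C \<subseteq> topspace X" using C top by auto
    ultimately show ?thesis using qm unfolding quotient_map_closedin by blast
  qed
  from that[OF qm this eq] show ?thesis .
qed

section \<open>Reflections exchanging two unit vectors\<close>

context
  fixes a b :: "real^3"
  assumes unit: "norm a = 1" "norm b = 1" and neq: "a \<noteq> b"
begin

lemma swap_reflection_coefficient:
  "swap_reflection a b x = x - (x \<bullet> (a - b) / (1 - a \<bullet> b)) *\<^sub>R (a - b)" "a \<bullet> b \<noteq> 1"
proof -
  have "a \<bullet> a = 1" "b \<bullet> b = 1" using unit by (simp_all add: norm_eq_1)
  then have d: "(a - b) \<bullet> (a - b) = 2 * (1 - a \<bullet> b)" by (simp add: inner_diff inner_commute)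
  moreover have "(a - b) \<bullet> (a - b) \<noteq> 0" using neq by simp
  ultimately show "a \<bullet> b \<noteq> 1" by auto
  have "2 * (x \<bullet> (a - b)) / (2 * (1 - a \<bullet> b)) = x \<bullet> (a - b) / (1 - a \<bullet> b)"
    by (rule mult_divide_mult_cancel_left) simp
  then show "swap_reflection a b x = x - (x \<bullet> (a - b) / (1 - a \<bullet> b)) *\<^sub>R (a - b)"
    unfolding swap_reflection_def d by (simp only:)
qed

lemma swap_reflection_inner:
  "swap_reflection a b x \<bullet> a = x \<bullet> b" "swap_reflection a b x \<bullet> b = x \<bullet> a"
  "swap_reflection a b x \<bullet> (a - b) = - (x \<bullet> (a - b))"
proof -
  have u: "a \<bullet> a = 1" "b \<bullet> b = 1" using unit by (simp_all add: norm_eq_1)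
  define k where "k = x \<bullet> (a - b) / (1 - a \<bullet> b)"
  have "k * (1 - a \<bullet> b) = x \<bullet> a - x \<bullet> b"
    using swap_reflection_coefficient(2) by (simp add: k_def inner_diff_right)
  then show 1: "swap_reflection a b x \<bullet> a = x \<bullet> b" "swap_reflection a b x \<bullet> b = x \<bullet> a"
    unfolding swap_reflection_coefficient(1) k_def[symmetric]
    by (simp_all add: u inner_diff_left inner_commute[of b a] algebra_simps)
  then show "swap_reflection a b x \<bullet> (a - b) = - (x \<bullet> (a - b))" by (simp add: inner_diff_right)
qed

lemma swap_reflection_involution: "swap_reflection a b (swap_reflection a b x) = x"
  by (simp add: swap_reflection_coefficient(1)[of "swap_reflection a b x"] swap_reflection_inner(3))
    (simp add: swap_reflection_coefficient)

lemma norm_swap_reflection: "norm (swap_reflection a b x) = norm x"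
proof -
  define k u where "k = x \<bullet> (a - b) / (1 - a \<bullet> b)" and "u = a - b"
  have "a \<bullet> a = 1" "b \<bullet> b = 1" using unit by (simp_all add: norm_eq_1)
  then have "u \<bullet> u = 2 * (1 - a \<bullet> b)" by (simp add: u_def inner_diff inner_commute)
  moreover have "k * (1 - a \<bullet> b) = x \<bullet> u"
    using swap_reflection_coefficient(2) by (simp add: k_def u_def)
  ultimately have ku: "k * (u \<bullet> u) = 2 * (x \<bullet> u)" by (metis mult.left_commute)
  have "(x - k *\<^sub>R u) \<bullet> (x - k *\<^sub>R u) = x \<bullet> x - 2 * k * (x \<bullet> u) + k * (k * (u \<bullet> u))"
    by (simp add: inner_diff inner_commute algebra_simps)
  also have "\<dots> = x \<bullet> x" unfolding ku by simp
  finally have "(x - k *\<^sub>R u) \<bullet> (x - k *\<^sub>R u) = x \<bullet> x" .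
  moreover have "swap_reflection a b x = x - k *\<^sub>R u"
    by (simp only: swap_reflection_coefficient(1) k_def u_def)
  ultimately have "swap_reflection a b x \<bullet> swap_reflection a b x = x \<bullet> x" by (simp only:)
  then show ?thesis by (simp add: norm_eq_sqrt_inner)
qed

end

lemma swap_reflection_commute: "swap_reflection a b = swap_reflection b a"
proof
  fix x
  have e: "x \<bullet> (a - b) = - (x \<bullet> (b - a))" "(a - b) \<bullet> (a - b) = (b - a) \<bullet> (b - a)"
    by (simp_all add: inner_diff inner_commute)
  show "swap_reflection a b x = swap_reflection b a x"
    unfolding swap_reflection_def e by (simp add: scaleR_diff_right)
qed

lemma continuous_on_swap_reflection: "continuous_on A (swap_reflection a b)"
  unfolding swap_reflection_def
  by (cases "a = b") (auto intro!: continuous_intros)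

text \<open>Handle \<open>i\<close> joins the caps \<open>2 i\<close> and \<open>2 i + 1\<close>.\<close>

definition partner :: "nat \<Rightarrow> nat" where
  "partner j = (if even j then Suc j else j - 1)"

lemma partner_involution [simp]: "partner (partner j) = j"
  by (auto simp: partner_def elim: oddE)

lemma partner_lt: "j < 2 * h \<Longrightarrow> partner j < 2 * h"
  by (auto simp: partner_def elim!: evenE)

lemma partner_neq: "partner j \<noteq> j"
  by (auto simp: partner_def elim: oddE)

text \<open>All handles are glued by one involution \<tau>, well defined because the circles are
  disjoint. The saturation of a closed set adds finitely many reflected compact sets, hence is
  closed.\<close>

lemma surface_by_handles:
  fixes p :: "nat \<Rightarrow> real^3" and t :: "nat \<Rightarrow> real"
  assumes caps: "disjoint_caps (2 * h) p t" and same: "\<And>i. i < h \<Longrightarrow> t (2 * i) = t (2 * i + 1)"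
  defines "S \<equiv> holed_sphere (2 * h) p t"
  obtains X :: "(real^3) set topology" and q \<tau> where "sphere_with_handles h X"
    "continuous_map (top_of_set S) X q"
    "\<And>C. closed C \<Longrightarrow> C \<subseteq> S \<Longrightarrow> closedin X (q ` C)"
    "\<And>U. openin (top_of_set S) U \<Longrightarrow> (\<And>x y. x \<in> U \<Longrightarrow> y \<in> S \<Longrightarrow> q x = q y \<Longrightarrow> y \<in> U) \<Longrightarrow> openin X (q ` U)"
    "\<And>x y. x \<in> S \<Longrightarrow> y \<in> S \<Longrightarrow> q x = q y \<longleftrightarrow> y = x \<or> y = \<tau> x"
    "\<And>x. x \<in> S \<Longrightarrow> (\<And>j. j < 2 * h \<Longrightarrow> x \<bullet> p j < t j) \<Longrightarrow> \<tau> x = x"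
    "\<And>i x. i < h \<Longrightarrow> x \<in> cap_circle (p (2 * i)) (t (2 * i)) \<Longrightarrow> \<tau> x = swap_reflection (p (2 * i)) (p (2 * i + 1)) x"
proof -
  have unit: "norm (p j) = 1" if "j < 2 * h" for j using caps that by (simp add: disjoint_caps_def)
  have dj: "\<not> (x \<bullet> p j \<ge> t j \<and> x \<bullet> p j' \<ge> t j')" if "x \<in> sphere 0 1" "j < 2 * h" "j' < 2 * h" "j \<noteq> j'" for x j j'
    using caps that unfolding disjoint_caps_def by blast
  have tp: "t (partner j) = t j" if "j < 2 * h" for j
  proof (cases "even j")
    case True
    then obtain i where "j = 2 * i" by (elim evenE)
    then show ?thesis using same[of i] that by (simp add: partner_def)
  next
    case False
    then obtain i where "j = 2 * i + 1" by (elim oddE)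
    then show ?thesis using same[of i] that by (simp add: partner_def)
  qed
  \<comment> \<open>A common centre would lie in both caps, which are disjoint.\<close>
  have neq: "p j \<noteq> p (partner j)" if j: "j < 2 * h" for j
  proof
    assume e: "p j = p (partner j)"
    have pp: "p j \<bullet> p j = 1" using unit[OF j] by (simp add: norm_eq_1)
    have "t j < 1" using caps j by (simp add: disjoint_caps_def)
    then show False using dj[of "p j" j "partner j"] unit[OF j] j partner_lt[OF j] partner_neq[of j] e pp tp[OF j]
      by auto
  qed
  define circ where "circ j = cap_circle (p j) (t j)" for j
  define refl where "refl j = swap_reflection (p j) (p (partner j))" for j
  have refl_partner: "refl (partner j) = refl j" for j
    unfolding refl_def by (simp add: swap_reflection_commute)
  have refl_inv: "refl j (refl j x) = x" if "j < 2 * h" for j x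
    unfolding refl_def using unit neq partner_lt that by (intro swap_reflection_involution) auto
  have refl_circ: "refl j x \<in> circ (partner j)" if "x \<in> circ j" "j < 2 * h" for j x
    using that unit neq partner_lt tp unfolding refl_def circ_def cap_circle_def
    by (auto simp: norm_swap_reflection swap_reflection_inner)
  have circ_unique: "j = j'" if "x \<in> circ j" "x \<in> circ j'" "j < 2 * h" "j' < 2 * h" for x j j'
    using dj[of x j j'] that by (force simp: circ_def cap_circle_def)
  have circ_S: "circ j \<subseteq> S" if j: "j < 2 * h" for j
  proof
    fix x assume x: "x \<in> circ j"
    have "x \<bullet> p j' \<le> t j'" if j': "j' < 2 * h" for j'
    proof (cases "j' = j")
      case False
      then show ?thesis using dj[of x j j'] x j j' by (force simp: circ_def cap_circle_def)
    qed (use x in \<open>simp add: circ_def cap_circle_def\<close>)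
    then show "x \<in> S" using x unfolding S_def holed_sphere_def circ_def cap_circle_def by simp
  qed
  define \<tau> where "\<tau> x = (if \<exists>j<2 * h. x \<in> circ j then refl (SOME j. j < 2 * h \<and> x \<in> circ j) x else x)" for x
  have \<tau>_circ: "\<tau> x = refl j x" if "j < 2 * h" "x \<in> circ j" for j x
  proof -
    have "(SOME j. j < 2 * h \<and> x \<in> circ j) = j"
      by (rule some_equality) (use that circ_unique in blast)+
    then show ?thesis using that by (auto simp: \<tau>_def)
  qed
  have \<tau>_off: "\<tau> x = x" if "\<And>j. j < 2 * h \<Longrightarrow> x \<notin> circ j" for x
    using that by (auto simp: \<tau>_def)
  have \<tau>S: "\<tau> x \<in> S \<and> \<tau> (\<tau> x) = x" if x: "x \<in> S" for x
  proof (cases "\<exists>j<2 * h. x \<in> circ j")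
    case True
    then obtain j where j: "j < 2 * h" "x \<in> circ j" by auto
    have c: "refl j x \<in> circ (partner j)" using refl_circ j by blast
    then have "\<tau> (refl j x) = refl (partner j) (refl j x)" using \<tau>_circ partner_lt[OF j(1)] by blast
    then show ?thesis
      using \<tau>_circ[OF j] c circ_S[OF partner_lt[OF j(1)]] refl_inv[OF j(1)] by (auto simp: refl_partner)
  next
    case False
    then show ?thesis using \<tau>_off[of x] x by auto
  qed
  have "compact (sphere (0 :: real^3) 1 \<inter> (\<Inter>j<2 * h. {x. x \<bullet> p j \<le> t j}))"
    by (intro compact_Int_closed closed_INT ballI closed_Collect_le continuous_intros) simp
  moreover have "S = sphere (0 :: real^3) 1 \<inter> (\<Inter>j<2 * h. {x. x \<bullet> p j \<le> t j})"
    by (auto simp: S_def holed_sphere_def)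
  ultimately have cpS: "compact S" by simp
  have clo: "closed (C \<union> \<tau> ` C)" if C: "closed C" "C \<subseteq> S" for C
  proof -
    have cc: "compact C" using C cpS by (metis compact_Int_closed inf.absorb2)
    have "closed (circ j)" for j
    proof -
      have "circ j = sphere 0 1 \<inter> {x. x \<bullet> p j = t j}" by (auto simp: circ_def cap_circle_def)
      then show ?thesis by (auto intro!: closed_Int closed_Collect_eq continuous_intros)
    qed
    then have "compact (C \<union> (\<Union>j<2 * h. refl j ` (C \<inter> circ j)))"
      unfolding refl_def
      by (intro compact_Un compact_UN cc compact_continuous_image continuous_on_swap_reflection compact_Int_closed) auto
    moreover have "C \<union> \<tau> ` C = C \<union> (\<Union>j<2 * h. refl j ` (C \<inter> circ j))"
    proof (intro equalityI subsetI)
      fix x assume "x \<in> C \<union> \<tau> ` C"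
      then consider "x \<in> C" | c where "c \<in> C" "x = \<tau> c" by auto
      then show "x \<in> C \<union> (\<Union>j<2 * h. refl j ` (C \<inter> circ j))"
      proof cases
        case 2
        show ?thesis
        proof (cases "\<exists>j<2 * h. c \<in> circ j")
          case True
          then obtain j where j: "j < 2 * h" "c \<in> circ j" by auto
          then have "x \<in> refl j ` (C \<inter> circ j)" using \<tau>_circ[OF j] 2 by blast
          then show ?thesis using j by blast
        next
          case False
          then show ?thesis using \<tau>_off[of c] 2 by auto
        qed
      qed simp
    next
      fix x assume "x \<in> C \<union> (\<Union>j<2 * h. refl j ` (C \<inter> circ j))"
      then consider "x \<in> C" | j c where "j < 2 * h" "c \<in> C" "c \<in> circ j" "x = refl j c" by auto
      then show "x \<in> C \<union> \<tau> ` C"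
      proof cases
        case 2
        then have "x = \<tau> c" using \<tau>_circ by simp
        then show ?thesis using 2 by blast
      qed simp
    qed
    ultimately show ?thesis by (simp add: compact_imp_closed)
  qed
  obtain X :: "(real^3) set topology" and q where q: "quotient_map (top_of_set S) X q"
    "\<And>C. closed C \<Longrightarrow> C \<subseteq> S \<Longrightarrow> closedin X (q ` C)"
    "\<And>x y. x \<in> S \<Longrightarrow> y \<in> S \<Longrightarrow> q x = q y \<longleftrightarrow> y = x \<or> y = \<tau> x"
    by (rule involution_quotient[of S \<tau>]) (use \<tau>S clo in blast)+
  have refl_even: "refl (2 * i) = swap_reflection (p (2 * i)) (p (2 * i + 1))" for i
    by (simp add: refl_def partner_def)
  \<comment> \<open>The definition of the surface mentions only reflections starting on the even
    circles. A point on an odd circle is related to its image by the reversed relation, since the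
    reflection is an involution.\<close>
  have rel: "y = \<tau> x \<or> y = x \<longleftrightarrow> x = y \<or>
      (\<exists>i<h. x \<in> circ (2 * i) \<and> y = refl (2 * i) x) \<or> (\<exists>i<h. y \<in> circ (2 * i) \<and> x = refl (2 * i) y)"
    if x: "x \<in> S" and y: "y \<in> S" for x y
  proof
    assume "y = \<tau> x \<or> y = x"
    then consider "y = x" | j where "j < 2 * h" "x \<in> circ j" "y = refl j x"
      using \<tau>_off[of x] \<tau>_circ by metis
    then show "x = y \<or> (\<exists>i<h. x \<in> circ (2 * i) \<and> y = refl (2 * i) x) \<or> (\<exists>i<h. y \<in> circ (2 * i) \<and> x = refl (2 * i) y)"
    proof cases
      case 2
      show ?thesis
      proof (cases "even j")
        case True
        then obtain i where "j = 2 * i" by (elim evenE)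
        then show ?thesis using 2 by auto
      next
        case False
        then obtain i where i: "j = 2 * i + 1" by (elim oddE)
        then have "partner j = 2 * i" "i < h" using 2 by (simp_all add: partner_def)
        then have "y \<in> circ (2 * i)" "x = refl (2 * i) y"
          using refl_circ[OF 2(2,1)] refl_inv[OF 2(1), of x] 2(3) refl_partner[of j] by auto
        then show ?thesis using \<open>i < h\<close> by blast
      qed
    qed simp
  next
    assume "x = y \<or> (\<exists>i<h. x \<in> circ (2 * i) \<and> y = refl (2 * i) x) \<or> (\<exists>i<h. y \<in> circ (2 * i) \<and> x = refl (2 * i) y)"
    then consider "x = y" | i where "i < h" "x \<in> circ (2 * i)" "y = refl (2 * i) x"
      | i where "i < h" "y \<in> circ (2 * i)" "x = refl (2 * i) y" by blast
    then show "y = \<tau> x \<or> y = x"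
    proof cases
      case 2
      then show ?thesis using \<tau>_circ[of "2 * i" x] by simp
    next
      case 3
      then have "x = \<tau> y" using \<tau>_circ[of "2 * i" y] by simp
      then show ?thesis using \<tau>S[OF y] by simp
    qed simp
  qed
  show ?thesis
  proof (rule that[of X q \<tau>])
    show "sphere_with_handles h X"
      unfolding sphere_with_handles_def glued_space_def
    proof (intro exI conjI allI impI ballI)
      show "disjoint_caps (2 * h) p t" by fact
      show "t (2 * i) = t (2 * i + 1)" if "i < h" for i using same that .
      show "quotient_map (top_of_set (holed_sphere (2 * h) p t)) X q" using q(1) by (simp add: S_def)
      fix x y assume "x \<in> holed_sphere (2 * h) p t" "y \<in> holed_sphere (2 * h) p t"
      then have xy: "x \<in> S" "y \<in> S" by (simp_all add: S_def)
      have "q x = q y \<longleftrightarrow> y = \<tau> x \<or> y = x" using q(3)[OF xy] by blast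
      then show "q x = q y \<longleftrightarrow> x = y \<or>
        (\<exists>i<h. x \<in> cap_circle (p (2 * i)) (t (2 * i)) \<and> y = swap_reflection (p (2 * i)) (p (2 * i + 1)) x) \<or>
        (\<exists>i<h. y \<in> cap_circle (p (2 * i)) (t (2 * i)) \<and> x = swap_reflection (p (2 * i)) (p (2 * i + 1)) y)"
        by (simp only: rel[OF xy, unfolded circ_def refl_even])
    qed
    show "continuous_map (top_of_set S) X q" using q(1) by (rule quotient_imp_continuous_map)
    show "closedin X (q ` C)" if "closed C" "C \<subseteq> S" for C using q(2) that .
    show "openin X (q ` U)" if U: "openin (top_of_set S) U" "\<And>x y. x \<in> U \<Longrightarrow> y \<in> S \<Longrightarrow> q x = q y \<Longrightarrow> y \<in> U" for U
    proof -
      have US: "U \<subseteq> S" using U(1) openin_imp_subset by blast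
      have "{x \<in> topspace (top_of_set S). q x \<in> q ` U} = U"
      proof (intro equalityI subsetI)
        fix x assume "x \<in> {x \<in> topspace (top_of_set S). q x \<in> q ` U}"
        then obtain u where "u \<in> U" "x \<in> S" "q u = q x" by auto
        then show "x \<in> U" using U(2) by blast
      qed (use US in auto)
      moreover have "q ` U \<subseteq> topspace X" using q(1) US by (auto simp: quotient_map_def)
      moreover have "openin (top_of_set S) {x \<in> topspace (top_of_set S). q x \<in> q ` U} \<longleftrightarrow> openin X (q ` U)"
        using q(1) calculation(2) unfolding quotient_map_def by blast
      ultimately show ?thesis using U(1) by simp
    qed
    show "q x = q y \<longleftrightarrow> y = x \<or> y = \<tau> x" if "x \<in> S" "y \<in> S" for x y using q(3) that .
    show "\<tau> x = x" if "x \<in> S" "\<And>j. j < 2 * h \<Longrightarrow> x \<bullet> p j < t j" for x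
      using that by (intro \<tau>_off) (force simp: circ_def cap_circle_def)
    show "\<tau> x = swap_reflection (p (2 * i)) (p (2 * i + 1)) x" if "i < h" "x \<in> cap_circle (p (2 * i)) (t (2 * i))" for i x
      using \<tau>_circ[of "2 * i" x] that by (simp add: circ_def refl_def partner_def)
  qed
qed

section \<open>Drawing the grid in a surface\<close>

text \<open>The profile of the lenses. It has slope at most 1/2 at its ends, so a row lens and a
  column lens leaving the same grid point stay apart, and height at most 1/8, so a lens never
  reaches the next row or column.\<close>

definition bump :: "real \<Rightarrow> real" where
  "bump t = t * (1 - t) / 2"

lemma bump_0 [simp]: "bump 0 = 0" and bump_1 [simp]: "bump 1 = 0"
  by (simp_all add: bump_def)

lemma continuous_on_bump [continuous_intros]:
  "continuous_on A f \<Longrightarrow> continuous_on A (\<lambda>x. bump (f x))"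
  unfolding bump_def by (intro continuous_intros) auto

lemma bump_pos: "0 < t \<Longrightarrow> t < 1 \<Longrightarrow> 0 < bump t"
  by (simp add: bump_def)

lemma bump_bounds:
  assumes "0 \<le> t" "t \<le> 1" "0 \<le> l" "l \<le> 1"
  shows "0 \<le> l * bump t" "l * bump t \<le> t / 2" "l * bump t \<le> (1 - t) / 2" "l * bump t \<le> 1 / 8"
proof -
  have 0: "0 \<le> bump t" using assms by (simp add: bump_def)
  then show "0 \<le> l * bump t" using assms by simp
  have le: "l * bump t \<le> bump t" using 0 assms by (simp add: mult_left_le_one_le)
  have "bump t \<le> t / 2" "bump t \<le> (1 - t) / 2"
    using assms mult_left_le[of "1 - t" t] mult_left_le_one_le[of "1 - t" t] by (auto simp: bump_def)
  moreover have "bump t \<le> 1 / 8"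
    using zero_le_power2[of "t - 1 / 2"] by (simp add: bump_def power2_eq_square algebra_simps)
  ultimately show "l * bump t \<le> t / 2" "l * bump t \<le> (1 - t) / 2" "l * bump t \<le> 1 / 8"
    using le by linarith+
qed

text \<open>The curves \<open>place e\<close> with \<open>l\<close> from 0 to 1 sweep out a lens on one side of the grid edge \<open>e\<close>.\<close>

fun place :: "bool \<times> nat \<times> nat \<Rightarrow> real \<times> real \<Rightarrow> real \<times> real" where
  "place (v, x, r) (t, l) =
    (if v then (real x + l * bump t, real r + t) else (real x + t, real r + 1 + l * bump t))"

lemma nat_plus_fraction_eq:
  fixes x x' :: nat and a a' :: real
  assumes "real x + a = real x' + a'" "0 \<le> a" "a < 1" "0 \<le> a'" "a' < 1"
  shows "x = x' \<and> a = a'"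
proof -
  have "\<lfloor>real x + a\<rfloor> = int x" by (rule floor_unique) (use assms in auto)
  moreover have "\<lfloor>real x + a\<rfloor> = int x'" by (rule floor_unique) (use assms in auto)
  ultimately have "x = x'" by linarith
  then show ?thesis using assms(1) by (metis add_left_cancel)
qed

text \<open>Integer and fractional parts of the coordinates recover the data. Only the first point
  has to be interior to its edge, so end points are separated from interiors as well. In a common
  point of a row lens and a column lens, each of the two offsets would be at most half of the
  other.\<close>

lemma place_inj:
  assumes eq: "place e (t, l) = place e' (t', l')" and t: "0 < t" "t < 1" "0 \<le> t'" "t' \<le> 1"
    and l: "0 \<le> l" "l \<le> 1" "0 \<le> l'" "l' \<le> 1"
  shows "e = e' \<and> t = t' \<and> l = l'"
proof -
  obtain v x r where e: "e = (v, x, r)" by (cases e) auto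
  obtain v' x' r' where e': "e' = (v', x', r')" by (cases e') auto
  have b: "0 \<le> l * bump t" "l * bump t \<le> t / 2" "l * bump t \<le> (1 - t) / 2" "l * bump t \<le> 1 / 8"
    using bump_bounds[of t l] t l by auto
  have b': "0 \<le> l' * bump t'" "l' * bump t' \<le> t' / 2" "l' * bump t' \<le> (1 - t') / 2" "l' * bump t' \<le> 1 / 8"
    using bump_bounds[of t' l'] t l by auto
  \<comment> \<open>The value t' = 1 has to be read as fraction 0 over the next integer, which an
    interior \<open>t\<close> excludes.\<close>
  have fr: "y = y' \<and> t = t'" if "real y + t = real y' + t'" for y y' :: nat
  proof (cases "t' = 1")
    case True
    then show ?thesis using nat_plus_fraction_eq[of y t "Suc y'" 0] that t by simp
  next
    case False
    then show ?thesis using nat_plus_fraction_eq[OF that] t by simp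
  qed
  consider "v" "v'" | "\<not> v" "\<not> v'" | "v" "\<not> v'" | "\<not> v" "v'" by blast
  then show ?thesis
  proof cases
    case 1
    have "r = r' \<and> t = t'" using eq 1 by (intro fr) (simp add: e e')
    moreover from this have "x = x' \<and> l * bump t = l' * bump t'"
      using eq 1 b b' by (intro nat_plus_fraction_eq) (auto simp: e e')
    ultimately show ?thesis using 1 bump_pos[OF t(1,2)] by (simp add: e e')
  next
    case 2
    have "x = x' \<and> t = t'" using eq 2 by (intro fr) (simp add: e e')
    moreover have "r = r' \<and> l * bump t = l' * bump t'"
      using eq 2 b b' by (intro nat_plus_fraction_eq) (auto simp: e e')
    ultimately show ?thesis using 2 bump_pos[OF t(1,2)] by (simp add: e e')
  next
    case 3
    have 1: "real x + l * bump t = real x' + t'" "real r + t = real (Suc r') + l' * bump t'"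
      using eq 3 by (auto simp: e e')
    have "t = l' * bump t'"
      using nat_plus_fraction_eq[OF 1(2)] t b' by auto
    then have "t' < 1" "t \<le> t' / 2" using b' t by auto
    moreover have "l * bump t = t'"
      using nat_plus_fraction_eq[OF 1(1)] t b \<open>t' < 1\<close> by auto
    ultimately show ?thesis using b t by linarith
  next
    case 4
    have 1: "real x + t = real x' + l' * bump t'" "real (Suc r) + l * bump t = real r' + t'"
      using eq 4 by (auto simp: e e')
    have "t = l' * bump t'"
      using nat_plus_fraction_eq[OF 1(1)] t b' by auto
    then have "t' < 1" "t \<le> t' / 2" using b' t by auto
    moreover have "l * bump t = t'"
      using nat_plus_fraction_eq[OF 1(2)] t b \<open>t' < 1\<close> by auto
    ultimately show ?thesis using b t by linarith
  qed
qed

lemma continuous_on_place: "continuous_on A (place e)"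
proof -
  obtain v x r where e: "e = (v, x, r)" by (cases e) auto
  have "place e = (\<lambda>p. if v then (real x + snd p * bump (fst p), real r + fst p)
      else (real x + fst p, real r + 1 + snd p * bump (fst p)))"
    by (auto simp: e)
  then show ?thesis by (cases v) (auto intro!: continuous_intros)
qed

declare place.simps [simp del]

text \<open>\<open>\<Phi>\<close> parametrises a polar region of a surface: \<open>0\<close> and \<open>W\<close> are the same longitude, the pole is at
  height \<open>s + 1\<close>, and points at height \<open>0\<close> may be identified with each other.\<close>

locale polar_chart =
  fixes W s :: nat and X :: "'a topology" and \<Phi> :: "real \<times> real \<Rightarrow> 'a"
  assumes W: "W \<ge> 2" and s: "s \<ge> 1"
    and cont: "continuous_map (top_of_set ({0..real W} \<times> {0..real s + 1})) X \<Phi>"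
    and clo: "\<And>C. closed C \<Longrightarrow> C \<subseteq> {0..real W} \<times> {0..real s + 1} \<Longrightarrow> closedin X (\<Phi> ` C)"
    and opn: "\<And>U. openin (top_of_set ({0..real W} \<times> {0..real s + 1})) U \<Longrightarrow> (\<And>a. a \<in> U \<Longrightarrow> snd a > 0) \<Longrightarrow>
      (\<And>a b. a \<in> U \<Longrightarrow> b \<in> {0..real W} \<times> {0..real s + 1} \<Longrightarrow> \<Phi> a = \<Phi> b \<Longrightarrow> b \<in> U) \<Longrightarrow> openin X (\<Phi> ` U)"
    and sep: "\<And>a b. a \<in> {0..real W} \<times> {0..real s + 1} \<Longrightarrow> b \<in> {0..real W} \<times> {0..real s + 1} \<Longrightarrow>
      snd a > 0 \<Longrightarrow> \<Phi> a = \<Phi> b \<Longrightarrow> a = b \<or> (snd a = real s + 1 \<and> snd b = real s + 1) \<or>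
        (snd a = snd b \<and> {fst a, fst b} = {0, real W})"
    and wrap: "\<And>y. 0 \<le> y \<Longrightarrow> y \<le> real s + 1 \<Longrightarrow> \<Phi> (0, y) = \<Phi> (real W, y)"
    and bottom: "\<And>x. x < W \<Longrightarrow> card {x'. x' < W \<and> \<Phi> (real x', 0) = \<Phi> (real x, 0)} \<le> 2"
begin

section \<open>Grid edges seen through a polar chart\<close>

definition "K = {0..real W} \<times> {0..real s + 1}"
abbreviation "H \<equiv> grid_edges W s"

lemma in_H: "(v, x, r) \<in> H \<longleftrightarrow> x < W \<and> r < s"
  by (simp add: grid_edges_def)

lemma place_bounds:
  assumes "e \<in> H" "0 \<le> t" "t \<le> 1" "0 \<le> l" "l \<le> 1"
  shows "place e (t, l) \<in> K" "snd (place e (t, l)) < real s + 1" "0 < t \<Longrightarrow> 0 < snd (place e (t, l))"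
proof -
  obtain v x r where e: "e = (v, x, r)" by (cases e) auto
  have "real x + 1 \<le> real W" "real r + 1 \<le> real s"
    using assms(1) by (auto simp: e in_H simp flip: of_nat_Suc)
  then show "place e (t, l) \<in> K" "snd (place e (t, l)) < real s + 1" "0 < t \<Longrightarrow> 0 < snd (place e (t, l))"
    using assms bump_bounds[OF assms(2-5)] by (auto simp: e K_def place.simps)
qed

text \<open>Longitude \<open>W\<close> is reached only by the right end of a row edge, at integer
  height. An interior point over longitude 0 lies on a column edge and has fractional
  height.\<close>

lemma place_interior_not_seam:
  assumes e: "e \<in> H" "e' \<in> H" and t: "0 < t" "t < 1" "0 \<le> t'" "t' \<le> 1"
    and l: "0 \<le> l" "l \<le> 1" "0 \<le> l'" "l' \<le> 1"
    and eq: "snd (place e (t, l)) = snd (place e' (t', l'))"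
  shows "{fst (place e (t, l)), fst (place e' (t', l'))} \<noteq> {0, real W}"
proof
  assume seam: "{fst (place e (t, l)), fst (place e' (t', l'))} = {0, real W}"
  obtain v x r where e1: "e = (v, x, r)" by (cases e) auto
  obtain v' x' r' where e2: "e' = (v', x', r')" by (cases e') auto
  have le: "real x + 1 \<le> real W" "real x' + 1 \<le> real W"
    using e by (auto simp: e1 e2 in_H simp flip: of_nat_Suc)
  have b: "0 \<le> l * bump t" "l * bump t \<le> 1 / 8" "0 \<le> l' * bump t'" "l' * bump t' \<le> 1 / 8"
    using bump_bounds[of t l] bump_bounds[of t' l'] t l by auto
  have "fst (place e (t, l)) \<noteq> real W" using le b t by (auto simp: e1 place.simps)
  then have f: "fst (place e (t, l)) = 0" "fst (place e' (t', l')) = real W"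
    using seam by (auto simp: doubleton_eq_iff)
  have v: v using f(1) t by (auto simp: e1 place.simps split: if_splits)
  have v': "\<not> v'" "t' = 1" using f(2) le b t by (auto simp: e2 place.simps split: if_splits)
  have "real r + t = real (Suc r') + 0" using eq v v' by (simp add: e1 e2 place.simps)
  from nat_plus_fraction_eq[OF this] t show False by simp
qed

lemma place_separated:
  assumes e: "e \<in> H" "e' \<in> H" and t: "0 < t" "t < 1" "0 \<le> t'" "t' \<le> 1"
    and l: "0 \<le> l" "l \<le> 1" "0 \<le> l'" "l' \<le> 1"
    and eq: "\<Phi> (place e (t, l)) = \<Phi> (place e' (t', l'))"
  shows "e = e' \<and> t = t' \<and> l = l'"
proof -
  have "place e (t, l) \<in> K" "place e' (t', l') \<in> K" "0 < snd (place e (t, l))" "snd (place e (t, l)) < real s + 1"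
    using place_bounds e t l by auto
  from sep[OF this(1,2)[unfolded K_def] this(3) eq] this(4)
  have "place e (t, l) = place e' (t', l')"
    using place_interior_not_seam[OF e t l] by auto
  then show ?thesis by (rule place_inj[OF _ t l])
qed

definition "tip e \<beta> = place e (if \<beta> then 1 else 0, 0)"

lemma tip_simps:
  "tip (True, x, r) False = (real x, real r)" "tip (True, x, r) True = (real x, real r + 1)"
  "tip (False, x, r) False = (real x, real r + 1)" "tip (False, x, r) True = (real x + 1, real r + 1)"
  by (simp_all add: tip_def place.simps)

lemma place_ends: "place e (0, l) = tip e False" "place e (1, l) = tip e True"
  by (cases e; auto simp: tip_def place.simps)+

lemma tip_in_K: "e \<in> H \<Longrightarrow> tip e \<beta> \<in> K"
  unfolding tip_def by (rule place_bounds) auto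

text \<open>With \<open>W\<close> at least 2, the wrap-around does not turn a row edge into a
  loop.\<close>

lemma tips_distinct:
  assumes e: "e \<in> H"
  shows "\<Phi> (tip e True) \<noteq> \<Phi> (tip e False)"
proof
  assume eq: "\<Phi> (tip e True) = \<Phi> (tip e False)"
  obtain v x r where e1: "e = (v, x, r)" by (cases e) auto
  have "x < W" "r < s" using e by (auto simp: e1 in_H)
  have "0 < snd (tip e True)" by (cases v) (auto simp: e1 tip_simps)
  from sep[OF tip_in_K[OF e, unfolded K_def] tip_in_K[OF e, unfolded K_def] this eq]
  show False using \<open>r < s\<close> W by (cases v) (auto simp: e1 tip_simps doubleton_eq_iff)
qed

definition "nodes = (\<lambda>(x, r). \<Phi> (real x, real r)) ` ({..<W} \<times> {..s})"

lemma tip_node: assumes "e \<in> H" shows "\<Phi> (tip e \<beta>) \<in> nodes"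
proof -
  obtain v x r where e: "e = (v, x, r)" by (cases e) auto
  have x: "x < W" "r < s" using assms by (auto simp: e in_H)
  have n: "\<Phi> (real x, real r) \<in> nodes" if "x < W" "r \<le> s" for x r
    using that by (force simp: nodes_def)
  have "\<Phi> (real x + 1, real r + 1) \<in> nodes"
  proof (cases "Suc x = W")
    case True
    then have "\<Phi> (real x + 1, real r + 1) = \<Phi> (0, real (Suc r))"
      using wrap[of "real (Suc r)"] x by (auto simp: add.commute)
    then show ?thesis using n[of 0 "Suc r"] W x by simp
  next
    case False
    then show ?thesis using n[of "Suc x" "Suc r"] x by (simp add: add.commute)
  qed
  then show ?thesis
    using n[of x r] n[of x "Suc r"] x by (cases v; cases \<beta>) (auto simp: e tip_simps add.commute)
qed

lemma node_tip:
  assumes "p \<in> nodes"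
  obtains e \<beta> where "e \<in> H" "p = \<Phi> (tip e \<beta>)"
proof -
  obtain x r where x: "x < W" "r \<le> s" "p = \<Phi> (real x, real r)"
    using assms by (auto simp: nodes_def)
  show ?thesis
  proof (cases "r < s")
    case True
    then show ?thesis using x that[of "(True, x, r)" False] by (simp add: in_H tip_simps)
  next
    case False
    then have "real r = real (s - 1) + 1" using x s by (simp add: of_nat_diff)
    then show ?thesis using x s that[of "(True, x, s - 1)" True] by (simp add: in_H tip_simps)
  qed
qed

lemma interior_not_node:
  assumes "e \<in> H" "0 < t" "t < 1" "0 \<le> l" "l \<le> 1"
  shows "\<Phi> (place e (t, l)) \<notin> nodes"
proof
  assume "\<Phi> (place e (t, l)) \<in> nodes"
  then obtain e' \<beta> where e': "e' \<in> H" "\<Phi> (place e (t, l)) = \<Phi> (tip e' \<beta>)"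
    using node_tip by blast
  show False
    using place_separated[OF assms(1) e'(1) assms(2,3) _ _ assms(4,5) _ _ e'(2)[unfolded tip_def]] assms
    by (auto split: if_splits)
qed


text \<open>The image is open in \<open>X\<close> because \<open>U\<close> is saturated and lies
  above height 0, and it is closed in the complement of \<open>D\<close> because taking the closure
  adds only points of \<open>D\<close>. A nonempty connected clopen set is a component.\<close>

lemma component_of_open_set:
  assumes D: "D \<subseteq> topspace X" and U: "U \<noteq> {}" "connected U" "openin (top_of_set K) U"
    and pos: "\<And>a. a \<in> U \<Longrightarrow> snd a > 0"
    and sat: "\<And>a b. a \<in> U \<Longrightarrow> b \<in> K \<Longrightarrow> \<Phi> a = \<Phi> b \<Longrightarrow> b \<in> U"
    and av: "\<Phi> ` U \<inter> D = {}" and clU: "\<Phi> ` closure U \<subseteq> \<Phi> ` U \<union> D"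
  shows "\<Phi> ` U \<in> connected_components_of (subtopology X (topspace X - D))"
    and "X closure_of (\<Phi> ` U) = \<Phi> ` closure U"
proof -
  have contK: "continuous_map (top_of_set K) X \<Phi>" using cont by (simp add: K_def)
  have UK: "U \<subseteq> K" using U(3) openin_imp_subset by blast
  have "closed K" by (simp add: K_def closed_Times)
  then have clK: "closure U \<subseteq> K" using UK by (simp add: closure_minimal)
  have op: "openin X (\<Phi> ` U)" using U pos sat by (intro opn) (auto simp: K_def)
  have cl: "closedin X (\<Phi> ` closure U)" using clK by (intro clo) (auto simp: K_def)
  have top: "\<Phi> ` U \<subseteq> topspace X - D" using op openin_subset av by blast
  let ?Y = "subtopology X (topspace X - D)"
  have opY: "openin ?Y (\<Phi> ` U)"
    using op top by (metis openin_subtopology inf.absorb1)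
  have "\<Phi> ` U = \<Phi> ` closure U \<inter> (topspace X - D)"
    using clU top closure_subset by blast
  then have clY: "closedin ?Y (\<Phi> ` U)" using cl closedin_subtopology by blast
  have "connectedin (top_of_set K) U" using U UK by (simp add: connectedin_subtopology)
  then have con: "connectedin ?Y (\<Phi> ` U)"
    using connectedin_continuous_map_image[OF contK] top by (simp add: connectedin_subtopology)
  obtain a where a: "a \<in> \<Phi> ` U" using U by blast
  have aT: "a \<in> topspace ?Y" using a top by auto
  have "connected_component_of_set ?Y a = \<Phi> ` U"
  proof
    show "\<Phi> ` U \<subseteq> connected_component_of_set ?Y a" by (rule connected_component_of_maximal[OF con a])
    have "a \<in> connected_component_of_set ?Y a" using aT by (simp add: connected_component_of_refl)
    then show "connected_component_of_set ?Y a \<subseteq> \<Phi> ` U"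
      using connectedin_clopen_cases[OF connectedin_connected_component_of clY opY, of a] a
      by (auto simp: disjnt_iff)
  qed
  then show "\<Phi> ` U \<in> connected_components_of ?Y"
    using aT unfolding connected_components_of_def by blast
  show "X closure_of (\<Phi> ` U) = \<Phi> ` closure U"
  proof
    show "X closure_of (\<Phi> ` U) \<subseteq> \<Phi> ` closure U"
      by (rule closure_of_minimal[OF image_mono[OF closure_subset] cl])
    have "top_of_set K closure_of U = closure U"
      using clK UK by (simp add: closure_of_subtopology Int_absorb1 Int_absorb2)
    then show "\<Phi> ` closure U \<subseteq> X closure_of (\<Phi> ` U)"
      using continuous_map_image_closure_subset[OF contK, of U] by simp
  qed
qed

end

section \<open>The embedded graph drawn along the grid edges\<close>

locale subdivided_chart = polar_chart +
  fixes m :: nat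
  assumes m: "m \<ge> 1"
begin

definition "halves = H \<times> {..m} \<times> (UNIV :: bool set)"

text \<open>Each of the \<open>m + 1\<close> curves drawn along a grid edge is split at its midpoint, which keeps the
  embedded graph simple. Both halves are parametrised towards the midpoint.\<close>

fun half :: "(bool \<times> nat \<times> nat) \<times> nat \<times> bool \<Rightarrow> real \<Rightarrow> 'a" where
  "half (e, i, \<beta>) u = \<Phi> (place e (if \<beta> then 1 - u / 2 else u / 2, real i / real m))"

declare half.simps [simp del]

definition "ends p = {half p 0, half p 1}"
definition "graph_vertices = nodes \<union> (\<lambda>p. half p 1) ` halves"
definition "graph_edges = ends ` halves"
definition "drawn f = half (inv_into halves ends f)"
definition "drawing = graph_vertices \<union> (\<Union>f\<in>graph_edges. drawn f ` {0..1})"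

text \<open>At \<open>u\<close> = 1 both halves of a curve are at its midpoint, hence the exception
  for \<beta>.\<close>

lemma half_separated:
  assumes p: "(e, i, \<beta>) \<in> halves" "(e', i', \<beta>') \<in> halves" and u: "0 < u" "u \<le> 1" "0 \<le> u'" "u' \<le> 1"
    and eq: "half (e, i, \<beta>) u = half (e', i', \<beta>') u'"
  shows "e = e' \<and> i = i' \<and> u = u' \<and> (u < 1 \<longrightarrow> \<beta> = \<beta>')"
proof -
  have "e = e' \<and> (if \<beta> then 1 - u / 2 else u / 2) = (if \<beta>' then 1 - u' / 2 else u' / 2) \<and>
      real i / real m = real i' / real m"
    by (rule place_separated) (use p u eq m in \<open>auto simp: halves_def half.simps\<close>)
  then show ?thesis using m u by (auto split: if_splits)
qed

lemma half_0: "half (e, i, \<beta>) 0 = \<Phi> (tip e \<beta>)"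
  using place_ends by (auto simp: half.simps)

lemma half_0_node: "p \<in> halves \<Longrightarrow> half p 0 \<in> nodes"
  by (cases p) (auto simp: halves_def half_0 tip_node)

lemma half_interior_not_node: "p \<in> halves \<Longrightarrow> 0 < u \<Longrightarrow> u \<le> 1 \<Longrightarrow> half p u \<notin> nodes"
proof -
  assume p: "p \<in> halves" "0 < u" "u \<le> 1"
  obtain e i \<beta> where p1: "p = (e, i, \<beta>)" by (cases p) auto
  show ?thesis
    unfolding p1 half.simps
    by (rule interior_not_node) (use p m in \<open>auto simp: p1 halves_def\<close>)
qed

text \<open>The midpoint determines the grid edge and the curve, and the other end tells the halves
  apart. This is what subdividing is for: parallel curves get different pairs of ends, so
  \<open>drawn\<close> can recover a curve from its two ends.\<close>

lemma inj_on_ends: "inj_on ends halves"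
proof (rule inj_onI)
  fix p p' assume p: "p \<in> halves" "p' \<in> halves" and eq: "ends p = ends p'"
  obtain e i \<beta> where p1: "p = (e, i, \<beta>)" by (cases p) auto
  obtain e' i' \<beta>' where p2: "p' = (e', i', \<beta>')" by (cases p') auto
  have "half p 1 \<noteq> half p' 0" using half_interior_not_node[OF p(1), of 1] half_0_node[OF p(2)] by auto
  then have h: "half p 1 = half p' 1" "half p 0 = half p' 0"
    using eq by (auto simp: ends_def doubleton_eq_iff)
  have ei: "e = e'" "i = i'"
    using half_separated[OF p[unfolded p1 p2] _ _ _ _ h(1)[unfolded p1 p2]] by auto
  have "e \<in> H" using p by (auto simp: p1 halves_def)
  from tips_distinct[OF this] h(2) have "\<beta> = \<beta>'"
    unfolding p1 p2 half_0 ei by (cases \<beta>; cases \<beta>') auto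
  then show "p = p'" using p1 p2 ei by simp
qed

lemma drawn_ends: "p \<in> halves \<Longrightarrow> drawn (ends p) = half p"
  by (simp add: drawn_def inj_on_ends)

text \<open>A continuous closed injection. Closed subsets of the unit interval go to compact subsets
  of \<open>K\<close>, which the chart maps to closed sets.\<close>

lemma half_embedding:
  assumes p: "p \<in> halves"
  shows "embedding_map (top_of_set {0..1}) X (half p)"
proof -
  obtain e i \<beta> where p1: "p = (e, i, \<beta>)" by (cases p) auto
  have e: "e \<in> H" "i \<le> m" using p by (auto simp: p1 halves_def)
  define c where "c u = place e (if \<beta> then 1 - u / 2 else u / 2, real i / real m)" for u
  have c: "continuous_on A c" for A
  proof -
    have "continuous_on A (\<lambda>u::real. (if \<beta> then 1 - u / 2 else u / 2, real i / real m))"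
      by (cases \<beta>; auto intro!: continuous_intros)
    from continuous_on_compose2[OF continuous_on_place[of UNIV] this] show ?thesis
      unfolding c_def by simp
  qed
  have cK: "c ` {0..1} \<subseteq> K"
    using e m by (auto simp: c_def intro!: place_bounds)
  have hc: "half p = \<Phi> \<circ> c" by (auto simp: p1 c_def half.simps)
  have contK: "continuous_map (top_of_set K) X \<Phi>" using cont by (simp add: K_def)
  have cm: "continuous_map (top_of_set {0..1}) X (half p)"
    unfolding hc by (rule continuous_map_compose[OF _ contK]) (use c cK in auto)
  show ?thesis
  proof (rule injective_closed_imp_embedding_map[OF cm])
    show "closed_map (top_of_set {0..1}) X (half p)"
      unfolding closed_map_def
    proof (intro allI impI)
      fix C assume "closedin (top_of_set {0..1::real}) C"
      then have C: "closed C" "C \<subseteq> {0..1}"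
        using closedin_closed_trans closedin_imp_subset by (blast, blast)
      then have "compact (c ` C)"
        by (intro compact_continuous_image c) (meson bounded_closed_interval bounded_subset compact_eq_bounded_closed)
      moreover have "c ` C \<subseteq> K" using C cK by blast
      ultimately show "closedin X (half p ` C)"
        unfolding hc image_comp[symmetric] by (intro clo) (auto simp: K_def compact_imp_closed)
    qed
    show "inj_on (half p) (topspace (top_of_set {0..1}))"
    proof (rule inj_onI)
      fix u u' assume u: "u \<in> topspace (top_of_set {0..1::real})" "u' \<in> topspace (top_of_set {0..1::real})"
        and eq: "half p u = half p u'"
      show "u = u'"
      proof (cases "u = 0")
        case True
        then show ?thesis
          using half_separated[of e i \<beta> e i \<beta> u' u] p u eq by (cases "u' = 0") (auto simp: p1)
      next
        case False
        then show ?thesis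
          using half_separated[of e i \<beta> e i \<beta> u u'] p u eq by (auto simp: p1)
      qed
    qed
  qed
qed

lemma graph_vertices_top: "graph_vertices \<subseteq> topspace X"
proof -
  have img: "\<Phi> ` K \<subseteq> topspace X"
    using continuous_map_image_subset_topspace[OF cont] by (simp add: K_def)
  have "nodes \<subseteq> \<Phi> ` K" using tip_in_K node_tip by blast
  moreover have "half p 1 \<in> \<Phi> ` K" if "p \<in> halves" for p
    using that m by (cases p) (auto simp: halves_def half.simps intro!: imageI place_bounds)
  ultimately show ?thesis using img by (auto simp: graph_vertices_def)
qed

lemma drawing_embedded: "embedded_graph X graph_vertices graph_edges drawn"
  unfolding embedded_graph_def
proof (intro conjI ballI impI)
  have finH: "finite halves" by (simp add: halves_def grid_edges_def)
  show "simple_graph graph_vertices graph_edges"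
    unfolding simple_graph_def
  proof (intro conjI ballI)
    show "finite graph_vertices" using finH by (simp add: graph_vertices_def nodes_def)
    fix f assume "f \<in> graph_edges"
    then obtain p where p: "p \<in> halves" "f = ends p" by (auto simp: graph_edges_def)
    show "f \<subseteq> graph_vertices" using p half_0_node by (auto simp: ends_def graph_vertices_def)
    have "half p 0 \<noteq> half p 1" using half_interior_not_node[OF p(1), of 1] half_0_node[OF p(1)] by auto
    then show "card f = 2" by (simp add: p ends_def)
  qed
  show "graph_vertices \<subseteq> topspace X" by (rule graph_vertices_top)
  fix f assume "f \<in> graph_edges"
  then obtain p where p: "p \<in> halves" "f = ends p" by (auto simp: graph_edges_def)
  have d: "drawn f = half p" by (simp add: p drawn_ends)
  show "embedding_map (top_of_set {0..1}) X (drawn f)" unfolding d by (rule half_embedding[OF p(1)])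
  show "{drawn f 0, drawn f 1} = f" unfolding d by (simp add: p ends_def)
  obtain e i \<beta> where p1: "p = (e, i, \<beta>)" by (cases p) auto
  show "drawn f ` {0<..<1} \<inter> graph_vertices = {}"
  proof -
    have "half p u \<noteq> half p' 1" if "p' \<in> halves" "0 < u" "u < 1" for u p'
      using half_separated[of e i \<beta> "fst p'" "fst (snd p')" "snd (snd p')" u 1] p that
      by (cases p') (auto simp: p1)
    then show ?thesis
      using half_interior_not_node[OF p(1)] unfolding d graph_vertices_def by fastforce
  qed
  fix g assume "g \<in> graph_edges" "f \<noteq> g"
  then obtain p' where p': "p' \<in> halves" "g = ends p'" unfolding graph_edges_def by blast
  then have "p \<noteq> p'" using p \<open>f \<noteq> g\<close> by auto
  have d': "drawn g = half p'" by (simp add: p' drawn_ends)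
  have "half p u \<noteq> half p' u'" if "0 < u" "u < 1" "0 < u'" "u' < 1" for u u'
    using half_separated[of e i \<beta> "fst p'" "fst (snd p')" "snd (snd p')" u u'] p p' that \<open>p \<noteq> p'\<close>
    by (cases p') (auto simp: p1)
  then show "drawn f ` {0<..<1} \<inter> drawn g ` {0<..<1} = {}"
    unfolding d d' by auto
qed

lemma drawing_eq:
  "drawing = nodes \<union> {\<Phi> (place e (t, real i / real m)) | e t i. e \<in> H \<and> 0 \<le> t \<and> t \<le> 1 \<and> i \<le> m}"
  (is "_ = nodes \<union> ?C")
proof
  have h: "half p u \<in> ?C" if "p \<in> halves" "0 \<le> u" "u \<le> 1" for p u
  proof -
    obtain e i \<beta> where p1: "p = (e, i, \<beta>)" by (cases p) auto
    have "half p u = \<Phi> (place e (if \<beta> then 1 - u / 2 else u / 2, real i / real m))" by (simp add: p1 half.simps)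
    moreover have "0 \<le> (if \<beta> then 1 - u / 2 else u / 2)" "(if \<beta> then 1 - u / 2 else u / 2) \<le> 1" "e \<in> H" "i \<le> m"
      using that by (auto simp: p1 halves_def)
    ultimately show ?thesis by blast
  qed
  show "drawing \<subseteq> nodes \<union> ?C"
  proof
    fix x assume "x \<in> drawing"
    then consider "x \<in> nodes" | p where "p \<in> halves" "x = half p 1" | p where "p \<in> halves" "x \<in> drawn (ends p) ` {0..1}"
      unfolding drawing_def graph_vertices_def graph_edges_def by blast
    then show "x \<in> nodes \<union> ?C"
    proof cases
      case 2
      then show ?thesis using h[of p 1] by simp
    next
      case 3
      then obtain u where "x = half p u" "0 \<le> u" "u \<le> 1" by (auto simp: drawn_ends)
      with 3 h show ?thesis by simp
    qed simp
  qed
  have "\<Phi> (place e (t, real i / real m)) \<in> drawing" if "e \<in> H" "0 \<le> t" "t \<le> 1" "i \<le> m" for e t i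
  proof -
    define p where "p = (e, i, t > 1 / 2)"
    have p: "p \<in> halves" using that by (simp add: p_def halves_def)
    have "\<Phi> (place e (t, real i / real m)) = half p (if t > 1 / 2 then 2 - 2 * t else 2 * t)"
      by (simp add: p_def half.simps diff_divide_distrib)
    moreover have "(if t > 1 / 2 then 2 - 2 * t else 2 * t) \<in> {0..1}" using that by auto
    ultimately have "\<Phi> (place e (t, real i / real m)) \<in> drawn (ends p) ` {0..1}"
      unfolding drawn_ends[OF p] by blast
    then show ?thesis using p by (auto simp: drawing_def graph_edges_def)
  qed
  then show "nodes \<union> ?C \<subseteq> drawing" unfolding drawing_def graph_vertices_def by blast
qed

lemma drawing_top: "drawing \<subseteq> topspace X"
proof -
  have img: "\<Phi> ` K \<subseteq> topspace X"
    using continuous_map_image_subset_topspace[OF cont] by (simp add: K_def)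
  have "\<Phi> (place e (t, real i / real m)) \<in> \<Phi> ` K" if "e \<in> H" "0 \<le> t" "t \<le> 1" "i \<le> m" for e t i
    using that m by (intro imageI place_bounds) auto
  then show ?thesis using img graph_vertices_top unfolding drawing_eq graph_vertices_def by blast
qed

lemma faces_eq: "embedding_faces X graph_vertices graph_edges drawn =
    connected_components_of (subtopology X (topspace X - drawing))"
  by (simp add: embedding_faces_def drawing_def)

section \<open>The nations and their faces\<close>

definition "lens e j = place e ` ({0<..<1} \<times> {real j / real m<..<real (Suc j) / real m})"
text \<open>The lenses of the top row bulge upwards from height \<open>s\<close> towards the pole,
  so they have to be cut out.\<close>

definition "polar_cap = K - ({a. snd a \<le> real s} \<union> (\<Union>x<W. place (False, x, s - 1) ` ({0..1} \<times> {0..1})))"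
definition "nation i = (case i of None \<Rightarrow> polar_cap | Some (e, j) \<Rightarrow> lens e j)"
definition "nations = insert None (Some ` (H \<times> {..<m}))"

lemma level_bounds:
  assumes "j < m" "real j / real m \<le> l" "l \<le> real (Suc j) / real m"
  shows "0 \<le> l" "l \<le> 1"
proof -
  show "0 \<le> l" using assms(2) by (rule order_trans[rotated]) simp
  have "real (Suc j) / real m \<le> 1" using assms(1) by simp
  with assms(3) show "l \<le> 1" by simp
qed

text \<open>Shifting the base point to the origin, and exchanging coordinates for a column edge,
  turns the lens into the region between two multiples of \<open>bump\<close> over the open unit
  interval.\<close>

lemma open_lens: "open (lens e j)"
proof -
  obtain v x r where e: "e = (v, x, r)" by (cases e) auto
  let ?lo = "real j / real m" and ?hi = "real (Suc j) / real m"
  have strip: "{t0. \<exists>t l. t0 = (t, l * bump t) \<and> 0 < t \<and> t < 1 \<and> ?lo < l \<and> l < ?hi} =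
      {a. 0 < fst a \<and> fst a < 1 \<and> ?lo * bump (fst a) < snd a \<and> snd a < ?hi * bump (fst a)}" (is "?S = ?R")
  proof
    show "?S \<subseteq> ?R"
      by (auto simp del: times_divide_eq_left of_nat_Suc intro!: mult_strict_right_mono bump_pos)
    show "?R \<subseteq> ?S"
    proof
      fix a assume a: "a \<in> ?R"
      then have b: "0 < bump (fst a)" by (simp add: bump_pos)
      have "a = (fst a, snd a / bump (fst a) * bump (fst a))" using b by simp
      moreover have "?lo < snd a / bump (fst a)" "snd a / bump (fst a) < ?hi"
        using a b by (simp_all add: pos_less_divide_eq pos_divide_less_eq)
      ultimately show "a \<in> ?S" using a by blast
    qed
  qed
  have open_strip: "open ?R"
    by (intro open_Collect_conj open_Collect_less continuous_intros)
  show ?thesis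
  proof (cases v)
    case True
    have "lens e j = (\<lambda>a. (snd a - real r, fst a - real x)) -` ?R"
    proof -
      have "lens e j = {a. (snd a - real r, fst a - real x) \<in> ?S}"
      proof (intro equalityI subsetI)
        fix a assume "a \<in> lens e j"
        then obtain t l where tl: "a = place e (t, l)" "0 < t" "t < 1" "?lo < l" "l < ?hi"
          by (auto simp: lens_def)
        then have "(snd a - real r, fst a - real x) = (t, l * bump t)" by (simp add: e True place.simps)
        with tl show "a \<in> {a. (snd a - real r, fst a - real x) \<in> ?S}" by blast
      next
        fix a assume "a \<in> {a. (snd a - real r, fst a - real x) \<in> ?S}"
        then obtain t l where tl: "(snd a - real r, fst a - real x) = (t, l * bump t)" "0 < t" "t < 1" "?lo < l" "l < ?hi"
          by blast
        then have "a = place e (t, l)" by (auto simp: e True place.simps prod_eq_iff)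
        with tl show "a \<in> lens e j" by (auto simp: lens_def simp del: of_nat_Suc)
      qed
      then show ?thesis unfolding strip by auto
    qed
    then show ?thesis
      using open_vimage[OF open_strip, of "\<lambda>a. (snd a - real r, fst a - real x)"]
      by (simp add: continuous_intros)
  next
    case False
    have "lens e j = (\<lambda>a. (fst a - real x, snd a - (real r + 1))) -` ?R"
    proof -
      have "lens e j = {a. (fst a - real x, snd a - (real r + 1)) \<in> ?S}"
      proof (intro equalityI subsetI)
        fix a assume "a \<in> lens e j"
        then obtain t l where tl: "a = place e (t, l)" "0 < t" "t < 1" "?lo < l" "l < ?hi"
          by (auto simp: lens_def)
        then have "(fst a - real x, snd a - (real r + 1)) = (t, l * bump t)" by (simp add: e False place.simps)
        with tl show "a \<in> {a. (fst a - real x, snd a - (real r + 1)) \<in> ?S}" by blast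
      next
        fix a assume "a \<in> {a. (fst a - real x, snd a - (real r + 1)) \<in> ?S}"
        then obtain t l where tl: "(fst a - real x, snd a - (real r + 1)) = (t, l * bump t)" "0 < t" "t < 1" "?lo < l" "l < ?hi"
          by blast
        then have "a = place e (t, l)" by (auto simp: e False place.simps prod_eq_iff)
        with tl show "a \<in> lens e j" by (auto simp: lens_def simp del: of_nat_Suc)
      qed
      then show ?thesis unfolding strip by auto
    qed
    then show ?thesis
      using open_vimage[OF open_strip, of "\<lambda>a. (fst a - real x, snd a - (real r + 1))"]
      by (simp add: continuous_intros)
  qed
qed

lemma closure_lens: "closure (lens e j) = place e ` ({0..1} \<times> {real j / real m..real (Suc j) / real m})"
proof
  let ?B = "{0<..<1 :: real} \<times> {real j / real m<..<real (Suc j) / real m}"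
  have lt: "real j / real m < real (Suc j) / real m" using m by (intro divide_strict_right_mono) auto
  have cb: "closure ?B = {0..1} \<times> {real j / real m..real (Suc j) / real m}"
    using lt by (simp add: closure_Times closure_greaterThanLessThan del: of_nat_Suc)
  have "compact (place e ` closure ?B)"
    unfolding cb by (intro compact_continuous_image continuous_on_place compact_Times) auto
  then show "closure (lens e j) \<subseteq> place e ` ({0..1} \<times> {real j / real m..real (Suc j) / real m})"
    unfolding cb[symmetric] lens_def
    by (intro closure_minimal image_mono closure_subset compact_imp_closed)
  show "place e ` ({0..1} \<times> {real j / real m..real (Suc j) / real m}) \<subseteq> closure (lens e j)"
    unfolding cb[symmetric] lens_def
    by (rule image_closure_subset) (auto intro: continuous_on_place closure_subset[THEN subsetD])
qed

lemma lens_face: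
  assumes e: "e \<in> H" and j: "j < m"
  shows "\<Phi> ` lens e j \<in> embedding_faces X graph_vertices graph_edges drawn"
    and "X closure_of (\<Phi> ` lens e j) = \<Phi> ` closure (lens e j)"
    and "lens e j \<noteq> {}"
    and "\<And>a b. a \<in> lens e j \<Longrightarrow> b \<in> K \<Longrightarrow> \<Phi> a = \<Phi> b \<Longrightarrow> b \<in> lens e j"
proof -
  have lt: "real j / real m < real (Suc j) / real m" using m by (intro divide_strict_right_mono) auto
  have el: "\<exists>t l. a = place e (t, l) \<and> 0 < t \<and> t < 1 \<and> real j / real m < l \<and> l < real (Suc j) / real m \<and> 0 < l \<and> l \<le> 1"
    if a: "a \<in> lens e j" for a
  proof -
    obtain t l where tl: "a = place e (t, l)" "0 < t" "t < 1" "real j / real m < l" "l < real (Suc j) / real m"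
      using a by (auto simp: lens_def)
    moreover have "0 < l" using tl(4) by (rule le_less_trans[rotated]) simp
    ultimately show ?thesis using level_bounds[OF j, of l] by auto
  qed
  have K: "lens e j \<subseteq> K"
  proof
    fix a assume "a \<in> lens e j"
    from el[OF this] show "a \<in> K" using place_bounds(1)[OF e] by fastforce
  qed
  \<comment> \<open>Column lenses bulge to the right, so even those over longitude 0 stay strictly
    off the seam. Away from seam, pole and height 0 the chart identifies nothing.\<close>
  have side: "0 < fst a \<and> fst a < real W \<and> 0 < snd a \<and> snd a < real s + 1" if a: "a \<in> lens e j" for a
  proof -
    obtain t l where tl: "a = place e (t, l)" "0 < t" "t < 1" "0 < l" "l \<le> 1" using el[OF a] by auto
    obtain v x r where e1: "e = (v, x, r)" by (cases e) auto
    have "real x + 1 \<le> real W" using e by (auto simp: e1 in_H simp flip: of_nat_Suc)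
    moreover have "0 < l * bump t" "l * bump t \<le> 1 / 8"
      using tl bump_pos[of t] bump_bounds(4)[of t l] by auto
    ultimately show ?thesis
      using tl place_bounds(2,3)[OF e, of t l] by (auto simp: e1 place.simps)
  qed
  have sat: "b \<in> lens e j" if ab: "a \<in> lens e j" "b \<in> K" "\<Phi> a = \<Phi> b" for a b
  proof -
    have "a \<in> K" using ab K by auto
    from sep[OF this[unfolded K_def] ab(2)[unfolded K_def] _ ab(3)] side[OF ab(1)]
    have "a = b" by (auto simp: doubleton_eq_iff)
    with ab show ?thesis by simp
  qed
  \<comment> \<open>Drawn curves sit at the levels i / m, and a lens lies strictly between two
    consecutive ones.\<close>
  have av: "\<Phi> ` lens e j \<inter> drawing = {}"
  proof -
    have False if a: "a \<in> lens e j" and d: "\<Phi> a \<in> drawing" for a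
    proof -
      obtain t l where tl: "a = place e (t, l)" "0 < t" "t < 1" "0 < l" "l \<le> 1"
        "real j / real m < l" "l < real (Suc j) / real m" using el[OF a] by auto
      have "\<Phi> a \<notin> nodes" using interior_not_node[OF e, of t l] tl by simp
      then obtain e' t' i where i: "\<Phi> a = \<Phi> (place e' (t', real i / real m))" "e' \<in> H" "0 \<le> t'" "t' \<le> 1" "i \<le> m"
        using d unfolding drawing_eq by blast
      have "l = real i / real m"
        using place_separated[OF e i(2) tl(2,3) i(3,4), of l "real i / real m"] i tl m by auto
      then have "real j < real i" "real i < real (Suc j)"
        using tl m by (auto simp: divide_less_cancel simp del: of_nat_Suc)
      then have "j < i" "i < Suc j" by (simp_all only: of_nat_less_iff)
      then show False by linarith
    qed
    then show ?thesis by blast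
  qed
  have cl: "\<Phi> ` closure (lens e j) \<subseteq> \<Phi> ` lens e j \<union> drawing"
  proof -
    have pt: "\<Phi> (place e (t, l)) \<in> \<Phi> ` lens e j \<union> drawing"
      if tl: "0 \<le> t" "t \<le> 1" "real j / real m \<le> l" "l \<le> real (Suc j) / real m" for t l
    proof -
      consider "t = 0" | "t = 1" | "l = real j / real m" | "l = real (Suc j) / real m"
        | "0 < t" "t < 1" "real j / real m < l" "l < real (Suc j) / real m"
        using tl by linarith
      then show ?thesis
      proof cases
        case 1
        then show ?thesis using tip_node[OF e] by (simp add: place_ends drawing_eq)
      next
        case 2
        then show ?thesis using tip_node[OF e] by (simp add: place_ends drawing_eq)
      next
        case 3
        then show ?thesis unfolding drawing_eq using e j tl less_imp_le by blast
      next
        case 4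
        then show ?thesis unfolding drawing_eq using e Suc_leI[OF j] tl by blast
      next
        case 5
        then show ?thesis by (auto simp: lens_def)
      qed
    qed
    show ?thesis
    proof
      fix p assume "p \<in> \<Phi> ` closure (lens e j)"
      then obtain t l where "p = \<Phi> (place e (t, l))" "0 \<le> t" "t \<le> 1" "real j / real m \<le> l" "l \<le> real (Suc j) / real m"
        unfolding closure_lens by (auto simp del: of_nat_Suc)
      with pt show "p \<in> \<Phi> ` lens e j \<union> drawing" by simp
    qed
  qed
  have "connected (lens e j)"
    unfolding lens_def by (intro connected_continuous_image continuous_on_place connected_Times) auto
  moreover have "lens e j \<noteq> {}" using lt by (simp add: lens_def del: of_nat_Suc)
  moreover have "openin (top_of_set K) (lens e j)" using K open_lens by (rule open_subset)
  moreover have "snd a > 0" if "a \<in> lens e j" for a using side[OF that] by simp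
  ultimately show "\<Phi> ` lens e j \<in> embedding_faces X graph_vertices graph_edges drawn"
    and "X closure_of (\<Phi> ` lens e j) = \<Phi> ` closure (lens e j)" and "lens e j \<noteq> {}"
    and "\<And>a b. a \<in> lens e j \<Longrightarrow> b \<in> K \<Longrightarrow> \<Phi> a = \<Phi> b \<Longrightarrow> b \<in> lens e j"
    using component_of_open_set[OF drawing_top, of "lens e j"] sat av cl unfolding faces_eq by auto
qed

text \<open>Since \<open>bump\<close> is at most 1/8, only edges of the top row rise above height
  \<open>s\<close>, and their lenses are cut out of the cap.\<close>

lemma place_not_polar:
  assumes "e \<in> H" "0 \<le> t" "t \<le> 1" "0 \<le> l" "l \<le> 1"
  shows "place e (t, l) \<notin> polar_cap"
proof
  assume a: "place e (t, l) \<in> polar_cap"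
  obtain v x r where e: "e = (v, x, r)" by (cases e) auto
  have x: "x < W" "r < s" using assms by (auto simp: e in_H)
  have up: "real s < snd (place e (t, l))" using a by (auto simp: polar_cap_def)
  have rs: "real r + 1 \<le> real s" using x by (simp flip: of_nat_Suc)
  have "\<not> v" using up rs assms by (auto simp: e place.simps)
  moreover from this have "real s < real r + 1 + 1 / 8"
    using up bump_bounds(4)[OF assms(2-5)] by (auto simp: e place.simps)
  then have "r = s - 1" using x by linarith
  ultimately have "place e (t, l) \<in> (\<Union>x<W. place (False, x, s - 1) ` ({0..1} \<times> {0..1}))"
    using x assms unfolding e by (intro UN_I[of x] imageI) auto
  then show False using a unfolding polar_cap_def by blast
qed

text \<open>The lenses of the top row have thickness 0 at grid points, so the polar cap reaches down
  to the top of every column. Hence the polar nation touches all columns.\<close>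

lemma top_row_segment:
  assumes x: "x < W"
  shows "{real x} \<times> {real s<..real s + 1} \<subseteq> polar_cap"
proof
  fix a assume a: "a \<in> {real x} \<times> {real s<..real s + 1}"
  have "a \<notin> place (False, x', s - 1) ` ({0..1} \<times> {0..1})" for x'
  proof
    assume "a \<in> place (False, x', s - 1) ` ({0..1} \<times> {0..1})"
    then obtain t l where tl: "a = place (False, x', s - 1) (t, l)" "0 \<le> t" "t \<le> 1" by auto
    have eq: "real x = real x' + t" using a tl by (auto simp: place.simps)
    have "t = 0 \<or> t = 1" using nat_plus_fraction_eq[of x 0 x' t] eq tl by (cases "t < 1") auto
    then have "snd a = real s" using tl s by (auto simp: place.simps of_nat_diff)
    then show False using a by auto
  qed
  then show "a \<in> polar_cap" using a x by (auto simp: polar_cap_def K_def)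
qed

text \<open>The cap is connected because each of its points can move straight up to the segment at
  height s + 1. Its other limit points lie on the curves of the top row.\<close>

lemma polar_face:
  shows "\<Phi> ` polar_cap \<in> embedding_faces X graph_vertices graph_edges drawn"
    and "X closure_of (\<Phi> ` polar_cap) = \<Phi> ` closure polar_cap"
    and "polar_cap \<noteq> {}"
proof -
  define L where "L = (\<Union>x<W. place (False, x, s - 1) ` ({0..1} \<times> {0..1}))"
  have pc: "polar_cap = K - ({a. snd a \<le> real s} \<union> L)" by (simp add: polar_cap_def L_def)
  have up: "real s < snd a" "a \<in> K" if "a \<in> polar_cap" for a
    using that by (auto simp: pc)
  have inH: "(False, x, s - 1) \<in> H" if "x < W" for x using that s by (simp add: in_H)
  have closedL: "closed L"
    unfolding L_def by (intro closed_UN ballI compact_imp_closed compact_continuous_image continuous_on_place compact_Times) auto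
  have op: "openin (top_of_set K) polar_cap"
  proof -
    have "closed ({a. snd a \<le> real s} \<union> L)"
      by (intro closed_Un closedL closed_Collect_le continuous_intros)
    then have "open (- ({a. snd a \<le> real s} \<union> L))" by (rule open_Compl)
    moreover have "polar_cap = K \<inter> - ({a. snd a \<le> real s} \<union> L)" by (auto simp: pc)
    ultimately show ?thesis using openin_open by metis
  qed
  have lens_low: "snd a < real s + 1" if "a \<in> L" for a
    using that place_bounds(2)[OF inH] by (auto simp: L_def)
  have top: "{0..real W} \<times> {real s + 1} \<subseteq> polar_cap"
  proof
    fix a assume a: "a \<in> {0..real W} \<times> {real s + 1}"
    then have "a \<in> K" "real s < snd a" by (auto simp: K_def)
    moreover have "a \<notin> L" using lens_low[of a] a by force
    ultimately show "a \<in> polar_cap" unfolding pc by auto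
  qed
  \<comment> \<open>A lens of the top row fills everything from height \<open>s\<close> up to a
    graph. If a point above \<open>a\<close> were in it, rescaling the level to \<open>l'\<close>
    would put \<open>a\<close> in it too.\<close>
  have ray: "{fst a} \<times> {snd a..real s + 1} \<subseteq> polar_cap" if a: "a \<in> polar_cap" for a
  proof
    fix b assume b: "b \<in> {fst a} \<times> {snd a..real s + 1}"
    have "b \<notin> L"
    proof
      assume "b \<in> L"
      then obtain x t l where x: "x < W" "b = place (False, x, s - 1) (t, l)" "0 \<le> t" "t \<le> 1" "0 \<le> l" "l \<le> 1"
        by (auto simp: L_def)
      have s1: "real (s - 1) + 1 = real s" using s by (simp add: of_nat_diff)
      have fa: "fst a = real x + t" and sb: "snd b = real s + l * bump t"
        using x b s1 by (auto simp: place.simps)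
      have h: "0 < snd a - real s" "snd a - real s \<le> l * bump t" using up[OF a] sb b by auto
      have bp: "0 < bump t"
      proof (rule ccontr)
        assume "\<not> 0 < bump t"
        then have "l * bump t \<le> 0" using x by (simp add: mult_nonneg_nonpos)
        with h show False by linarith
      qed
      define l' where "l' = (snd a - real s) / bump t"
      have "0 \<le> l'" "l' \<le> l" using h bp by (auto simp: l'_def pos_divide_le_eq)
      moreover have "a = place (False, x, s - 1) (t, l')"
        using fa bp s1 by (auto simp: place.simps l'_def prod_eq_iff)
      ultimately show False using place_not_polar[OF inH[OF x(1)], of t l'] x a by auto
    qed
    moreover have "b \<in> K" "real s < snd b" using b up[OF a] by (auto simp: K_def)
    ultimately show "b \<in> polar_cap" by (auto simp: pc)
  qed
  have con: "connected polar_cap"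
  proof -
    let ?T = "{0..real W} \<times> {real s + 1}"
    let ?F = "(\<lambda>a. ?T \<union> {fst a} \<times> {snd a..real s + 1}) ` polar_cap"
    have "connected (\<Union>?F)"
    proof (rule connected_Union)
      fix C assume "C \<in> ?F"
      then obtain a where a: "a \<in> polar_cap" "C = ?T \<union> {fst a} \<times> {snd a..real s + 1}" by auto
      have "(fst a, real s + 1) \<in> ?T \<inter> {fst a} \<times> {snd a..real s + 1}"
        using up[OF a(1)] by (auto simp: K_def)
      then have "{0..real W} \<times> {real s + 1} \<inter> {fst a} \<times> {snd a..real s + 1} \<noteq> {}" by blast
      then show "connected C" unfolding a(2)
        by (intro connected_Un connected_Times) auto
    next
      have "(0, real s + 1) \<in> \<Inter>?F" by auto
      then show "\<Inter>?F \<noteq> {}" by blast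
    qed
    moreover have "\<Union>?F = polar_cap"
    proof
      show "\<Union>?F \<subseteq> polar_cap" using top ray by blast
      show "polar_cap \<subseteq> \<Union>?F"
      proof
        fix a assume a: "a \<in> polar_cap"
        then have "a \<in> {fst a} \<times> {snd a..real s + 1}" using up[OF a] by (cases a) (auto simp: K_def)
        show "a \<in> \<Union>?F"
        proof (rule UnionI)
          show "?T \<union> {fst a} \<times> {snd a..real s + 1} \<in> ?F" by (rule image_eqI[OF refl a])
        qed (rule UnI2, fact)
      qed
    qed
    ultimately show ?thesis by simp
  qed
  have sat: "b \<in> polar_cap" if ab: "a \<in> polar_cap" "b \<in> K" "\<Phi> a = \<Phi> b" for a b
  proof -
    have "0 < snd a" using up[OF ab(1)] by linarith
    from sep[OF up(2)[OF ab(1), unfolded K_def] ab(2)[unfolded K_def] this ab(3)]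
    consider "a = b" | "snd b = real s + 1" | "snd a = snd b" "fst b = 0 \<or> fst b = real W"
      by (auto simp: doubleton_eq_iff)
    then show ?thesis
    proof cases
      case 1
      then show ?thesis using ab by simp
    next
      case 2
      then have "b \<in> {0..real W} \<times> {real s + 1}" using ab by (cases b) (auto simp: K_def)
      then show ?thesis using top by blast
    next
      case 3
      have "b \<notin> L"
      proof
        assume "b \<in> L"
        then obtain x t l where x: "x < W" "b = place (False, x, s - 1) (t, l)" "0 \<le> t" "t \<le> 1" by (auto simp: L_def)
        have "real x + 1 \<le> real W" using x by (simp flip: of_nat_Suc)
        then have "t = 0 \<or> t = 1" using 3(2) x by (auto simp: place.simps)
        then have "snd b = real s" using x s by (auto simp: place.simps of_nat_diff)
        then show False using 3 up[OF ab(1)] by simp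
      qed
      then show ?thesis using ab 3 up[OF ab(1)] by (auto simp: pc)
    qed
  qed
  have av: "\<Phi> ` polar_cap \<inter> drawing = {}"
  proof -
    have no: "\<Phi> a \<noteq> \<Phi> (place e (t, l))" if "a \<in> polar_cap" "e \<in> H" "0 \<le> t" "t \<le> 1" "0 \<le> l" "l \<le> 1" for a e t l
      using sat[OF that(1) place_bounds(1)[OF that(2-6)]] place_not_polar[OF that(2-6)] by auto
    have "\<Phi> a \<notin> nodes" if "a \<in> polar_cap" for a
    proof
      assume "\<Phi> a \<in> nodes"
      then obtain e \<beta> where "e \<in> H" "\<Phi> a = \<Phi> (tip e \<beta>)" using node_tip by blast
      with no[OF that, of e "if \<beta> then 1 else 0" 0] show False by (cases \<beta>) (auto simp: tip_def)
    qed
    moreover have "\<Phi> a \<noteq> \<Phi> (place e (t, real i / real m))" if "a \<in> polar_cap" "e \<in> H" "0 \<le> t" "t \<le> 1" "i \<le> m" for a e t i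
      using no[OF that(1-4), of "real i / real m"] that m by simp
    ultimately show ?thesis unfolding drawing_eq by blast
  qed
  have cl: "\<Phi> ` closure polar_cap \<subseteq> \<Phi> ` polar_cap \<union> drawing"
  proof
    fix p assume "p \<in> \<Phi> ` closure polar_cap"
    then obtain a where a: "a \<in> closure polar_cap" "p = \<Phi> a" by auto
    show "p \<in> \<Phi> ` polar_cap \<union> drawing"
    proof (cases "a \<in> polar_cap")
      case False
      have "closed (K \<inter> {a. real s \<le> snd a})"
        by (intro closed_Int closed_Collect_le continuous_intros) (simp add: K_def closed_Times)
      moreover have "polar_cap \<subseteq> K \<inter> {a. real s \<le> snd a}" using up by force
      ultimately have aK: "a \<in> K" "real s \<le> snd a"
        using closure_minimal[of polar_cap] a by blast+
      have s1: "real (s - 1) + 1 = real s" using s by (simp add: of_nat_diff)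
      \<comment> \<open>A limit point outside the cap is in a lens of the top row or exactly at
        height \<open>s\<close>. In the second case it is on the lower side of the lens found by
        rounding its longitude down; at longitude \<open>W\<close> it is the right end of the last
        row edge.\<close>
      obtain x t l where x: "x < W" "a = place (False, x, s - 1) (t, l)" "0 \<le> t" "t \<le> 1" "0 \<le> l" "l \<le> 1"
      proof (cases "a \<in> L")
        case True
        then show ?thesis using that by (auto simp: L_def)
      next
        case notL: False
        then have sa: "snd a = real s" using False aK unfolding pc by auto
        have f: "0 \<le> fst a" "fst a \<le> real W" using aK by (auto simp: K_def)
        show ?thesis
        proof (cases "fst a = real W")
          case True
          then have "a = place (False, W - 1, s - 1) (1, 0)"
            using sa s1 W by (auto simp: place.simps prod_eq_iff of_nat_diff)
          then show ?thesis using that[of "W - 1" 1 0] W by simp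
        next
          case False
          have n: "real (nat \<lfloor>fst a\<rfloor>) = of_int \<lfloor>fst a\<rfloor>" using f by simp
          have fl: "of_int \<lfloor>fst a\<rfloor> \<le> fst a" "fst a < of_int \<lfloor>fst a\<rfloor> + 1" by linarith+
          then have "a = place (False, nat \<lfloor>fst a\<rfloor>, s - 1) (fst a - of_int \<lfloor>fst a\<rfloor>, 0)"
            using sa s1 n by (auto simp: place.simps prod_eq_iff)
          moreover have "nat \<lfloor>fst a\<rfloor> < W"
          proof -
            have "real (nat \<lfloor>fst a\<rfloor>) < real W" using n fl f False by linarith
            then show ?thesis by simp
          qed
          ultimately show ?thesis using that[of "nat \<lfloor>fst a\<rfloor>" "fst a - of_int \<lfloor>fst a\<rfloor>" 0] fl by simp
        qed
      qed
      show ?thesis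
      proof (cases "t = 0 \<or> t = 1")
        case True
        then show ?thesis
          using tip_node[OF inH[OF x(1)]] a x by (auto simp: place_ends drawing_eq)
      next
        case t: False
        \<comment> \<open>Rounding the level down puts the point either on a drawn curve or inside
          an open lens. Such a lens misses the cap and therefore also its closure.\<close>
        define i where "i = nat \<lfloor>l * real m\<rfloor>"
        have i: "real i \<le> l * real m" "l * real m < real i + 1"
          using x by (auto simp: i_def)
        have "l * real m \<le> real m" using x mult_right_mono[of l 1 "real m"] by simp
        then have "real i \<le> real m" using i by linarith
        then have im: "i \<le> m" by simp
        show ?thesis
        proof (cases "l = real i / real m")
          case True
          then show ?thesis
            unfolding drawing_eq using a x inH[OF x(1)] im by blast
        next
          case False
          have "real i / real m \<le> l" using i m by (simp add: pos_divide_le_eq)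
          then have lo: "real i / real m < l" "l < real (Suc i) / real m"
            using i False m by (simp_all add: pos_less_divide_eq)
          then have "a \<in> lens (False, x, s - 1) i" using x t by (auto simp: lens_def simp del: of_nat_Suc)
          moreover have "i < m"
          proof (rule ccontr)
            assume "\<not> i < m"
            then have "1 \<le> real i / real m" using m by simp
            with lo x show False by linarith
          qed
          then have "lens (False, x, s - 1) i \<inter> polar_cap = {}"
            using place_not_polar[OF inH[OF x(1)]] level_bounds[of i] unfolding lens_def by fastforce
          then have "lens (False, x, s - 1) i \<inter> closure polar_cap = {}"
            using open_Int_closure_eq_empty[OF open_lens] by blast
          ultimately show ?thesis using a by blast
        qed
      qed
    qed (use a in auto)
  qed
  have "polar_cap \<noteq> {}" using top by fastforce
  moreover have "snd a > 0" if "a \<in> polar_cap" for a using up[OF that] by linarith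
  ultimately show "\<Phi> ` polar_cap \<in> embedding_faces X graph_vertices graph_edges drawn"
    and "X closure_of (\<Phi> ` polar_cap) = \<Phi> ` closure polar_cap" and "polar_cap \<noteq> {}"
    using component_of_open_set[OF drawing_top, of polar_cap] con op sat av cl unfolding faces_eq by auto
qed

lemma nation_simps [simp]: "nation None = polar_cap" "nation (Some (e, j)) = lens e j"
  by (simp_all add: nation_def)

lemma nation_face:
  assumes "i \<in> nations"
  shows "\<Phi> ` nation i \<in> embedding_faces X graph_vertices graph_edges drawn"
    and "X closure_of (\<Phi> ` nation i) = \<Phi> ` closure (nation i)" and "nation i \<noteq> {}"
  using assms polar_face lens_face(1-3) by (auto simp: nations_def)

lemma lens_element:
  assumes "a \<in> lens e j" "j < m"
  obtains t l where "a = place e (t, l)" "0 < t" "t < 1" "real j / real m < l" "l < real (Suc j) / real m"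
    "0 \<le> l" "l \<le> 1"
proof -
  obtain t l where "a = place e (t, l)" "0 < t" "t < 1" "real j / real m < l" "l < real (Suc j) / real m"
    using assms by (auto simp: lens_def)
  with that level_bounds[OF assms(2), of l] show ?thesis by auto
qed

lemma inj_on_nation: "inj_on (\<lambda>i. \<Phi> ` nation i) nations"
proof -
  have polar: False if ej: "(e, j) \<in> H \<times> {..<m}" "\<Phi> ` lens e j = \<Phi> ` polar_cap" for e j
  proof -
    have e: "e \<in> H" "j < m" using ej by auto
    obtain b where b: "b \<in> polar_cap" using polar_face(3) by blast
    then obtain a where a: "a \<in> lens e j" "\<Phi> a = \<Phi> b" using ej(2) by (metis imageE imageI)
    have "b \<in> K" using b by (auto simp: polar_cap_def)
    from lens_face(4)[OF e a(1) this a(2)] obtain t l where "b = place e (t, l)" "0 < t" "t < 1" "0 \<le> l" "l \<le> 1"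
      using lens_element[OF _ e(2)] by metis
    with place_not_polar[OF e(1), of t l] b show False by auto
  qed
  have lens: "e = e' \<and> j = j'" if ee: "e \<in> H" "j < m" "e' \<in> H" "j' < m" "\<Phi> ` lens e j = \<Phi> ` lens e' j'" for e j e' j'
  proof -
    obtain b where b: "b \<in> lens e' j'" using lens_face(3)[OF ee(3,4)] by blast
    then obtain a where a: "a \<in> lens e j" "\<Phi> a = \<Phi> b" using ee(5) by (metis imageE imageI)
    obtain t l where tl: "a = place e (t, l)" "0 < t" "t < 1" "real j / real m < l" "l < real (Suc j) / real m" "0 \<le> l" "l \<le> 1"
      using lens_element[OF a(1) ee(2)] .
    obtain t' l' where tl': "b = place e' (t', l')" "0 < t'" "t' < 1" "real j' / real m < l'" "l' < real (Suc j') / real m" "0 \<le> l'" "l' \<le> 1"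
      using lens_element[OF b ee(4)] .
    have eq: "e = e'" "l = l'"
      using place_separated[OF ee(1,3) tl(2,3) _ _ tl(6,7) tl'(6,7) a(2)[unfolded tl(1) tl'(1)]] tl'(2,3)
      by simp_all
    have "real j < real (Suc j')" "real j' < real (Suc j)"
      using order.strict_trans[OF tl(4) tl'(5)[folded eq]] order.strict_trans[OF tl'(4)[folded eq] tl(5)] m
      by (auto simp: divide_less_cancel simp del: of_nat_Suc)
    then show ?thesis using eq by simp
  qed
  show ?thesis
  proof (rule inj_onI)
    fix i i' assume i: "i \<in> nations" "i' \<in> nations" "\<Phi> ` nation i = \<Phi> ` nation i'"
    show "i = i'"
    proof -
      consider "i = None" "i' = None"
        | e j where "i = Some (e, j)" "i' = None" "(e, j) \<in> H \<times> {..<m}"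
        | e' j' where "i = None" "i' = Some (e', j')" "(e', j') \<in> H \<times> {..<m}"
        | e j e' j' where "i = Some (e, j)" "i' = Some (e', j')" "(e, j) \<in> H \<times> {..<m}" "(e', j') \<in> H \<times> {..<m}"
        using i(1,2) unfolding nations_def by blast
      then show ?thesis
      proof cases
        case 2
        then show ?thesis using polar[OF 2(3)] i(3) by simp
      next
        case 3
        then show ?thesis using polar[OF 3(3)] i(3) by simp
      next
        case 4
        then show ?thesis using lens[of e j e' j'] i(3) by simp
      qed simp
    qed
  qed
qed

section \<open>Incidences between nations and vertices\<close>

lemma lens_touches_tip:
  assumes "e \<in> H" "j < m"
  shows "\<Phi> (tip e \<beta>) \<in> X closure_of (\<Phi> ` lens e j)"
proof -
  have le: "real j / real m \<le> real (Suc j) / real m" by (simp add: divide_right_mono)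
  have "tip e \<beta> = place e (if \<beta> then 1 else 0, real j / real m)" by (simp add: place_ends)
  moreover have "(if \<beta> then 1 else 0 :: real, real j / real m) \<in> {0..1} \<times> {real j / real m..real (Suc j) / real m}"
    using le by (simp del: of_nat_Suc)
  ultimately show ?thesis unfolding lens_face(2)[OF assms] closure_lens by blast
qed

lemma polar_cap_touches_tip:
  assumes "x < W"
  shows "\<Phi> (tip (True, x, s - 1) True) \<in> X closure_of (\<Phi> ` polar_cap)"
proof -
  have "tip (True, x, s - 1) True = (real x, real s)" using s by (simp add: tip_simps of_nat_diff)
  moreover have "(real x, real s) \<in> closure ({real x} \<times> {real s<..real s + 1})"
    by (simp add: closure_Times closure_greaterThanAtMost)
  ultimately show ?thesis
    unfolding polar_face(2) using closure_mono[OF top_row_segment[OF assms]] by auto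
qed

text \<open>At height 0 there are only lower ends of columns, at most two of them glued together.
  Elsewhere one edge leaves in each of the four directions.\<close>

lemma card_incident_edges:
  assumes p: "p \<in> nodes"
  shows "card {e \<in> H. \<exists>\<beta>. p = \<Phi> (tip e \<beta>)} \<le> 4" (is "card ?I \<le> 4")
proof -
  obtain a r where a: "a < W" "r \<le> s" "p = \<Phi> (real a, real r)"
    using p by (auto simp: nodes_def)
  have aK: "(real a, real r) \<in> {0..real W} \<times> {0..real s + 1}" using a by auto
  show ?thesis
  proof (cases "r = 0")
    case True
    have "?I \<subseteq> (\<lambda>x. (True, x, 0)) ` {x'. x' < W \<and> \<Phi> (real x', 0) = \<Phi> (real a, 0)}"
    proof
      fix e assume "e \<in> ?I"
      then obtain \<beta> where e: "e \<in> H" "p = \<Phi> (tip e \<beta>)" by auto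
      obtain v x r' where e1: "e = (v, x, r')" by (cases e) auto
      have "\<not> 0 < snd (tip e \<beta>)"
        using sep[OF tip_in_K[OF e(1), unfolded K_def] aK, of \<beta>] e a True by auto
      then have "v" "\<not> \<beta>" "r' = 0" unfolding e1 by (cases v; cases \<beta>; simp add: tip_simps)+
      then show "e \<in> (\<lambda>x. (True, x, 0)) ` {x'. x' < W \<and> \<Phi> (real x', 0) = \<Phi> (real a, 0)}"
        using e a True by (auto simp: e1 tip_simps in_H)
    qed
    then have "card ?I \<le> card {x'. x' < W \<and> \<Phi> (real x', 0) = \<Phi> (real a, 0)}"
      by (rule surj_card_le[rotated]) simp
    then show ?thesis using bottom[OF a(1)] by linarith
  next
    case False
    \<comment> \<open>Up, down, right and left. The left neighbour of column 0 is reached across the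
      seam by the row edge that starts in column W - 1.\<close>
    let ?S = "{(True, a, r), (True, a, r - 1), (False, a, r - 1), (False, if a = 0 then W - 1 else a - 1, r - 1)}"
    have "?I \<subseteq> ?S"
    proof
      fix e assume "e \<in> ?I"
      then obtain \<beta> where e: "e \<in> H" "p = \<Phi> (tip e \<beta>)" by auto
      obtain v x r' where e1: "e = (v, x, r')" by (cases e) auto
      have x: "x < W" using e by (simp add: e1 in_H)
      have "(real a, real r) = tip e \<beta> \<or> (real r = snd (tip e \<beta>) \<and> {real a, fst (tip e \<beta>)} = {0, real W})"
        using sep[OF aK tip_in_K[OF e(1), unfolded K_def], of \<beta>] e a False by auto
      then have o: "real r = snd (tip e \<beta>)" "real a = fst (tip e \<beta>) \<or> (a = 0 \<and> fst (tip e \<beta>) = real W)"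
        using a(1) by (cases "tip e \<beta>"; auto simp: doubleton_eq_iff)+
      show "e \<in> ?S"
      proof (cases \<beta>)
        case True
        show ?thesis
        proof (cases v)
          case True
          then show ?thesis using o x \<open>\<beta>\<close> by (auto simp: e1 tip_simps)
        next
          case False
          then have "r = Suc r'" "a = Suc x \<or> (a = 0 \<and> W = Suc x)"
            using o \<open>\<beta>\<close> by (auto simp: e1 tip_simps)
          then show ?thesis using False by (auto simp: e1)
        qed
      next
        case False
        then show ?thesis using o x by (cases v) (auto simp: e1 tip_simps)
      qed
    qed
    then have "card ?I \<le> card ?S" by (rule card_mono[rotated]) simp
    also have "\<dots> \<le> 4" by (rule order_trans[OF card_insert_le_m1 order_refl] | simp add: card_insert_if)+
    finally show ?thesis .
  qed
qed

text \<open>A grid point lies on at most 4 m lenses. Any other vertex is the midpoint of a curve and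
  borders only the lenses on its two sides. The polar nation adds one in either case.\<close>

lemma card_nations_at_vertex:
  assumes p: "p \<in> graph_vertices" and d: "4 * m + 1 \<le> d"
  shows "card {F \<in> (\<lambda>i. \<Phi> ` nation i) ` nations. p \<in> X closure_of F} \<le> d"
proof -
  define Q where "Q = {(e, j) \<in> H \<times> {..<m}. p \<in> \<Phi> ` closure (lens e j)}"
  have finQ: "finite Q" unfolding Q_def by (rule finite_subset[of _ "H \<times> {..<m}"]) (auto simp: grid_edges_def)
  have elQ: "\<exists>t l. p = \<Phi> (place e (t, l)) \<and> 0 \<le> t \<and> t \<le> 1 \<and> real j / real m \<le> l \<and> l \<le> real (Suc j) / real m \<and> 0 \<le> l \<and> l \<le> 1"
    if ej: "(e, j) \<in> Q" for e j
  proof -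
    have j: "j < m" using ej by (simp add: Q_def)
    obtain t l where tl: "p = \<Phi> (place e (t, l))" "0 \<le> t" "t \<le> 1" "real j / real m \<le> l" "l \<le> real (Suc j) / real m"
      using ej unfolding Q_def closure_lens by (auto simp del: of_nat_Suc)
    with level_bounds[OF j tl(4,5)] show ?thesis by blast
  qed
  have cQ: "card Q \<le> 4 * m"
  proof (cases "p \<in> nodes")
    case True
    let ?I = "{e \<in> H. \<exists>\<beta>. p = \<Phi> (tip e \<beta>)}"
    have "Q \<subseteq> ?I \<times> {..<m}"
    proof (rule subrelI)
      fix e j assume ej: "(e, j) \<in> Q"
      have eH: "e \<in> H" "j < m" using ej by (auto simp: Q_def)
      obtain t l where tl: "p = \<Phi> (place e (t, l))" "0 \<le> t" "t \<le> 1" "0 \<le> l" "l \<le> 1" using elQ[OF ej] by blast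
      have "t = 0 \<or> t = 1"
      proof (rule ccontr)
        assume "\<not> ?thesis"
        then have "0 < t" "t < 1" using tl by auto
        then show False using interior_not_node[OF eH(1), of t l] tl True by auto
      qed
      then have "\<exists>\<beta>. p = \<Phi> (tip e \<beta>)" using tl(1) by (auto simp: place_ends)
      then show "(e, j) \<in> ?I \<times> {..<m}" using eH by auto
    qed
    then have "card Q \<le> card (?I \<times> {..<m})" by (rule card_mono[rotated]) (simp add: grid_edges_def)
    also have "\<dots> = card ?I * m" by (simp add: card_cartesian_product)
    also have "\<dots> \<le> 4 * m" by (rule mult_right_mono[OF card_incident_edges[OF True]]) simp
    finally show ?thesis .
  next
    case False
    then obtain e0 i0 \<beta>0 where h: "(e0, i0, \<beta>0) \<in> halves" "p = half (e0, i0, \<beta>0) 1"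
      using p by (auto simp: graph_vertices_def)
    then have e0: "e0 \<in> H" "i0 \<le> m" "p = \<Phi> (place e0 (1 / 2, real i0 / real m))"
      by (auto simp: halves_def half.simps)
    have "Q \<subseteq> {e0} \<times> {i0, i0 - 1}"
    proof (rule subrelI)
      fix e j assume ej: "(e, j) \<in> Q"
      have eH: "e \<in> H" using ej by (auto simp: Q_def)
      obtain t l where tl: "p = \<Phi> (place e (t, l))" "0 \<le> t" "t \<le> 1" "0 \<le> l" "l \<le> 1"
        "real j / real m \<le> l" "l \<le> real (Suc j) / real m" using elQ[OF ej] by blast
      have "e0 = e \<and> real i0 / real m = l"
        using place_separated[OF e0(1) eH _ _ tl(2,3) _ _ tl(4,5), of "1 / 2" "real i0 / real m"]
          e0(2) m e0(3)[symmetric] tl(1) by simp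
      moreover from this have "j \<le> i0 \<and> i0 \<le> Suc j"
        using tl(6,7) m by (auto simp: divide_le_cancel simp del: of_nat_Suc)
      ultimately show "(e, j) \<in> {e0} \<times> {i0, i0 - 1}" by auto
    qed
    then have "card Q \<le> card ({e0} \<times> {i0, i0 - 1})" by (rule card_mono[rotated]) simp
    also have "\<dots> \<le> 2" by (simp add: card_cartesian_product card_insert_if)
    finally show ?thesis using m by simp
  qed
  have "{F \<in> (\<lambda>i. \<Phi> ` nation i) ` nations. p \<in> X closure_of F} \<subseteq> (\<lambda>i. \<Phi> ` nation i) ` insert None (Some ` Q)"
  proof
    fix F assume "F \<in> {F \<in> (\<lambda>i. \<Phi> ` nation i) ` nations. p \<in> X closure_of F}"
    then obtain i where i: "i \<in> nations" "F = \<Phi> ` nation i" "p \<in> X closure_of F" by auto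
    have "i \<in> insert None (Some ` Q)"
    proof (cases i)
      case (Some c)
      then obtain e j where "i = Some (e, j)" by (cases c) auto
      then show ?thesis using i lens_face(2) by (auto simp: nations_def Q_def)
    qed simp
    then show "F \<in> (\<lambda>i. \<Phi> ` nation i) ` insert None (Some ` Q)" using i(2) by blast
  qed
  then have "card {F \<in> (\<lambda>i. \<Phi> ` nation i) ` nations. p \<in> X closure_of F} \<le> card (insert None (Some ` Q))"
    by (rule surj_card_le[rotated]) (simp add: finQ)
  also have "\<dots> \<le> Suc (card Q)" using card_image_le[OF finQ, of Some] finQ by (simp add: card_insert_if)
  finally show ?thesis using cQ d by linarith
qed

lemma meets_common_tip:
  assumes "meets (\<lambda>x x'. \<Phi> (real x, 0) = \<Phi> (real x', 0)) e e'"
  shows "\<exists>\<beta> \<beta>'. \<Phi> (tip e \<beta>) = \<Phi> (tip e' \<beta>')"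
  using assms
proof cases
  case (row x r)
  then have "tip e True = tip e' False" by (simp add: tip_simps)
  then show ?thesis by metis
next
  case (column x r)
  then have "tip e True = tip e' False" by (simp add: tip_simps)
  then show ?thesis by metis
next
  case (corner x r)
  then have "tip e True = tip e' False" by (simp add: tip_simps)
  then show ?thesis by metis
next
  case (handle x x')
  then have "\<Phi> (tip e False) = \<Phi> (tip e' False)" by (simp add: tip_simps)
  then show ?thesis by metis
qed auto

end

text \<open>Numbers the nations by naturals and provides the assumptions of
  \<open>wired_grid\<close>. The grid has 2 W s edges with \<open>m\<close> lenses each, and the
  polar nation adds one vertex.\<close>

lemma map_graph_of_chart:
  fixes X :: "(real^3) set topology" and g d :: nat
  assumes chart: "subdivided_chart W s X \<Phi> m"
    and X: "surface_of_euler_genus k X" "k \<le> g" and d: "4 * m + 1 \<le> d"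
  obtains V :: "nat set" and E \<nu> apex where
    "map_graph g d V E" "card V = 2 * W * s * m + 1"
    "V = insert apex (case_prod \<nu> ` (grid_edges W s \<times> {..<m}))"
    "inj_on (case_prod \<nu>) (grid_edges W s \<times> {..<m})"
    "\<And>e e' j j'. e \<in> grid_edges W s \<Longrightarrow> e' \<in> grid_edges W s \<Longrightarrow>
      meets (\<lambda>x x'. \<Phi> (real x, 0) = \<Phi> (real x', 0)) e e' \<Longrightarrow> j < m \<Longrightarrow> j' < m \<Longrightarrow>
      (e, j) \<noteq> (e', j') \<Longrightarrow> {\<nu> e j, \<nu> e' j'} \<in> E"
    "\<And>x j. x < W \<Longrightarrow> j < m \<Longrightarrow> {apex, \<nu> (True, x, s - 1) j} \<in> E"
proof -
  interpret subdivided_chart W s X \<Phi> m by (rule chart)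
  have finJ: "finite nations" by (simp add: nations_def grid_edges_def)
  define V where "V = {0..<card nations}"
  obtain h where h: "bij_betw h V nations"
    using ex_bij_betw_nat_finite[OF finJ] unfolding V_def by blast
  define hi where "hi = inv_into V h"
  have hi: "bij_betw hi nations V" unfolding hi_def by (rule bij_betw_inv_into[OF h])
  have h_hi: "h (hi i) = i" "hi i \<in> V" if "i \<in> nations" for i
    using that h hi by (auto simp: hi_def bij_betw_inv_into_right bij_betw_apply)
  define f where "f u = \<Phi> ` nation (h u)" for u
  define touch where "touch u v \<longleftrightarrow> (\<exists>x\<in>graph_vertices. x \<in> X closure_of (f u) \<and> x \<in> X closure_of (f v))" for u v
  define E where "E = {{u, v} | u v. u \<in> V \<and> v \<in> V \<and> u \<noteq> v \<and> touch u v}"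
  have touch_sym: "touch u v \<longleftrightarrow> touch v u" for u v by (auto simp: touch_def)
  have E_iff: "{u, v} \<in> E \<longleftrightarrow> u \<noteq> v \<and> touch u v" if "u \<in> V" "v \<in> V" for u v
    using that touch_sym unfolding E_def by (auto simp: doubleton_eq_iff)
  define \<nu> where "\<nu> e j = hi (Some (e, j))" for e j
  define apex where "apex = hi None"
  have V_eq: "V = insert apex (case_prod \<nu> ` (H \<times> {..<m}))"
  proof -
    have "V = hi ` nations" using hi by (simp add: bij_betw_def)
    also have "\<dots> = insert apex (case_prod \<nu> ` (H \<times> {..<m}))"
    proof -
      have "case_prod \<nu> = (\<lambda>p. hi (Some p))" by (auto simp: \<nu>_def)
      then show ?thesis by (simp add: nations_def apex_def image_image)
    qed
    finally show ?thesis .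
  qed
  have inj: "inj_on (case_prod \<nu>) (H \<times> {..<m})"
  proof (rule inj_onI)
    fix p p' assume p: "p \<in> H \<times> {..<m}" "p' \<in> H \<times> {..<m}" "case_prod \<nu> p = case_prod \<nu> p'"
    then have "hi (Some p) = hi (Some p')" "Some p \<in> nations" "Some p' \<in> nations"
      by (auto simp: \<nu>_def nations_def)
    then show "p = p'" using hi by (auto simp: bij_betw_def dest: inj_onD)
  qed
  have "card nations = Suc (card (H \<times> {..<m}))"
    unfolding nations_def by (subst card_insert_disjoint) (auto simp: card_image grid_edges_def)
  then have cV: "card V = 2 * W * s * m + 1"
    by (simp add: V_def card_cartesian_product grid_edges_def card_UNIV_bool)
  have adj: "{\<nu> e j, \<nu> e' j'} \<in> E"
    if e: "e \<in> H" "e' \<in> H" "meets (\<lambda>x x'. \<Phi> (real x, 0) = \<Phi> (real x', 0)) e e'" "j < m" "j' < m" "(e, j) \<noteq> (e', j')"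
    for e e' j j'
  proof -
    obtain \<beta> \<beta>' where eq: "\<Phi> (tip e \<beta>) = \<Phi> (tip e' \<beta>')" using meets_common_tip[OF e(3)] by blast
    have n: "Some (e, j) \<in> nations" "Some (e', j') \<in> nations" using e by (auto simp: nations_def)
    have "touch (\<nu> e j) (\<nu> e' j')" unfolding touch_def f_def \<nu>_def h_hi(1)[OF n(1)] h_hi(1)[OF n(2)]
    proof (rule bexI[of _ "\<Phi> (tip e \<beta>)"])
      show "\<Phi> (tip e \<beta>) \<in> graph_vertices" using tip_node[OF e(1)] by (simp add: graph_vertices_def)
      show "\<Phi> (tip e \<beta>) \<in> X closure_of \<Phi> ` nation (Some (e, j)) \<and> \<Phi> (tip e \<beta>) \<in> X closure_of \<Phi> ` nation (Some (e', j'))"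
        using lens_touches_tip[OF e(1,4), of \<beta>] lens_touches_tip[OF e(2,5), of \<beta>'] eq by simp
    qed
    moreover have "\<nu> e j \<noteq> \<nu> e' j'"
      using inj_onD[OF inj, of "(e, j)" "(e', j')"] e by auto
    moreover have "\<nu> e j \<in> V" "\<nu> e' j' \<in> V" using h_hi(2) n by (auto simp: \<nu>_def)
    ultimately show ?thesis using E_iff by blast
  qed
  have ap: "{apex, \<nu> (True, x, s - 1) j} \<in> E" if x: "x < W" "j < m" for x j
  proof -
    let ?e = "(True, x, s - 1)"
    have e: "?e \<in> H" using x s by (simp add: in_H)
    have n: "None \<in> nations" "Some (?e, j) \<in> nations" using e x by (auto simp: nations_def)
    have "touch apex (\<nu> ?e j)" unfolding touch_def f_def \<nu>_def apex_def h_hi(1)[OF n(1)] h_hi(1)[OF n(2)]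
    proof (rule bexI[of _ "\<Phi> (tip ?e True)"])
      show "\<Phi> (tip ?e True) \<in> graph_vertices" using tip_node[OF e] by (simp add: graph_vertices_def)
      show "\<Phi> (tip ?e True) \<in> X closure_of \<Phi> ` nation None \<and> \<Phi> (tip ?e True) \<in> X closure_of \<Phi> ` nation (Some (?e, j))"
        using polar_cap_touches_tip[OF x(1)] lens_touches_tip[OF e x(2), of True] by simp
    qed
    moreover have "apex \<noteq> \<nu> ?e j"
      using n hi h_hi(1) unfolding apex_def \<nu>_def by (metis option.distinct(1))
    moreover have "apex \<in> V" "\<nu> ?e j \<in> V" using h_hi(2) n by (auto simp: \<nu>_def apex_def)
    ultimately show ?thesis using E_iff by blast
  qed
  have f: "bij_betw f V ((\<lambda>i. \<Phi> ` nation i) ` nations)"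
  proof -
    have "f = (\<lambda>i. \<Phi> ` nation i) \<circ> h" by (auto simp: f_def)
    then show ?thesis using bij_betw_trans[OF h inj_on_imp_bij_betw[OF inj_on_nation]] by simp
  qed
  have "map_graph g d V E"
    unfolding map_graph_def
  proof (intro conjI exI)
    show "simple_graph V E" by (auto simp: simple_graph_def E_def V_def)
    show "k \<le> g" "surface_of_euler_genus k X" by fact+
    show "embedded_graph X graph_vertices graph_edges drawn" by (rule drawing_embedded)
    show "(\<lambda>i. \<Phi> ` nation i) ` nations \<subseteq> embedding_faces X graph_vertices graph_edges drawn"
      using nation_face(1) by blast
    show "\<forall>x\<in>graph_vertices. card {F \<in> (\<lambda>i. \<Phi> ` nation i) ` nations. x \<in> X closure_of F} \<le> d"
      using card_nations_at_vertex[OF _ d] by blast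
    show "bij_betw f V ((\<lambda>i. \<Phi> ` nation i) ` nations)" by (rule f)
    show "\<forall>u\<in>V. \<forall>v\<in>V. ({u, v} \<in> E) = (u \<noteq> v \<and> (\<exists>x\<in>graph_vertices. x \<in> X closure_of f u \<and> x \<in> X closure_of f v))"
      using E_iff unfolding touch_def by blast
  qed
  from that[OF this cV V_eq inj adj ap] show ?thesis by blast
qed

section \<open>A sphere with handles along the equator\<close>

definition cyl :: "real \<Rightarrow> real \<Rightarrow> real \<Rightarrow> real^3" where
  "cyl w \<theta> z = vector [w * cos \<theta>, w * sin \<theta>, z]"

lemma inner_cyl: "cyl w \<theta> z \<bullet> cyl w' \<theta>' z' = w * w' * cos (\<theta> - \<theta>') + z * z'"
  by (simp add: cyl_def inner_vec_def sum_3 cos_diff algebra_simps)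

lemma cyl_eq_iff: "cyl w \<theta> z = cyl w' \<theta>' z' \<longleftrightarrow> w * cos \<theta> = w' * cos \<theta>' \<and> w * sin \<theta> = w' * sin \<theta>' \<and> z = z'"
  by (auto simp: cyl_def vec_eq_iff forall_3)

lemma norm_cyl: "norm (cyl w \<theta> z) = sqrt (w^2 + z^2)"
  by (simp add: norm_eq_sqrt_inner inner_cyl power2_eq_square)

lemma continuous_on_cyl:
  fixes w \<theta> z :: "'a::t2_space \<Rightarrow> real"
  assumes "continuous_on A w" "continuous_on A \<theta>" "continuous_on A z"
  shows "continuous_on A (\<lambda>x. cyl (w x) (\<theta> x) (z x))"
proof -
  have "cyl w \<theta> z = (w * cos \<theta>) *\<^sub>R axis 1 1 + (w * sin \<theta>) *\<^sub>R axis 2 1 + z *\<^sub>R axis 3 1" for w \<theta> z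
    by (simp add: cyl_def vec_eq_iff forall_3 axis_def)
  then show ?thesis
    using assms continuous_on_cos[OF assms(2)] continuous_on_sin[OF assms(2)]
    by (auto intro!: continuous_intros)
qed

lemma sphere_cyl:
  assumes "x \<in> sphere (0 :: real^3) 1"
  obtains \<theta> z where "0 \<le> \<theta>" "\<theta> < 2 * pi" "-1 \<le> z" "z \<le> 1" "x = cyl (sqrt (1 - z^2)) \<theta> z"
proof -
  define z w where "z = x $ 3" and "w = sqrt (1 - z^2)"
  have "x \<bullet> x = 1" using assms by (simp add: norm_eq_1)
  then have s: "(x $ 1)^2 + (x $ 2)^2 + z^2 = 1" by (simp add: inner_vec_def sum_3 z_def power2_eq_square)
  then have "z^2 \<le> 1" by (smt (verit) zero_le_power2)
  then have z: "-1 \<le> z" "z \<le> 1" "w^2 = 1 - z^2" by (auto simp: w_def abs_square_le_1 abs_le_iff)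
  have xz: "x = cyl w \<theta> z" if "x $ 1 = w * cos \<theta>" "x $ 2 = w * sin \<theta>" for \<theta>
    using that by (simp add: cyl_def vec_eq_iff forall_3 z_def)
  show ?thesis
  proof (cases "w = 0")
    case True
    then have "(x $ 1)^2 + (x $ 2)^2 = 0" using s z(3) by simp
    then have "x $ 1 = 0" "x $ 2 = 0" by (simp_all add: sum_power2_eq_zero_iff)
    then show ?thesis using that[of 0 z] xz[of 0] True z by (simp add: w_def)
  next
    case False
    have "(x $ 1 / w)^2 + (x $ 2 / w)^2 = ((x $ 1)^2 + (x $ 2)^2) / w^2"
      by (simp add: power_divide add_divide_distrib)
    also have "(x $ 1)^2 + (x $ 2)^2 = w^2" using s z(3) by linarith
    also have "w^2 / w^2 = 1" using False by simp
    finally obtain \<theta> where t: "0 \<le> \<theta>" "\<theta> < 2 * pi" "x $ 1 / w = cos \<theta>" "x $ 2 / w = sin \<theta>"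
      using sincos_total_2pi by metis
    then have "x $ 1 = w * cos \<theta>" "x $ 2 = w * sin \<theta>" using False by (simp_all add: field_simps)
    then show ?thesis using that[of \<theta> z] xz t z by (simp add: w_def)
  qed
qed

lemma cyl_sum_diff:
  "cyl w (\<mu> + t) z - cyl w (\<mu> - t) z = (2 * w * sin t) *\<^sub>R cyl 1 (\<mu> + pi / 2) 0"
  "cyl 1 (\<mu> + t) 0 + cyl 1 (\<mu> - t) 0 = (2 * cos t) *\<^sub>R cyl 1 \<mu> 0"
  by (simp_all add: cyl_def vec_eq_iff forall_3 cos_add cos_diff sin_add sin_diff algebra_simps)

lemma cos_sin_shift: "cos (x + 2 * pi * of_int n) = cos x" "sin (x + 2 * pi * of_int n) = sin x"
  by (simp_all add: cos_add sin_add cos_int_2pin sin_int_2pin)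

text \<open>The mirror is the vertical plane through the mean of the two angles; its normal
  \<open>n\<close> is horizontal. So heights are kept and angles are reversed about the mean. The
  hypothesis says that the two equatorial points differ.\<close>

lemma swap_reflection_cyl:
  assumes "sin ((\<alpha> - \<beta>) / 2) \<noteq> 0"
  shows "swap_reflection (cyl 1 \<alpha> 0) (cyl 1 \<beta> 0) (cyl w (\<alpha> + \<phi>) z) = cyl w (\<beta> - \<phi>) z"
proof -
  define \<mu> e where "\<mu> = (\<alpha> + \<beta>) / 2" and "e = (\<alpha> - \<beta>) / 2"
  have ab: "\<alpha> = \<mu> + e" "\<beta> = \<mu> - e" by (simp_all add: \<mu>_def e_def field_simps)
  define n where "n = cyl 1 (\<mu> + pi / 2) 0"
  have u: "cyl 1 \<alpha> 0 - cyl 1 \<beta> 0 = (2 * sin e) *\<^sub>R n"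
    using cyl_sum_diff(1)[of 1 \<mu> e 0] by (simp add: ab n_def)
  have nn: "n \<bullet> n = 1" by (simp add: n_def inner_cyl)
  have "\<mu> + e + \<phi> - (\<mu> + pi / 2) = - (pi / 2 - (e + \<phi>))" by simp
  then have xn: "cyl w (\<alpha> + \<phi>) z \<bullet> n = w * sin (e + \<phi>)"
    by (simp only: n_def inner_cyl ab cos_minus sin_cos_eq mult_zero_right add_0_right mult_1_right
      of_real_eq_id id_apply)
  have "swap_reflection (cyl 1 \<alpha> 0) (cyl 1 \<beta> 0) (cyl w (\<alpha> + \<phi>) z) = cyl w (\<alpha> + \<phi>) z - (2 * w * sin (e + \<phi>)) *\<^sub>R n"
    using assms unfolding swap_reflection_def u e_def[symmetric]
    by (simp add: nn xn)
  also have "\<dots> = cyl w (\<beta> - \<phi>) z"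
    using cyl_sum_diff(1)[of w \<mu> "e + \<phi>" z] by (simp add: ab n_def algebra_simps)
  finally show ?thesis .
qed

section \<open>Columns, caps and heights on the sphere\<close>

locale sphere_grid =
  fixes M s :: nat
  assumes M: "M \<ge> 3" and s: "s \<ge> 1"
begin

text \<open>The shift by 1/2 places the \<open>s\<close> columns of sector \<open>q\<close>
  symmetrically about \<open>centre q\<close>, so that reflections match columns with
  columns.\<close>

definition "angle \<xi> = 2 * pi * (\<xi> + 1 / 2) / (real M * real s)"
definition "centre q = 2 * pi * (real q + 1 / 2) / real M"
text \<open>Lies between pi (s - 1) / (M s), the largest distance of a column of the sector from its
  centre, and pi / M, half the distance of neighbouring centres. So all \<open>s\<close> columns end
  on the circle and the caps stay disjoint, also for s = 1.\<close>

definition "radius = pi * (real s - 1 / 2) / (real M * real s)"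

text \<open>The distance from \<open>\<theta>\<close> to the nearest of the angles \<open>centre q\<close>.\<close>

definition "deviation \<theta> = arccos (- cos (real M * \<theta>)) / real M"

text \<open>The boundary circle of the cap around the equatorial point at angle \<open>centre q\<close> lies at height
  \<open>low \<theta>\<close> above the angle \<open>\<theta>\<close>.\<close>

definition "low \<theta> = sqrt (max 0 (1 - (cos radius / cos (deviation \<theta>))^2))"
text \<open>Nonnegative \<open>\<eta>\<close> lie above the caps, negative ones below; \<open>-1\<close> is the south pole.\<close>

definition "height \<theta> \<eta> = low \<theta> + max 0 \<eta> / (real s + 1) * (1 - low \<theta>) + min 0 \<eta> * (1 + low \<theta>)"
text \<open>Covers the whole sphere although the chart uses only nonnegative heights: the rest makes
  it possible to prove images open by taking complements of compact sets.\<close>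

definition "spot a = (let z = height (angle (fst a)) (snd a) in cyl (sqrt (1 - z^2)) (angle (fst a)) z)"
definition "pole q = cyl 1 (centre q) 0"

lemma radius_bounds: "0 < radius" "radius < pi / real M" "pi / real M < pi / 2" "pi / real M \<le> pi"
proof -
  show "0 < radius" unfolding radius_def using M s by (intro divide_pos_pos mult_pos_pos) auto
  have "radius = pi / real M * ((real s - 1 / 2) / real s)" by (simp add: radius_def)
  also have "\<dots> < pi / real M * 1" using M s by (intro mult_strict_left_mono) auto
  finally show "radius < pi / real M" by simp
  show half: "pi / real M < pi / 2" using M by (intro divide_strict_left_mono) auto
  show "pi / real M \<le> pi" using half pi_gt_zero by linarith
qed

lemma cos_radius: "cos (pi / real M) < cos radius" "0 < cos (pi / real M)" "cos radius < 1" "0 < cos radius"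
proof -
  show "cos (pi / real M) < cos radius" using radius_bounds M by (intro cos_monotone_0_pi) auto
  show "0 < cos (pi / real M)" using radius_bounds M by (intro cos_gt_zero_pi) (auto intro: order.strict_trans[of _ 0])
  then show "0 < cos radius" using \<open>cos (pi / real M) < cos radius\<close> by linarith
  show "cos radius < 1" using cos_monotone_0_pi[of 0 radius] radius_bounds by auto
qed

lemma deviation_bounds: "0 \<le> deviation \<theta>" "deviation \<theta> \<le> pi / real M"
  using M arccos_lbound[of "- cos (real M * \<theta>)"] arccos_ubound[of "- cos (real M * \<theta>)"]
  by (auto simp: deviation_def divide_right_mono)

lemma cos_deviation: "cos (pi / real M) \<le> cos (deviation \<theta>)" "0 < cos (deviation \<theta>)"
proof -
  show "cos (pi / real M) \<le> cos (deviation \<theta>)"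
    using deviation_bounds[of \<theta>] radius_bounds by (intro cos_monotone_0_pi_le) auto
  then show "0 < cos (deviation \<theta>)" using cos_radius by linarith
qed

text \<open>M times \<open>centre q\<close> is an odd multiple of pi, which makes
  \<open>deviation\<close> the same for all \<open>q\<close>.\<close>

lemma minus_cos_centre: "- cos (real M * \<theta>) = cos (real M * (\<theta> - centre q))"
proof -
  have "real M * (\<theta> - centre q) = (real M * \<theta> - pi) + 2 * pi * of_int (- int q)"
    using M by (simp add: centre_def field_simps)
  then have "cos (real M * (\<theta> - centre q)) = cos (real M * \<theta> - pi)"
    by (simp only: cos_sin_shift)
  then show ?thesis by (simp add: cos_diff)
qed

lemma deviation_near:
  assumes "\<bar>\<theta> - centre q\<bar> \<le> pi / real M"
  shows "deviation \<theta> = \<bar>\<theta> - centre q\<bar>"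
proof -
  have "cos (real M * (\<theta> - centre q)) = cos (real M * \<bar>\<theta> - centre q\<bar>)"
    using cos_abs_real[of "real M * (\<theta> - centre q)"] by (simp add: abs_mult)
  moreover have "real M * \<bar>\<theta> - centre q\<bar> \<le> pi" using assms M by (simp add: field_simps)
  ultimately have "arccos (- cos (real M * \<theta>)) = real M * \<bar>\<theta> - centre q\<bar>"
    unfolding minus_cos_centre[of \<theta> q] by (simp add: arccos_cos)
  then show ?thesis using M by (simp add: deviation_def)
qed

lemma arccos_cos_le: "arccos (cos y) \<le> \<bar>y\<bar>"
proof (cases "\<bar>y\<bar> \<le> pi")
  case True
  have "cos y = cos \<bar>y\<bar>" by (simp add: abs_if)
  then show ?thesis using True arccos_cos[of "\<bar>y\<bar>"] by simp
next
  case False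
  then show ?thesis using arccos_ubound[of "cos y"] by simp
qed

text \<open>Reduce \<theta> - centre q modulo 2 pi to some \<open>y\<close> between -pi and pi. As M
  is an integer, cos (M y) is unchanged, and arccos (cos (M y)) / M is at most |y|; cosine decreases
  there.\<close>

lemma cos_le_cos_deviation: "cos (\<theta> - centre q) \<le> cos (deviation \<theta>)"
proof -
  obtain y where y: "-pi \<le> y" "y \<le> pi" "cos y = cos (\<theta> - centre q)" "cos (real M * y) = cos (real M * (\<theta> - centre q))"
  proof -
    define x where "x = \<theta> - centre q"
    define n where "n = \<lfloor>(x + pi) / (2 * pi)\<rfloor>"
    have n: "of_int n \<le> (x + pi) / (2 * pi)" "(x + pi) / (2 * pi) < of_int n + 1" unfolding n_def by linarith+
    have "of_int n * (2 * pi) \<le> x + pi" using n(1) by (simp add: pos_le_divide_eq)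
    moreover have "x + pi < (of_int n + 1) * (2 * pi)" using n(2) by (simp add: pos_divide_less_eq)
    ultimately have b: "-pi \<le> x - of_int n * (2 * pi)" "x - of_int n * (2 * pi) \<le> pi" by (auto simp: algebra_simps)
    have "x - of_int n * (2 * pi) = x + 2 * pi * of_int (- n)" by simp
    then have c1: "cos (x - of_int n * (2 * pi)) = cos x" by (simp only: cos_sin_shift)
    have "real M * (x - of_int n * (2 * pi)) = real M * x + 2 * pi * of_int (- (int M * n))"
      by (simp add: algebra_simps)
    then have c2: "cos (real M * (x - of_int n * (2 * pi))) = cos (real M * x)"
      by (simp only: cos_sin_shift)
    show ?thesis using that[OF b] c1 c2 by (simp add: x_def)
  qed
  have "deviation \<theta> = arccos (cos (real M * y)) / real M"
    by (simp add: deviation_def minus_cos_centre[of \<theta> q] y(4))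
  also have "\<dots> \<le> \<bar>real M * y\<bar> / real M" by (intro divide_right_mono arccos_cos_le) simp
  also have "\<dots> = \<bar>y\<bar>" using M by (simp add: abs_mult)
  finally have "cos \<bar>y\<bar> \<le> cos (deviation \<theta>)"
    using deviation_bounds[of \<theta>] y by (intro cos_monotone_0_pi_le) auto
  moreover have "cos \<bar>y\<bar> = cos y" by (simp add: abs_if)
  ultimately show ?thesis using y(3) by simp
qed

lemma low_bounds: "0 \<le> low \<theta>" "low \<theta> < 1"
  using cos_radius(4) cos_deviation(2)[of \<theta>] by (auto simp: low_def)

text \<open>The left side is the inner product of the point at height \<open>low \<theta>\<close>
  with the nearest centre. Over a cap it places the point on the circle. Between caps the maximum in
  \<open>low\<close> forces height 0 and only the inequality is left.\<close>

lemma low_circle: "sqrt (1 - (low \<theta>)^2) * cos (deviation \<theta>) \<le> cos radius"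
  "cos radius \<le> cos (deviation \<theta>) \<Longrightarrow> sqrt (1 - (low \<theta>)^2) * cos (deviation \<theta>) = cos radius"
proof -
  let ?r = "cos radius / cos (deviation \<theta>)"
  have r: "0 < ?r" using cos_radius(4) cos_deviation(2) by simp
  have l2: "(low \<theta>)^2 = max 0 (1 - ?r^2)" by (simp add: low_def)
  have 1: "sqrt (1 - (low \<theta>)^2) = ?r" if "?r \<le> 1"
  proof -
    have "?r^2 \<le> 1" using that r by (simp add: power_le_one)
    then have "1 - (low \<theta>)^2 = ?r^2" unfolding l2 by simp
    then show ?thesis by (simp only: real_sqrt_abs abs_of_pos[OF r])
  qed
  show "sqrt (1 - (low \<theta>)^2) * cos (deviation \<theta>) = cos radius" if "cos radius \<le> cos (deviation \<theta>)"
    using 1 that cos_deviation(2)[of \<theta>] by (simp add: divide_le_eq)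
  show "sqrt (1 - (low \<theta>)^2) * cos (deviation \<theta>) \<le> cos radius"
  proof (cases "?r \<le> 1")
    case True
    then show ?thesis using 1 cos_deviation(2)[of \<theta>] by simp
  next
    case False
    then have "1 < ?r^2" by (simp add: one_less_power)
    then have "low \<theta> = 0" by (simp add: low_def)
    then show ?thesis using False cos_deviation(2)[of \<theta>] by (simp add: divide_le_eq)
  qed
qed

lemma above_low:
  assumes "low \<theta> \<le> z" "z \<le> 1"
  shows "sqrt (1 - z^2) * cos (\<theta> - centre q) \<le> cos radius"
    and "low \<theta> < z \<Longrightarrow> sqrt (1 - z^2) * cos (\<theta> - centre q) < cos radius"
proof -
  have sq: "sqrt (1 - z^2) \<le> sqrt (1 - (low \<theta>)^2)" "0 \<le> sqrt (1 - z^2)"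
    using assms low_bounds[of \<theta>] by (auto intro: power_mono power_le_one)
  have "sqrt (1 - z^2) * cos (\<theta> - centre q) \<le> sqrt (1 - z^2) * cos (deviation \<theta>)"
    using sq cos_le_cos_deviation by (intro mult_left_mono)
  moreover have "\<dots> \<le> sqrt (1 - (low \<theta>)^2) * cos (deviation \<theta>)"
    using sq cos_deviation(2)[of \<theta>] by (intro mult_right_mono) auto
  ultimately show "sqrt (1 - z^2) * cos (\<theta> - centre q) \<le> cos radius"
    using low_circle(1)[of \<theta>] by linarith
  assume lt: "low \<theta> < z"
  have "sqrt (1 - z^2) < sqrt (1 - (low \<theta>)^2)"
    using lt low_bounds[of \<theta>] by (auto intro: power_strict_mono)
  then have "sqrt (1 - z^2) * cos (deviation \<theta>) < sqrt (1 - (low \<theta>)^2) * cos (deviation \<theta>)"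
    using cos_deviation(2) by (intro mult_strict_right_mono)
  then show "sqrt (1 - z^2) * cos (\<theta> - centre q) < cos radius"
    using low_circle(1)[of \<theta>] \<open>sqrt (1 - z^2) * cos (\<theta> - centre q) \<le> sqrt (1 - z^2) * cos (deviation \<theta>)\<close>
    by linarith
qed

lemma low_periodic: "low (\<theta> + 2 * pi * of_int n) = low \<theta>"
proof -
  have "real M * (\<theta> + 2 * pi * of_int n) = real M * \<theta> + 2 * pi * of_int (int M * n)"
    by (simp add: algebra_simps)
  then have "cos (real M * (\<theta> + 2 * pi * of_int n)) = cos (real M * \<theta>)"
    by (simp only: cos_sin_shift)
  then show ?thesis by (simp add: low_def deviation_def)
qed

lemma continuous_on_low: "continuous_on A low"
proof -
  have d: "continuous_on A deviation"
    unfolding deviation_def using M by (intro continuous_intros) auto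
  show ?thesis
    unfolding low_def using d cos_deviation(2) by (intro continuous_intros) (auto simp: less_le)
qed

lemma height_strict_mono: "\<eta> < \<eta>' \<Longrightarrow> height \<theta> \<eta> < height \<theta> \<eta>'"
proof -
  assume lt: "\<eta> < \<eta>'"
  define A B where "A = (1 - low \<theta>) / (real s + 1)" and "B = 1 + low \<theta>"
  have AB: "0 < A" "0 < B" using low_bounds[of \<theta>] by (simp_all add: A_def B_def)
  have h: "height \<theta> x = low \<theta> + max 0 x * A + min 0 x * B" for x
    by (simp add: height_def A_def B_def)
  have le: "max 0 \<eta> * A \<le> max 0 \<eta>' * A" "min 0 \<eta> * B \<le> min 0 \<eta>' * B"
    using AB lt by (auto intro!: mult_right_mono)
  show ?thesis
  proof (cases "\<eta> < 0")
    case True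
    then have "min 0 \<eta> * B < min 0 \<eta>' * B" using AB lt by (intro mult_strict_right_mono) auto
    then show ?thesis using le unfolding h by linarith
  next
    case False
    then have "max 0 \<eta> * A < max 0 \<eta>' * A" using AB lt by (intro mult_strict_right_mono) auto
    then show ?thesis using le unfolding h by linarith
  qed
qed

lemma height_values: "height \<theta> 0 = low \<theta>" "height \<theta> (real s + 1) = 1" "height \<theta> (-1) = -1"
proof -
  have "real s + 1 \<noteq> 0" by linarith
  then show "height \<theta> 0 = low \<theta>" "height \<theta> (real s + 1) = 1" "height \<theta> (-1) = -1"
    by (simp_all add: height_def)
qed

lemma height_less_iff: "height \<theta> \<eta> < height \<theta> \<eta>' \<longleftrightarrow> \<eta> < \<eta>'"
  using height_strict_mono[of \<eta> \<eta>' \<theta>] height_strict_mono[of \<eta>' \<eta> \<theta>] by (cases \<eta> \<eta>' rule: linorder_cases) auto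

lemma height_eq_iff: "height \<theta> \<eta> = height \<theta> \<eta>' \<longleftrightarrow> \<eta> = \<eta>'"
  using height_less_iff[of \<theta> \<eta> \<eta>'] height_less_iff[of \<theta> \<eta>' \<eta>] by auto

lemma height_range: "-1 \<le> \<eta> \<Longrightarrow> \<eta> \<le> real s + 1 \<Longrightarrow> -1 \<le> height \<theta> \<eta> \<and> height \<theta> \<eta> \<le> 1"
  using height_less_iff[of \<theta> \<eta> "-1"] height_less_iff[of \<theta> "real s + 1" \<eta>] height_values[of \<theta>] by auto

lemma height_surj:
  assumes z: "-1 \<le> z" "z \<le> 1"
  obtains \<eta> where "-1 \<le> \<eta>" "\<eta> \<le> real s + 1" "height \<theta> \<eta> = z"
proof (cases "low \<theta> \<le> z")
  case True
  let ?e = "(z - low \<theta>) / (1 - low \<theta>) * (real s + 1)"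
  have "0 \<le> (z - low \<theta>) / (1 - low \<theta>)" "(z - low \<theta>) / (1 - low \<theta>) \<le> 1"
    using True z low_bounds[of \<theta>] by auto
  then have "0 \<le> ?e" "?e \<le> 1 * (real s + 1)" by (intro mult_nonneg_nonneg mult_right_mono; simp)+
  then have e: "0 \<le> ?e" "?e \<le> real s + 1" by (simp_all only: mult_1_left)
  have "real s + 1 \<noteq> 0" by linarith
  then have "?e / (real s + 1) * (1 - low \<theta>) = z - low \<theta>"
    using low_bounds[of \<theta>] by simp
  then have "height \<theta> ?e = z" using e by (simp add: height_def max_absorb2 min_absorb1)
  then show ?thesis using that[of ?e] e by linarith
next
  case False
  let ?e = "(z - low \<theta>) / (1 + low \<theta>)"
  have "?e \<le> 0" "-1 \<le> ?e" using False z low_bounds[of \<theta>] by (auto simp: pos_le_divide_eq divide_le_0_iff)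
  moreover from this have "height \<theta> ?e = z"
    using low_bounds[of \<theta>] by (simp add: height_def max_absorb1 min_absorb2)
  ultimately show ?thesis using that[of ?e] by simp
qed

section \<open>Parametrisation of the sphere by column position and height\<close>

definition "strip = {0..real (M * s)} \<times> {-1..real s + 1}"

lemma spot_eq: "spot (\<xi>, \<eta>) = cyl (sqrt (1 - (height (angle \<xi>) \<eta>)^2)) (angle \<xi>) (height (angle \<xi>) \<eta>)"
  by (simp add: spot_def Let_def)

lemma spot_on_sphere: "a \<in> strip \<Longrightarrow> spot a \<in> sphere 0 1"
proof -
  assume "a \<in> strip"
  then obtain \<xi> \<eta> where a: "a = (\<xi>, \<eta>)" "-1 \<le> \<eta>" "\<eta> \<le> real s + 1" by (cases a) (auto simp: strip_def)
  have "(height (angle \<xi>) \<eta>)^2 \<le> 1" using height_range[OF a(2,3)] by (simp add: abs_square_le_1 abs_le_iff)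
  then show ?thesis by (simp add: a(1) spot_eq norm_cyl)
qed

lemma Ms_pos: "0 < real (M * s)"
  using M s by simp

lemma angle_scale: "angle \<xi> = 2 * pi * ((\<xi> + 1 / 2) / real (M * s))"
  by (simp add: angle_def)

text \<open>Longitude is undetermined only at the two poles. Elsewhere \<xi> is determined modulo M
  s, and the interval allows a difference of at most one period.\<close>

lemma spot_separated:
  assumes a: "a \<in> strip" and b: "b \<in> strip" and eq: "spot a = spot b"
  shows "a = b \<or> (snd a = real s + 1 \<and> snd b = real s + 1) \<or> (snd a = -1 \<and> snd b = -1) \<or>
    (snd a = snd b \<and> {fst a, fst b} = {0, real (M * s)})"
proof -
  obtain \<xi> \<eta> where a1: "a = (\<xi>, \<eta>)" by (cases a)
  obtain \<xi>' \<eta>' where b1: "b = (\<xi>', \<eta>')" by (cases b)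
  have r: "0 \<le> \<xi>" "\<xi> \<le> real (M * s)" "-1 \<le> \<eta>" "\<eta> \<le> real s + 1"
    "0 \<le> \<xi>'" "\<xi>' \<le> real (M * s)" "-1 \<le> \<eta>'" "\<eta>' \<le> real s + 1"
    using a b by (auto simp: strip_def a1 b1)
  define z where "z = height (angle \<xi>) \<eta>"
  have z': "height (angle \<xi>') \<eta>' = z"
    using eq unfolding a1 b1 spot_eq cyl_eq_iff z_def by simp
  have e: "sqrt (1 - z^2) * cos (angle \<xi>) = sqrt (1 - z^2) * cos (angle \<xi>')"
    "sqrt (1 - z^2) * sin (angle \<xi>) = sqrt (1 - z^2) * sin (angle \<xi>')"
    using eq unfolding a1 b1 spot_eq cyl_eq_iff z' z_def[symmetric] by auto
  have zr: "-1 \<le> z" "z \<le> 1" using height_range[OF r(3,4)] by (auto simp: z_def)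
  consider "z = 1" | "z = -1" | "-1 < z" "z < 1" using zr by linarith
  then show ?thesis
  proof cases
    case 1
    then have "\<eta> = real s + 1" "\<eta>' = real s + 1"
      using height_eq_iff height_values(2) z' unfolding z_def by metis+
    then show ?thesis by (simp add: a1 b1)
  next
    case 2
    then have "\<eta> = -1" "\<eta>' = -1"
      using height_eq_iff height_values(3) z' unfolding z_def by metis+
    then show ?thesis by (simp add: a1 b1)
  next
    case 3
    then have "z^2 < 1" by (simp add: abs_square_less_1 abs_less_iff)
    then have "cos (angle \<xi>) = cos (angle \<xi>')" "sin (angle \<xi>) = sin (angle \<xi>')" using e by auto
    then obtain n :: int where n: "angle \<xi> = angle \<xi>' + 2 * pi * of_int n"
      using sin_cos_eq_iff[of "angle \<xi>" "angle \<xi>'"] by auto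
    then have "low (angle \<xi>) = low (angle \<xi>')" by (simp add: low_periodic)
    then have "height (angle \<xi>') \<eta> = height (angle \<xi>') \<eta>'"
      using z' unfolding z_def by (simp add: height_def)
    then have \<eta>: "\<eta> = \<eta>'" by (simp add: height_eq_iff)
    have "2 * pi * ((\<xi> + 1 / 2) / real (M * s)) = 2 * pi * ((\<xi>' + 1 / 2) / real (M * s) + of_int n)"
      using n unfolding angle_scale by (simp add: distrib_left)
    then have "(\<xi> + 1 / 2) / real (M * s) = (\<xi>' + 1 / 2) / real (M * s) + of_int n"
      by (subst (asm) mult_cancel_left) simp
    then have "(\<xi> + 1 / 2) = (\<xi>' + 1 / 2) + of_int n * real (M * s)"
      using Ms_pos by (simp add: field_simps del: of_nat_mult)
    then have d: "\<xi> - \<xi>' = of_int n * real (M * s)" by simp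
    have "n = 0 \<or> n = 1 \<or> n = -1"
    proof (rule ccontr)
      assume "\<not> ?thesis"
      then have "2 \<le> \<bar>n\<bar>" by linarith
      then have "2 \<le> \<bar>real_of_int n\<bar>" by linarith
      then have "2 * real (M * s) \<le> \<bar>real_of_int n\<bar> * real (M * s)" using Ms_pos by (intro mult_right_mono) auto
      also have "\<dots> = \<bar>\<xi> - \<xi>'\<bar>" unfolding d using Ms_pos by (simp add: abs_mult)
      also have "\<dots> \<le> real (M * s)" using r by linarith
      finally show False using Ms_pos by linarith
    qed
    then show ?thesis
    proof (elim disjE)
      assume "n = 0"
      then show ?thesis using d \<eta> by (simp add: a1 b1)
    next
      assume "n = 1"
      then have "\<xi> = real (M * s)" "\<xi>' = 0" using d r by auto
      then show ?thesis using \<eta> by (simp add: a1 b1 insert_commute)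
    next
      assume "n = -1"
      then have "\<xi>' = real (M * s)" "\<xi> = 0" using d r by auto
      then show ?thesis using \<eta> by (simp add: a1 b1)
    qed
  qed
qed

lemma spot_surj: "sphere 0 1 \<subseteq> spot ` strip"
proof
  fix x :: "real^3" assume "x \<in> sphere 0 1"
  then obtain \<theta> z where x: "0 \<le> \<theta>" "\<theta> < 2 * pi" "-1 \<le> z" "z \<le> 1" "x = cyl (sqrt (1 - z^2)) \<theta> z"
    by (rule sphere_cyl)
  \<comment> \<open>Because of the half-column shift, angle 0 belongs to \<xi> = -1/2. One period is
    added when the value is negative.\<close>
  define \<xi>0 where "\<xi>0 = \<theta> * real (M * s) / (2 * pi) - 1 / 2"
  have lo: "-1 / 2 \<le> \<xi>0" using x Ms_pos by (simp add: \<xi>0_def)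
  have "\<theta> * real (M * s) / (2 * pi) \<le> real (M * s)"
    using x Ms_pos mult_right_mono[of \<theta> "2 * pi" "real (M * s)"] by (simp add: pos_divide_le_eq mult.commute)
  then have hi: "\<xi>0 \<le> real (M * s) - 1 / 2" by (simp add: \<xi>0_def)
  have "1 \<le> real (M * s)" using M s by (metis Ms_pos of_nat_0_less_iff of_nat_1 of_nat_le_iff Suc_leI One_nat_def)
  obtain n :: int where n: "n = 0 \<or> n = 1" "0 \<le> \<xi>0 + of_int n * real (M * s)" "\<xi>0 + of_int n * real (M * s) \<le> real (M * s)"
  proof (cases "0 \<le> \<xi>0")
    case True
    then show ?thesis using that[of 0] hi by simp
  next
    case False
    then show ?thesis using that[of 1] lo \<open>1 \<le> real (M * s)\<close> by simp
  qed
  define \<xi> where "\<xi> = \<xi>0 + of_int n * real (M * s)"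
  have "angle \<xi> = 2 * pi * ((\<theta> * real (M * s) / (2 * pi) + of_int n * real (M * s)) / real (M * s))"
    by (simp add: angle_scale \<xi>_def \<xi>0_def)
  also have "\<dots> = \<theta> + 2 * pi * of_int n"
    using Ms_pos by (simp add: add_divide_distrib distrib_left del: of_nat_mult)
  finally have ang: "angle \<xi> = \<theta> + 2 * pi * of_int n" .
  obtain \<eta> where \<eta>: "-1 \<le> \<eta>" "\<eta> \<le> real s + 1" "height (angle \<xi>) \<eta> = z" using height_surj[OF x(3,4)] .
  have "spot (\<xi>, \<eta>) = x"
    unfolding spot_eq \<eta>(3) unfolding x(5) ang cyl_eq_iff cos_sin_shift by simp
  moreover have "(\<xi>, \<eta>) \<in> strip" using n \<eta> by (simp add: strip_def \<xi>_def)
  ultimately show "x \<in> spot ` strip" by blast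
qed

lemma continuous_on_spot: "continuous_on strip spot"
proof -
  have "continuous_on UNIV (\<lambda>a :: real \<times> real. angle (fst a))"
    unfolding angle_def by (intro continuous_intros) (use M s in auto)
  then have ang: "continuous_on strip (\<lambda>a. angle (fst a))" by (rule continuous_on_subset) simp
  have "continuous_on strip (\<lambda>a. low (angle (fst a)))"
    by (rule continuous_on_compose2[OF continuous_on_low[of UNIV] ang]) simp
  then have h: "continuous_on strip (\<lambda>a. height (angle (fst a)) (snd a))"
    unfolding height_def by (intro continuous_intros) auto
  show ?thesis
    unfolding spot_def Let_def by (intro continuous_on_cyl ang h continuous_intros)
qed

lemma spot_wrap: "spot (0, \<eta>) = spot (real (M * s), \<eta>)"
proof -
  have "angle (real (M * s)) = angle 0 + 2 * pi * of_int 1"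
    unfolding angle_scale using Ms_pos by (simp add: add_divide_distrib distrib_left del: of_nat_mult)
  then have "height (angle (real (M * s))) \<eta> = height (angle 0) \<eta>"
    "cos (angle (real (M * s))) = cos (angle 0)" "sin (angle (real (M * s))) = sin (angle 0)"
    unfolding height_def by (simp_all only: low_periodic cos_sin_shift)
  then show ?thesis by (simp add: spot_eq cyl_eq_iff)
qed

lemma spot_inner_pole:
  assumes "0 \<le> \<eta>" "\<eta> \<le> real s + 1"
  shows "spot (\<xi>, \<eta>) \<bullet> pole q \<le> cos radius" "0 < \<eta> \<Longrightarrow> spot (\<xi>, \<eta>) \<bullet> pole q < cos radius"
proof -
  let ?z = "height (angle \<xi>) \<eta>"
  have z: "?z \<le> 1" using height_range[of \<eta> "angle \<xi>"] assms by simp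
  have i: "spot (\<xi>, \<eta>) \<bullet> pole q = sqrt (1 - ?z^2) * cos (angle \<xi> - centre q)"
    by (simp add: spot_eq pole_def inner_cyl)
  have lz: "low (angle \<xi>) \<le> ?z" "0 < \<eta> \<Longrightarrow> low (angle \<xi>) < ?z"
    using height_less_iff[of "angle \<xi>" \<eta> 0] height_less_iff[of "angle \<xi>" 0 \<eta>] height_values(1)[of "angle \<xi>"] assms(1)
    by auto
  show "spot (\<xi>, \<eta>) \<bullet> pole q \<le> cos radius" unfolding i by (rule above_low(1)[OF lz(1) z])
  show "spot (\<xi>, \<eta>) \<bullet> pole q < cos radius" if "0 < \<eta>"
    unfolding i by (rule above_low(2)[OF lz(1) z lz(2)[OF that]])
qed

text \<open>Half the angle between different centres lies between pi / M and pi - pi / M, and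
  \<open>radius\<close> is less than pi / M.\<close>

lemma half_angle:
  assumes "q < M" "q' < M" "q \<noteq> q'"
  shows "\<bar>cos ((centre q - centre q') / 2)\<bar> < cos radius" "sin ((centre q - centre q') / 2) \<noteq> 0"
proof -
  define e where "e = (centre q - centre q') / 2"
  have e: "e = pi * (real q - real q') / real M" using M by (simp add: e_def centre_def field_simps)
  have k: "1 \<le> \<bar>real q - real q'\<bar>" "\<bar>real q - real q'\<bar> \<le> real M - 1" using assms by linarith+
  have ae: "\<bar>e\<bar> = pi * \<bar>real q - real q'\<bar> / real M" unfolding e by (simp add: abs_mult)
  have lo: "pi / real M \<le> \<bar>e\<bar>"
    unfolding ae using k M by (intro divide_right_mono) (auto simp: mult_le_cancel_left1)
  have "\<bar>e\<bar> \<le> pi * (real M - 1) / real M"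
    unfolding ae using k M by (intro divide_right_mono mult_left_mono) auto
  also have "\<dots> = pi - pi / real M" using M by (simp add: field_simps)
  finally have hi: "\<bar>e\<bar> \<le> pi - pi / real M" .
  have p: "0 < pi / real M" using M by simp
  have "cos \<bar>e\<bar> \<le> cos (pi / real M)" using lo hi p by (intro cos_monotone_0_pi_le) auto
  moreover have "cos (pi - \<bar>e\<bar>) \<le> cos (pi / real M)" using lo hi p by (intro cos_monotone_0_pi_le) auto
  ultimately have "\<bar>cos \<bar>e\<bar>\<bar> \<le> cos (pi / real M)" by (simp add: cos_diff abs_le_iff)
  then show "\<bar>cos ((centre q - centre q') / 2)\<bar> < cos radius"
    unfolding e_def[symmetric] using cos_radius(1) by simp
  have "0 < sin \<bar>e\<bar>" using lo hi p by (intro sin_gt_zero) auto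
  then show "sin ((centre q - centre q') / 2) \<noteq> 0"
    unfolding e_def[symmetric] by (auto simp: abs_if split: if_splits)
qed

text \<open>Two centres add up to a vector of length 2 |cos e|, with e half the angle between them.
  A point in both caps would have inner product at least 2 cos radius with this sum, which is too
  short for that.\<close>

lemma caps_apart:
  assumes q: "q < M" "q' < M" "q \<noteq> q'" and x: "x \<in> sphere 0 1"
  shows "\<not> (cos radius \<le> x \<bullet> pole q \<and> cos radius \<le> x \<bullet> pole q')"
proof
  assume c: "cos radius \<le> x \<bullet> pole q \<and> cos radius \<le> x \<bullet> pole q'"
  define \<mu> e where "\<mu> = (centre q + centre q') / 2" and "e = (centre q - centre q') / 2"
  have ab: "centre q = \<mu> + e" "centre q' = \<mu> - e" by (simp_all add: \<mu>_def e_def field_simps)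
  have "x \<bullet> pole q + x \<bullet> pole q' = 2 * cos e * (x \<bullet> cyl 1 \<mu> 0)"
    unfolding pole_def inner_add_right[symmetric] ab cyl_sum_diff(2) by simp
  also have "\<dots> \<le> 2 * \<bar>cos e\<bar> * \<bar>x \<bullet> cyl 1 \<mu> 0\<bar>"
    by (metis abs_ge_self abs_mult abs_numeral)
  also have "\<dots> \<le> 2 * \<bar>cos e\<bar> * 1"
    using Cauchy_Schwarz_ineq2[of x "cyl 1 \<mu> 0"] x by (intro mult_left_mono) (auto simp: norm_cyl)
  also have "\<dots> < 2 * cos radius" using half_angle(1)[OF q] by (simp add: e_def)
  finally show False using c by linarith
qed

section \<open>Lower ends of the columns on the circles\<close>

definition "offset c = 2 * pi * (real c + 1 / 2 - real s / 2) / real (M * s)"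

lemma column_angle: "angle (real (q * s + c)) = centre q + offset c"
  using M s by (simp add: angle_def centre_def offset_def field_simps)

lemma offset_mirror: "c < s \<Longrightarrow> offset (s - 1 - c) = - offset c"
proof -
  assume "c < s"
  then have "real (s - 1 - c) + 1 / 2 - real s / 2 = - (real c + 1 / 2 - real s / 2)" by (simp add: of_nat_diff)
  then show ?thesis unfolding offset_def by (simp only: mult_minus_right minus_divide_left)
qed

lemma offset_bound: "c < s \<Longrightarrow> \<bar>offset c\<bar> \<le> radius"
proof -
  assume "c < s"
  then have "real c + 1 \<le> real s" by (simp flip: of_nat_Suc)
  then have "\<bar>real c + 1 / 2 - real s / 2\<bar> \<le> (real s - 1 / 2) / 2"
    by (intro abs_leI) (simp_all add: field_simps)
  then have "2 * pi * \<bar>real c + 1 / 2 - real s / 2\<bar> \<le> 2 * pi * ((real s - 1 / 2) / 2)" by (intro mult_left_mono) auto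
  then have "2 * pi * \<bar>real c + 1 / 2 - real s / 2\<bar> / real (M * s) \<le> pi * (real s - 1 / 2) / real (M * s)"
    by (intro divide_right_mono) auto
  then show ?thesis by (simp add: offset_def radius_def abs_mult)
qed

lemma column_deviation: "c < s \<Longrightarrow> deviation (centre q + offset c) = \<bar>offset c\<bar>"
  using deviation_near[of "centre q + offset c" q] offset_bound[of c] radius_bounds(2) by simp

text \<open>The offset is at most \<open>radius\<close>, so the longitude of the column meets the
  cap and \<open>low\<close> is the height of the circle there.\<close>

lemma column_foot:
  assumes c: "c < s"
  shows "spot (real (q * s + c), 0) \<in> cap_circle (pole q) (cos radius)"
proof -
  let ?\<theta> = "centre q + offset c"
  have "cos radius \<le> cos \<bar>offset c\<bar>"
    using offset_bound[OF c] radius_bounds by (intro cos_monotone_0_pi_le) auto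
  then have "sqrt (1 - (low ?\<theta>)^2) * cos \<bar>offset c\<bar> = cos radius"
    using low_circle(2)[of ?\<theta>] column_deviation[OF c, of q] by simp
  then have "spot (real (q * s + c), 0) \<bullet> pole q = cos radius"
    unfolding spot_eq column_angle height_values(1) pole_def inner_cyl by simp
  moreover have "norm (spot (real (q * s + c), 0)) = 1"
    using low_bounds[of ?\<theta>] unfolding spot_eq column_angle height_values(1) norm_cyl
    by (simp add: power_le_one)
  ultimately show ?thesis by (simp add: cap_circle_def)
qed

text \<open>The reflection negates the offset, and the negated offset is that of the mirrored
  column. Equal deviations give both feet the same height.\<close>

lemma column_reflected:
  assumes q: "q < M" "q' < M" "q \<noteq> q'" and c: "c < s"
  shows "swap_reflection (pole q) (pole q') (spot (real (q * s + c), 0)) = spot (real (q' * s + (s - 1 - c)), 0)"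
proof -
  have c': "s - 1 - c < s" using c by simp
  have "low (centre q' - offset c) = low (centre q + offset c)"
    using column_deviation[OF c, of q] column_deviation[OF c', of q'] offset_mirror[OF c] by (simp add: low_def)
  then show ?thesis
    unfolding spot_eq column_angle height_values(1) offset_mirror[OF c] pole_def
    using swap_reflection_cyl[OF half_angle(2)[OF q], where \<phi> = "offset c"] by simp
qed

text \<open>Cap \<open>j\<close> is put into sector \<open>loc j\<close>; sectors without a cap keep
  their column ends unglued. The chart is \<open>spot\<close> followed by the gluing map, which
  identifies nothing above height 0.\<close>

lemma exists_chart:
  fixes loc :: "nat \<Rightarrow> nat"
  assumes inj: "inj_on loc {..<2 * h}" and rng: "\<And>j. j < 2 * h \<Longrightarrow> loc j < M"
  obtains X :: "(real^3) set topology" and \<Phi> where "sphere_with_handles h X" "polar_chart (M * s) s X \<Phi>"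
    "\<And>i c. i < h \<Longrightarrow> c < s \<Longrightarrow>
      \<Phi> (real (loc (2 * i) * s + c), 0) = \<Phi> (real (loc (2 * i + 1) * s + (s - 1 - c)), 0)"
proof -
  define p where "p j = pole (loc j)" for j
  define t :: "nat \<Rightarrow> real" where "t j = cos radius" for j
  have caps: "disjoint_caps (2 * h) p t"
    unfolding disjoint_caps_def
  proof (intro conjI allI impI)
    fix i assume i: "i < 2 * h"
    show "norm (p i) = 1" by (simp add: p_def pole_def norm_cyl)
    show "-1 < t i" "t i < 1" using cos_radius(3,4) by (simp_all add: t_def)
    fix j assume j: "j < 2 * h" "i \<noteq> j"
    then have "loc i \<noteq> loc j" using inj i by (auto dest: inj_onD)
    from caps_apart[OF rng[OF i] rng[OF j(1)] this]
    show "{x \<in> sphere 0 1. t i \<le> x \<bullet> p i} \<inter> {x \<in> sphere 0 1. t j \<le> x \<bullet> p j} = {}"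
      unfolding t_def p_def by blast
  qed
  define S where "S = holed_sphere (2 * h) p t"
  obtain X :: "(real^3) set topology" and q \<tau> where X: "sphere_with_handles h X"
    and cont: "continuous_map (top_of_set S) X q"
    and clo: "\<And>C. closed C \<Longrightarrow> C \<subseteq> S \<Longrightarrow> closedin X (q ` C)"
    and opn: "\<And>U. openin (top_of_set S) U \<Longrightarrow> (\<And>x y. x \<in> U \<Longrightarrow> y \<in> S \<Longrightarrow> q x = q y \<Longrightarrow> y \<in> U) \<Longrightarrow> openin X (q ` U)"
    and q_eq: "\<And>x y. x \<in> S \<Longrightarrow> y \<in> S \<Longrightarrow> q x = q y \<longleftrightarrow> y = x \<or> y = \<tau> x"
    and off: "\<And>x. x \<in> S \<Longrightarrow> (\<And>j. j < 2 * h \<Longrightarrow> x \<bullet> p j < t j) \<Longrightarrow> \<tau> x = x"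
    and on: "\<And>i x. i < h \<Longrightarrow> x \<in> cap_circle (p (2 * i)) (t (2 * i)) \<Longrightarrow> \<tau> x = swap_reflection (p (2 * i)) (p (2 * i + 1)) x"
    using surface_by_handles[OF caps] unfolding S_def t_def by blast
  define \<Phi> where "\<Phi> = q \<circ> spot"
  define K where "K = {0..real (M * s)} \<times> {0..real s + 1}"
  have K_strip: "K \<subseteq> strip" by (auto simp: K_def strip_def)
  have spot_S: "spot a \<in> S" if a: "a \<in> K" for a
  proof -
    have "spot a \<bullet> p j \<le> t j" for j
      using a spot_inner_pole(1)[of "snd a" "fst a" "loc j"] by (auto simp: K_def p_def t_def)
    then show ?thesis using spot_on_sphere[of a] a K_strip by (auto simp: S_def holed_sphere_def)
  qed
  have high: "\<tau> (spot a) = spot a" if a: "a \<in> K" "0 < snd a" for a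
  proof (rule off[OF spot_S[OF a(1)]])
    show "spot a \<bullet> p j < t j" for j
      using a spot_inner_pole(2)[of "snd a" "fst a" "loc j"] by (auto simp: K_def p_def t_def)
  qed
  have same_spot: "spot a = spot b" if "a \<in> K" "b \<in> K" "0 < snd a" "\<Phi> a = \<Phi> b" for a b
    using q_eq[OF spot_S[OF that(1)] spot_S[OF that(2)]] high[OF that(1,3)] that(4) by (auto simp: \<Phi>_def)
  have compK: "compact K" and compstrip: "compact strip"
    by (auto simp: K_def strip_def intro!: compact_Times)
  have contK: "continuous_on A spot" if "A \<subseteq> strip" for A
    using continuous_on_spot that by (rule continuous_on_subset)
  have "polar_chart (M * s) s X \<Phi>"
  proof (unfold_locales, fold K_def)
    show "2 \<le> M * s" using M s mult_le_mono[of 2 M 1 s] by simp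
    show "1 \<le> s" by (rule s)
    have "continuous_map (top_of_set K) (top_of_set S) spot" using contK[OF K_strip] spot_S by auto
    then show "continuous_map (top_of_set K) X \<Phi>" unfolding \<Phi>_def using cont by (rule continuous_map_compose)
  next
    fix C assume C: "closed C" "C \<subseteq> K"
    then have "compact C" using compK by (metis compact_Int_closed inf.absorb2)
    then have "compact (spot ` C)" using C K_strip by (intro compact_continuous_image contK) auto
    moreover have "spot ` C \<subseteq> S" using C spot_S by auto
    ultimately show "closedin X (\<Phi> ` C)"
      unfolding \<Phi>_def image_comp[symmetric] by (intro clo compact_imp_closed)
  next
    fix U assume U: "openin (top_of_set K) U" and pos: "\<And>a. a \<in> U \<Longrightarrow> 0 < snd a"
      and sat: "\<And>a b. a \<in> U \<Longrightarrow> b \<in> K \<Longrightarrow> \<Phi> a = \<Phi> b \<Longrightarrow> b \<in> U"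
    have UK: "U \<subseteq> K" using U openin_imp_subset by blast
    obtain O1 where O1: "open O1" "U = K \<inter> O1" using U by (auto simp: openin_open)
    \<comment> \<open>The image of \<open>U\<close> under \<open>spot\<close> is the part of
      \<open>S\<close> outside the image of strip - U. The latter set is compact since
      \<open>U\<close> is relatively open in the strip as well, lying above height 0.\<close>
    have Ueq: "strip - U = strip \<inter> - (O1 \<inter> {a. 0 < snd a})"
    proof -
      have "U = strip \<inter> (O1 \<inter> {a. 0 < snd a})"
        using O1 pos K_strip by (auto simp: K_def strip_def)
      then show ?thesis by blast
    qed
    have "open (O1 \<inter> {a :: real \<times> real. 0 < snd a})"
      by (intro open_Int O1 open_Collect_less continuous_intros)
    then have "compact (strip - U)" unfolding Ueq by (intro compact_Int_closed compstrip closed_Compl)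
    then have cl: "closed (spot ` (strip - U))"
      by (intro compact_imp_closed compact_continuous_image contK) auto
    have apart: "spot a \<noteq> spot b" if a: "a \<in> U" and b: "b \<in> strip - U" for a b
    proof
      assume eq: "spot a = spot b"
      have "a \<in> strip" "b \<in> strip" "0 < snd a" using a b UK K_strip pos by auto
      then have "snd a = snd b" using spot_separated[OF _ _ eq] by auto
      then have "b \<in> K" using b \<open>0 < snd a\<close> by (auto simp: K_def strip_def)
      then have "b \<in> U" using sat[OF a] eq by (simp add: \<Phi>_def)
      then show False using b by simp
    qed
    have "spot ` U = S \<inter> - (spot ` (strip - U))"
    proof (intro equalityI subsetI)
      fix x assume "x \<in> spot ` U"
      then show "x \<in> S \<inter> - (spot ` (strip - U))" using apart spot_S UK by auto
    next
      fix x assume x: "x \<in> S \<inter> - (spot ` (strip - U))"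
      then have "x \<in> sphere 0 1" by (auto simp: S_def holed_sphere_def)
      then show "x \<in> spot ` U" using spot_surj x by blast
    qed
    then have "openin (top_of_set S) (spot ` U)" using cl by (metis openin_open open_Compl)
    then show "openin X (\<Phi> ` U)"
      unfolding \<Phi>_def image_comp[symmetric]
    proof (rule opn)
      fix x y assume "x \<in> spot ` U" "y \<in> S" "q x = q y"
      then obtain a where a: "a \<in> U" "x = spot a" by auto
      have "\<tau> x = x" "x \<in> S" using high[of a] spot_S[of a] UK pos[OF a(1)] a by auto
      then show "y \<in> spot ` U" using q_eq[of x y] \<open>y \<in> S\<close> \<open>q x = q y\<close> a by auto
    qed
  next
    fix a b assume ab: "a \<in> K" "b \<in> K" "0 < snd a" "\<Phi> a = \<Phi> b"
    show "a = b \<or> snd a = real s + 1 \<and> snd b = real s + 1 \<or> snd a = snd b \<and> {fst a, fst b} = {0, real (M * s)}"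
      using spot_separated[OF _ _ same_spot[OF ab]] ab K_strip by auto
  next
    show "\<Phi> (0, y) = \<Phi> (real (M * s), y)" for y by (simp only: \<Phi>_def o_apply spot_wrap)
  next
    fix x assume x: "x < M * s"
    have K0: "(real x', 0) \<in> K" if "x' < M * s" for x' using that by (simp add: K_def del: of_nat_mult)
    \<comment> \<open>The only spots glued to a given one are itself and its image under \<tau>.
      Different columns have different feet, as position M s is excluded.\<close>
    have "card {x'. x' < M * s \<and> \<Phi> (real x', 0) = \<Phi> (real x, 0)} \<le> card {spot (real x, 0), \<tau> (spot (real x, 0))}"
    proof (rule card_inj_on_le)
      show "inj_on (\<lambda>x'. spot (real x', 0)) {x'. x' < M * s \<and> \<Phi> (real x', 0) = \<Phi> (real x, 0)}"
      proof (rule inj_onI)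
        fix y y' assume y: "y \<in> {x'. x' < M * s \<and> \<Phi> (real x', 0) = \<Phi> (real x, 0)}"
          "y' \<in> {x'. x' < M * s \<and> \<Phi> (real x', 0) = \<Phi> (real x, 0)}" "spot (real y, 0) = spot (real y', 0)"
        then have "real y < real (M * s)" "real y' < real (M * s)" by (auto simp only: of_nat_less_iff mem_Collect_eq)
        then show "y = y'"
          using spot_separated[OF _ _ y(3)] K0 K_strip y by (auto simp: doubleton_eq_iff simp del: of_nat_mult)
      qed
      show "(\<lambda>x'. spot (real x', 0)) ` {x'. x' < M * s \<and> \<Phi> (real x', 0) = \<Phi> (real x, 0)} \<subseteq> {spot (real x, 0), \<tau> (spot (real x, 0))}"
        using q_eq[OF spot_S[OF K0[OF x]] spot_S[OF K0]] by (auto simp: \<Phi>_def)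
    qed simp
    also have "\<dots> \<le> 2" by (simp add: card_insert_if)
    finally show "card {x'. x' < M * s \<and> \<Phi> (real x', 0) = \<Phi> (real x, 0)} \<le> 2" .
  qed
  moreover have "\<Phi> (real (loc (2 * i) * s + c), 0) = \<Phi> (real (loc (2 * i + 1) * s + (s - 1 - c)), 0)"
    if i: "i < h" and c: "c < s" for i c
  proof -
    have ne: "loc (2 * i) \<noteq> loc (2 * i + 1)" using inj i by (auto dest: inj_onD)
    have M2: "loc (2 * i) < M" "loc (2 * i + 1) < M" using rng i by auto
    have col: "(real (l * s + c'), 0) \<in> K" if "l < M" "c' < s" for l c'
    proof -
      have "l * s + c' < Suc l * s" using that by simp
      also have "\<dots> \<le> M * s" using that by (intro mult_le_mono1) simp
      finally have "real (l * s + c') \<le> real (M * s)" by (simp only: of_nat_le_iff less_imp_le)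
      then show ?thesis by (simp add: K_def)
    qed
    have "\<tau> (spot (real (loc (2 * i) * s + c), 0)) = spot (real (loc (2 * i + 1) * s + (s - 1 - c)), 0)"
      using on[OF i, of "spot (real (loc (2 * i) * s + c), 0)"] column_foot[OF c, of "loc (2 * i)"]
        column_reflected[OF M2 ne c] by (simp add: p_def t_def)
    then show ?thesis
      using q_eq[OF spot_S[OF col[OF M2(1) c]] spot_S[OF col[OF M2(2), of "s - 1 - c"]]] c by (simp add: \<Phi>_def)
  qed
  ultimately show ?thesis using that X by blast
qed

end

section \<open>The lower bounds\<close>

lemma euler_genus_of_handles:
  assumes "sphere_with_handles h X"
  shows "surface_of_euler_genus (2 * h) X"
  using assms unfolding surface_of_euler_genus_def by blast

text \<open>A single block needs no handles, as it cannot be split into two nonempty parts.\<close>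

lemma wired_map_graph:
  fixes g d k s m h :: nat and \<sigma> :: "nat \<Rightarrow> nat"
  assumes k: "k \<ge> 1" and s: "s \<ge> 1" and m: "m \<ge> 1" "4 * m + 1 \<le> d"
    and h: "2 * h \<le> g" "(h = 0 \<and> k = 1) \<or> h = 35 * k"
    and \<sigma>: "\<sigma> permutes {..<35 * k}" "expanding k \<sigma>"
  shows "\<exists>(V :: nat set) E. map_graph g d V E \<and> card V = 140 * k * s * s * m + 1 \<and>
    int (k * s * m div 40) \<le> treewidth V E \<and>
    k * s * m div 40 < (2 * s + 3) * layered_treewidth V E"
proof -
  interpret sphere_grid "70 * k" s
    by unfold_locales (use k s in auto)
  \<comment> \<open>Handle \<open>i\<close> leaves from the even sector 2 i, in block i div 35, and
    arrives at the odd sector 2 \<sigma> i + 1, in block \<sigma> i div 35. Parity and injectivity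
    of \<sigma> keep the sectors distinct.\<close>
  define loc where "loc j = (if even j then j else 2 * \<sigma> (j div 2) + 1)" for j
  have h35: "h \<le> 35 * k" using h by auto
  have \<sigma>_lt: "\<sigma> i < 35 * k" if "i < 35 * k" for i
    using permutes_in_image[OF \<sigma>(1), of i] that by simp
  have loc_even: "loc (2 * i) = 2 * i" and loc_odd: "loc (2 * i + 1) = 2 * \<sigma> i + 1" for i
    by (simp_all add: loc_def)
  have "inj_on loc {..<2 * h}"
  proof (rule inj_onI)
    fix j j' assume j: "j \<in> {..<2 * h}" "j' \<in> {..<2 * h}" "loc j = loc j'"
    have par: "even (loc j) = even j" "even (loc j') = even j'" by (auto simp: loc_def)
    show "j = j'"
    proof (cases "even j")
      case True
      then show ?thesis using j par by (simp add: loc_def)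
    next
      case False
      then have odd: "odd j'" using j par by simp
      then have "\<sigma> (j div 2) = \<sigma> (j' div 2)" using j(3) False by (simp add: loc_def)
      then have "j div 2 = j' div 2" using permutes_inj[OF \<sigma>(1)] by (simp add: inj_eq)
      then show ?thesis using False odd by (metis odd_two_times_div_two_succ)
    qed
  qed
  moreover have "loc j < 70 * k" if "j < 2 * h" for j
  proof (cases "even j")
    case True
    then show ?thesis using that h35 by (simp add: loc_def)
  next
    case False
    have "j div 2 < 35 * k" using that h35 by linarith
    from \<sigma>_lt[OF this] have "2 * \<sigma> (j div 2) + 1 < 70 * k" by linarith
    then show ?thesis using False by (simp add: loc_def)
  qed
  ultimately obtain X :: "(real^3) set topology" and \<Phi>
    where X: "sphere_with_handles h X" "polar_chart (70 * k * s) s X \<Phi>"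
      and glue: "\<And>i c. i < h \<Longrightarrow> c < s \<Longrightarrow>
        \<Phi> (real (loc (2 * i) * s + c), 0) = \<Phi> (real (loc (2 * i + 1) * s + (s - 1 - c)), 0)"
    by (rule exists_chart[of loc h]) blast+
  define glued where "glued = (\<lambda>x x'. \<Phi> (real x, 0) = \<Phi> (real x', 0))"
  have chart: "subdivided_chart (70 * k * s) s X \<Phi> m"
    using X(2) m by (simp add: subdivided_chart_def subdivided_chart_axioms_def)
  have expansion: "\<exists>b\<in>A. \<exists>b'\<in>B. linked s glued b b'"
    if AB: "A \<subseteq> {..<k}" "B \<subseteq> {..<k}" "A \<inter> B = {}" "k \<le> 5 * card A" "k \<le> 5 * card B" for A B
  proof (cases "h = 35 * k")
    case True
    obtain i where i: "i < 35 * k" "i div 35 \<in> A" "\<sigma> i div 35 \<in> B"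
      using \<sigma>(2) AB unfolding expanding_def by blast
    have "linked s glued (i div 35) (\<sigma> i div 35)"
      unfolding linked_def
    proof (intro exI conjI allI impI)
      show "2 * i div 70 = i div 35" "(2 * \<sigma> i + 1) div 70 = \<sigma> i div 35" by presburger+
      fix c assume "c < s"
      then show "glued (2 * i * s + c) ((2 * \<sigma> i + 1) * s + (s - 1 - c))"
        using glue[of i c] i(1) True unfolding glued_def loc_even loc_odd by simp
    qed
    then show ?thesis using i by blast
  next
    case False
    then have "k = 1" using h(2) by auto
    then have "A \<noteq> {}" "B \<noteq> {}" using AB(4,5) by auto
    then show ?thesis using AB(1-3) \<open>k = 1\<close> by (auto simp: subset_singleton_iff lessThan_Suc)
  qed
  show ?thesis
  proof (rule map_graph_of_chart[OF chart euler_genus_of_handles[OF X(1)] h(1) m(2), folded glued_def])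
    fix V :: "nat set" and E \<nu> apex
    assume V: "map_graph g d V E" "card V = 2 * (70 * k * s) * s * m + 1"
      "V = insert apex (case_prod \<nu> ` (grid_edges (70 * k * s) s \<times> {..<m}))"
      "inj_on (case_prod \<nu>) (grid_edges (70 * k * s) s \<times> {..<m})"
      and adj: "\<And>e e' j j'. e \<in> grid_edges (70 * k * s) s \<Longrightarrow> e' \<in> grid_edges (70 * k * s) s \<Longrightarrow>
        meets glued e e' \<Longrightarrow> j < m \<Longrightarrow> j' < m \<Longrightarrow> (e, j) \<noteq> (e', j') \<Longrightarrow> {\<nu> e j, \<nu> e' j'} \<in> E"
      and ap: "\<And>x j. x < 70 * k * s \<Longrightarrow> j < m \<Longrightarrow> {apex, \<nu> (True, x, s - 1) j} \<in> E"
    have simple: "simple_graph V E" using V(1) by (simp add: map_graph_def)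
    interpret G: wired_grid k s m glued V E \<nu> apex
      using k s m(1) simple V(3,4) adj ap expansion by (rule wired_grid.intro)
    have "card V = 140 * k * s * s * m + 1" using V(2) by simp
    then show ?thesis using V(1) G.treewidth_lower G.layered_treewidth_lower by blast
  qed
qed

text \<open>The factors 140, 16 and 141, the last absorbing the polar nation, multiply to 315840,
  just below 562^2 = 315844.\<close>

lemma sqrt_bound:
  fixes g d k s m :: nat
  assumes g: "g + 1 \<le> 140 * k" and d: "d \<le> 16 * m" and pos: "k \<ge> 1" "s \<ge> 1" "m \<ge> 1"
  shows "sqrt (real (g + 1) * real d * real (140 * k * s * s * m + 1)) \<le> 562 * real (k * s * m)"
proof -
  have "1 \<le> k * s * s * m" using pos by simp
  then have n: "140 * k * s * s * m + 1 \<le> 141 * (k * s * s * m)" by (simp add: mult.assoc)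
  have "(g + 1) * d * (140 * k * s * s * m + 1) \<le> (140 * k) * (16 * m) * (141 * (k * s * s * m))"
    by (intro mult_le_mono g d n)
  also have "\<dots> = 315840 * (k * s * m)^2" by (simp add: power2_eq_square)
  also have "\<dots> \<le> 562^2 * (k * s * m)^2" by (rule mult_le_mono1) simp
  finally have "real ((g + 1) * d * (140 * k * s * s * m + 1)) \<le> real ((562 * (k * s * m))^2)"
    unfolding of_nat_le_iff by (simp only: power_mult_distrib)
  then have "sqrt (real ((g + 1) * d * (140 * k * s * s * m + 1))) \<le> sqrt (real ((562 * (k * s * m))^2))"
    by (rule real_sqrt_le_mono)
  also have "sqrt (real ((562 * (k * s * m))^2)) = 562 * real (k * s * m)"
    unfolding of_nat_power real_sqrt_abs abs_of_nat by simp
  finally show ?thesis by (simp only: of_nat_mult of_nat_add)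
qed

lemma arbitrarily_large_map_graphs:
  fixes g d N :: nat
  assumes d: "d \<ge> 8"
  shows "\<exists>n\<ge>N. \<exists>(V :: nat set) E. map_graph g d V E \<and> card V = n \<and>
      real_of_int (treewidth V E) \<ge> 1 / 1000000 * sqrt (real (g + 1) * real d * real n) \<and>
      real (layered_treewidth V E) \<ge> 1 / 1000000 * real (g + 1) * real d"
proof -
  \<comment> \<open>For \<open>g\<close> at least 70 the 35 k handles use genus 70 k \<le> g, and g
    + 1 \<le> 140 k in every case. As \<open>d\<close> is at least 8, d div 8 satisfies both 4 m + 1
    \<le> d and d \<le> 16 m. The depth \<open>s\<close> is free, which gives infinitely many
    sizes.\<close>
  define k h m s where "k = max 1 (g div 70)" and "h = (if g < 70 then 0 else 35 * k)"
    and "m = d div 8" and "s = max N 80"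
  have k: "k \<ge> 1" "g + 1 \<le> 140 * k" "2 * h \<le> g" "(h = 0 \<and> k = 1) \<or> h = 35 * k"
    by (auto simp: k_def h_def)
  have m: "m \<ge> 1" "4 * m + 1 \<le> d" "d \<le> 16 * m" using d unfolding m_def by presburger+
  have s: "s \<ge> 80" "s \<ge> N" "s \<ge> 1" by (auto simp: s_def)
  obtain \<sigma> where \<sigma>: "\<sigma> permutes {..<35 * k}" "expanding k \<sigma>" using exists_expanding_permutation[OF k(1)] by blast
  define w where "w = k * s * m"
  obtain V :: "nat set" and E where V: "map_graph g d V E" "card V = 140 * k * s * s * m + 1"
    "int (w div 40) \<le> treewidth V E" "w div 40 < (2 * s + 3) * layered_treewidth V E"
    using wired_map_graph[OF k(1) s(3) m(1,2) k(3,4) \<sigma>] unfolding w_def by blast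
  have "80 * 1 \<le> w" unfolding w_def using k(1) s m by (metis mult_le_mono mult.assoc mult.commute mult_1 mult_1_right)
  \<comment> \<open>Rounding down the quotient by 40 loses at most a factor 2 once \<open>w\<close>
    is at least 40.\<close>
  then have "w \<le> 80 * (w div 40)" by linarith
  then have w40: "real w \<le> 80 * real (w div 40)" by (simp flip: of_nat_mult)
  have tw: "real w / 80 \<le> real_of_int (treewidth V E)"
  proof -
    have "real (w div 40) \<le> real_of_int (treewidth V E)" using V(3) by linarith
    with w40 show ?thesis by linarith
  qed
  have "sqrt (real (g + 1) * real d * real (card V)) \<le> 562 * real w"
    unfolding V(2) w_def by (rule sqrt_bound[OF k(2) m(3) k(1) s(3) m(1)])
  then have 1: "1 / 1000000 * sqrt (real (g + 1) * real d * real (card V)) \<le> real_of_int (treewidth V E)"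
    using tw by linarith
  have "w \<le> 80 * ((2 * s + 3) * layered_treewidth V E)" using V(4) \<open>w \<le> 80 * (w div 40)\<close> by linarith
  also have "\<dots> \<le> 80 * ((5 * s) * layered_treewidth V E)" using s by (intro mult_le_mono) auto
  finally have "s * (k * m) \<le> s * (400 * layered_treewidth V E)" by (simp add: w_def mult_ac)
  then have km: "k * m \<le> 400 * layered_treewidth V E" using s by simp
  have "(g + 1) * d \<le> (140 * k) * (16 * m)" by (intro mult_le_mono k m)
  also have "\<dots> \<le> 2240 * (400 * layered_treewidth V E)" using mult_le_mono2[OF km, of 2240] by simp
  \<comment> \<open>The larger of the two final constants: 2240 * 400 = 896000, against 562 * 80 for
    treewidth. Both are below the million in the theorem.\<close>
  finally have "real ((g + 1) * d) \<le> real (896000 * layered_treewidth V E)" unfolding of_nat_le_iff by simp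
  then have "real ((g + 1) * d) / 1000000 \<le> real (layered_treewidth V E)" by simp
  then have 2: "1 / 1000000 * real (g + 1) * real d \<le> real (layered_treewidth V E)"
    by (simp only: of_nat_mult)
  have "s * 1 \<le> s * (140 * k * s * m)" using k m s by (intro mult_le_mono2) simp
  also have "\<dots> = 140 * k * s * s * m" by (simp only: mult_ac)
  finally have "N \<le> card V" using s V(2) by linarith
  then show ?thesis using V(1) 1 2 by blast
qed

theorem theorem28:
  shows "\<exists>c::real. c > 0 \<and>
    (\<forall>g d :: nat. d \<ge> 8 \<longrightarrow>
      infinite {n :: nat. \<exists>(V :: nat set) E.
        map_graph g d V E \<and> card V = n \<and>
        real_of_int (treewidth V E) \<ge> c * sqrt (real (g + 1) * real d * real n) \<and>
        real (layered_treewidth V E) \<ge> c * real (g + 1) * real d})"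
proof (intro exI[of _ "1 / 1000000"] conjI allI impI)
  fix g d :: nat
  assume "d \<ge> 8"
  from arbitrarily_large_map_graphs[OF this]
  show "infinite {n :: nat. \<exists>(V :: nat set) E.
        map_graph g d V E \<and> card V = n \<and>
        real_of_int (treewidth V E) \<ge> 1 / 1000000 * sqrt (real (g + 1) * real d * real n) \<and>
        real (layered_treewidth V E) \<ge> 1 / 1000000 * real (g + 1) * real d}"
    unfolding infinite_nat_iff_unbounded_le by blast
qed simp

end
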